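(* The problem $d$-$SC1S$-$R$ — given a binary matrix $M$ and an integer $d\ge0$ (the parameter), decide whether there is a set of at most $d$ rows of $M$ whose deletion yields a matrix with the simultaneous consecutive ones property — is fixed-parameter tractable on $(2,* )$-matrices with running time $O^*(4^d)$ and on $( *,2)$-matrices with running time $O^*(3^d)$.
   Context: A binary matrix has the consecutive ones property (C1P) for rows if its columns can be permuted so that in every row the $1$-entries occur consecutively; it has the C1P for columns if its rows can be permuted so that in every column the $1$-entries occur consecutively. It has the simultaneous consecutive ones property (SC1P) if it has both. A $(2,* )$-matrix has at most two ones in each column; a $( *,2)$-matrix has at most two ones in each row. $O^*(f(d))$ denotes $f(d)\cdot N^{O(1)}$ where $N$ is the input size. *)

theory Defs
  imports
    "Jordan_Normal_Form.DL_Submatrix"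
    "HOL-Combinatorics.Permutations"
    "HOL-Library.Log_Nat"
begin

section \<open>The simultaneous consecutive ones property\<close>

definition binary_mat :: "nat mat \<Rightarrow> bool" where
  "binary_mat M \<longleftrightarrow> elements_mat M \<subseteq> {0, 1}"

definition consecutive_ones :: "nat \<Rightarrow> (nat \<Rightarrow> nat) \<Rightarrow> bool" where
  "consecutive_ones n v \<longleftrightarrow>
     (\<forall>i j k. i \<le> j \<longrightarrow> j \<le> k \<longrightarrow> k < n \<longrightarrow> v i = 1 \<longrightarrow> v k = 1 \<longrightarrow> v j = 1)"

definition C1P_rows :: "nat mat \<Rightarrow> bool" where
  "C1P_rows M \<longleftrightarrow>
     (\<exists>\<sigma>. \<sigma> permutes {..<dim_col M} \<and>
        (\<forall>i<dim_row M. consecutive_ones (dim_col M) (\<lambda>j. M $$ (i, \<sigma> j))))"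

definition C1P_cols :: "nat mat \<Rightarrow> bool" where
  "C1P_cols M \<longleftrightarrow>
     (\<exists>\<pi>. \<pi> permutes {..<dim_row M} \<and>
        (\<forall>j<dim_col M. consecutive_ones (dim_row M) (\<lambda>i. M $$ (\<pi> i, j))))"

definition SC1P :: "nat mat \<Rightarrow> bool" where
  "SC1P M \<longleftrightarrow> C1P_rows M \<and> C1P_cols M"

definition two_star_mat :: "nat mat \<Rightarrow> bool" where
  "two_star_mat M \<longleftrightarrow> (\<forall>j<dim_col M. card {i. i < dim_row M \<and> M $$ (i, j) = 1} \<le> 2)"

definition star_two_mat :: "nat mat \<Rightarrow> bool" where
  "star_two_mat M \<longleftrightarrow> (\<forall>i<dim_row M. card {j. j < dim_col M \<and> M $$ (i, j) = 1} \<le> 2)"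

definition delete_rows :: "nat set \<Rightarrow> nat mat \<Rightarrow> nat mat" where
  "delete_rows R M = submatrix M (- R) UNIV"

definition d_SC1S_R :: "(nat mat \<times> nat) set" where
  "d_SC1S_R = {(M, d). \<exists>R \<subseteq> {..<dim_row M}. card R \<le> d \<and> SC1P (delete_rows R M)}"


section \<open>Random access machines with logarithmic cost\<close>

text \<open>
  The machine has registers and a data memory, both holding natural numbers of arbitrary size.
  The first argument of an instruction is its target register, except in \<open>Store\<close>, whose first
  argument is the register holding the address; the second argument of \<open>Jump_Zero\<close> and the
  argument of \<open>Jump\<close> are absolute program positions. A program is a fixed finite list, so only
  finitely many registers are accessible to it; unbounded storage is reached through
  \<open>Load\<close> and \<open>Store\<close>.
\<close>

datatype instr =
    Const nat nat
  | Add nat nat nat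
  | Sub nat nat nat
  | Load nat nat
  | Store nat nat
  | Jump_Zero nat nat
  | Jump nat

datatype config = Config (pc: nat) (regs: "nat \<Rightarrow> nat") (mem: "nat \<Rightarrow> nat")

text \<open>\<open>Sub\<close> is truncated subtraction.\<close>

fun step :: "instr \<Rightarrow> config \<Rightarrow> config" where
  "step (Const i c)     (Config q r m) = Config (Suc q) (r(i := c)) m"
| "step (Add i j k)     (Config q r m) = Config (Suc q) (r(i := r j + r k)) m"
| "step (Sub i j k)     (Config q r m) = Config (Suc q) (r(i := r j - r k)) m"
| "step (Load i j)      (Config q r m) = Config (Suc q) (r(i := m (r j))) m"
| "step (Store i j)     (Config q r m) = Config (Suc q) r (m(r i := r j))"
| "step (Jump_Zero i l) (Config q r m) = Config (if r i = 0 then l else Suc q) r m"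
| "step (Jump l)        (Config q r m) = Config l r m"

definition bit_length :: "nat \<Rightarrow> nat" where
  "bit_length n = max 1 (floorlog 2 n)"

text \<open>
  Logarithmic cost criterion: an instruction costs the total number of bits of the numbers and
  memory addresses it handles. Register indices and jump targets are constants of the program
  and are not charged.
\<close>

fun cost :: "instr \<Rightarrow> config \<Rightarrow> nat" where
  "cost (Const i c)     (Config q r m) = bit_length c"
| "cost (Add i j k)     (Config q r m) = bit_length (r j) + bit_length (r k)"
| "cost (Sub i j k)     (Config q r m) = bit_length (r j) + bit_length (r k)"
| "cost (Load i j)      (Config q r m) = bit_length (r j) + bit_length (m (r j))"
| "cost (Store i j)     (Config q r m) = bit_length (r i) + bit_length (r j)"
| "cost (Jump_Zero i l) (Config q r m) = bit_length (r i)"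
| "cost (Jump l)        (Config q r m) = 1"

text \<open>
  \<open>halts_in p s t s'\<close>: started in \<open>s\<close>, the program \<open>p\<close> halts in \<open>s'\<close> after a computation of
  total cost \<open>t\<close>. The machine halts when the program counter leaves the program.
\<close>

inductive halts_in :: "instr list \<Rightarrow> config \<Rightarrow> nat \<Rightarrow> config \<Rightarrow> bool" for p where
  halt: "length p \<le> pc s \<Longrightarrow> halts_in p s 0 s"
| step: "pc s < length p \<Longrightarrow> halts_in p (step (p ! pc s) s) t s' \<Longrightarrow>
           halts_in p s (cost (p ! pc s) s + t) s'"

definition initial_config :: "nat list \<Rightarrow> config" where
  "initial_config xs = Config 0 (\<lambda>_. 0) (\<lambda>a. if a < length xs then xs ! a else 0)"

definition accepting :: "config \<Rightarrow> bool" where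
  "accepting s \<longleftrightarrow> regs s 0 \<noteq> 0"

definition input_size :: "nat list \<Rightarrow> nat" where
  "input_size xs = (\<Sum>x\<leftarrow>xs. bit_length x)"


section \<open>Fixed-parameter tractability\<close>

text \<open>
  \<open>fpt_in_time enc \<kappa> I Y f\<close>: the parameterized problem with instances \<open>I\<close>, yes-instances
  \<open>I \<inter> Y\<close>, and parameter \<open>\<kappa>\<close> is decided in time \<open>O\<^sup>*(f)\<close>, that is, \<open>f (\<kappa> x) \<cdot> N\<^bsup>O(1)\<^esup>\<close>, by a
  single program for all instances and all parameter values. Nothing is required of the program
  on inputs that do not encode an element of \<open>I\<close>.
\<close>

definition fpt_in_time ::
    "('a \<Rightarrow> nat list) \<Rightarrow> ('a \<Rightarrow> nat) \<Rightarrow> 'a set \<Rightarrow> 'a set \<Rightarrow> (nat \<Rightarrow> nat) \<Rightarrow> bool" where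
  "fpt_in_time enc \<kappa> I Y f \<longleftrightarrow>
     (\<exists>p c k. \<forall>x\<in>I. \<exists>t s.
        halts_in p (initial_config (enc x)) t s \<and>
        (accepting s \<longleftrightarrow> x \<in> Y) \<and>
        t \<le> c * f (\<kappa> x) * input_size (enc x) ^ k)"

text \<open>The dimensions, the parameter, and the entries in row-major order.\<close>

definition encode_instance :: "nat mat \<times> nat \<Rightarrow> nat list" where
  "encode_instance = (\<lambda>(M, d). dim_row M # dim_col M # d #
     [M $$ (i, j). i \<leftarrow> [0..<dim_row M], j \<leftarrow> [0..<dim_col M]])"

end

theory Submission
  imports Defs
begin

text \<open>
  Call two rows adjacent if they share a one in some column. If every column has at most two ones,
  SC1P holds iff this graph is a disjoint union of paths: walking along the paths orders the rows,
  and the columns are then sorted by the position of their ones. Row deletion is vertex deletion. A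
  vertex with three neighbours forces the deletion of one of four vertices; once there is none, the
  components are paths and cycles, and an arbitrary vertex of each cycle is deleted. If every row has
  at most two ones, the graph lives on the columns and the rows are edges, possibly parallel: three
  edges to distinct neighbours give a three-way branching, and a cycle is best broken at an edge of
  least multiplicity.

  The branching choices are guessed as a string of length \<open>d\<close>, and the program enumerates all
  \<open>4\<^sup>d\<close> or \<open>3\<^sup>d\<close> strings. A single run is a bounded loop program in which all
  values are polynomial in the input size, so that its running time is polynomial by construction,
  also under the logarithmic cost criterion.
\<close>

section \<open>Linear forests and the consecutive ones property\<close>

text \<open>Paths and cycles never occur as objects. A cycle is witnessed by a nonempty vertex set
  of minimum degree two; such sets are closed under union, so there is a largest one, the core. Once
  all degrees are at most two, the component of a core vertex plays the role of its cycle. A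
  solution need not contain the chosen vertex or edge of a cycle, so it is rebuilt on the whole
  component. For parallel edges a solution is only known to contain all copies of some edge of the
  cycle, not of which one; trading them for the copies of another edge never costs more if that edge
  has the fewest copies. The exponential factor cannot come from the loop language, whose loop
  bounds are polynomial. It comes from one backward jump that repeats a polynomial round until a
  counter with \<open>d\<close> digits in base \<open>b\<close> overflows. The rounds share one
  memory, so their cost stays polynomial only under a bound on the memory contents that survives
  exponentially many rounds. The constant caps on stored values provide it.\<close>

definition min_degree_two :: "('a \<Rightarrow> 'a \<Rightarrow> bool) \<Rightarrow> 'a set \<Rightarrow> bool" where
  "min_degree_two E S \<longleftrightarrow> (\<forall>v\<in>S. 2 \<le> card {u\<in>S. E v u})"

text \<open>A finite simple graph contains a cycle iff some nonempty vertex set induces minimum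
  degree two, so the second condition is acyclicity. In this form it can be decided by peeling off
  vertices of small degree.\<close>

definition linear_forest :: "'a set \<Rightarrow> ('a \<Rightarrow> 'a \<Rightarrow> bool) \<Rightarrow> bool" where
  "linear_forest A E \<longleftrightarrow> (\<forall>v\<in>A. card {u\<in>A. E v u} \<le> 2) \<and>
     (\<forall>S\<subseteq>A. S \<noteq> {} \<longrightarrow> \<not> min_degree_two E S)"

text \<open>Vertices at consecutive positions need not be adjacent, so several paths can be placed
  one after the other.\<close>

definition line_layout :: "'a set \<Rightarrow> ('a \<Rightarrow> 'a \<Rightarrow> bool) \<Rightarrow> ('a \<Rightarrow> nat) \<Rightarrow> bool" where
  "line_layout A E f \<longleftrightarrow> inj_on f A \<and>
     (\<forall>a\<in>A. \<forall>b\<in>A. E a b \<longrightarrow> f a = Suc (f b) \<or> f b = Suc (f a))"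

text \<open>\<open>f\<close> may have ties. Elements of equal rank then agree on \<open>P\<close>
  (take \<open>z = x\<close>), so a sort by \<open>f\<close> may break ties in any way.\<close>

definition consec_by :: "('a \<Rightarrow> nat) \<Rightarrow> 'a set \<Rightarrow> ('a \<Rightarrow> bool) \<Rightarrow> bool" where
  "consec_by f A P \<longleftrightarrow>
     (\<forall>x\<in>A. \<forall>y\<in>A. \<forall>z\<in>A. f x \<le> f y \<longrightarrow> f y \<le> f z \<longrightarrow> P x \<longrightarrow> P z \<longrightarrow> P y)"

lemma min_degree_two_mono:
  assumes "min_degree_two E S" "finite S" "\<And>a b. a \<in> S \<Longrightarrow> b \<in> S \<Longrightarrow> E a b \<Longrightarrow> E' a b"
  shows "min_degree_two E' S"
  unfolding min_degree_two_def
proof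
  fix v assume v: "v \<in> S"
  have "card {u\<in>S. E v u} \<le> card {u\<in>S. E' v u}" using assms(2,3) v by (intro card_mono) auto
  then show "2 \<le> card {u\<in>S. E' v u}" using assms(1) v unfolding min_degree_two_def by (meson le_trans)
qed

lemma min_degree_two_nbr:
  assumes "min_degree_two E S" "v \<in> S"
  obtains u where "u \<in> S" "E v u"
proof -
  have "card {u\<in>S. E v u} \<noteq> 0" using assms unfolding min_degree_two_def by fastforce
  then have "{u\<in>S. E v u} \<noteq> {}" by (metis card.empty)
  then show ?thesis using that by blast
qed

lemma linear_forest_subset:
  assumes "linear_forest A E" "B \<subseteq> A" "finite A"
  shows "linear_forest B E"
  unfolding linear_forest_def
proof (intro conjI ballI)
  fix v assume "v \<in> B"
  have "card {u\<in>B. E v u} \<le> card {u\<in>A. E v u}"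
    using assms(2,3) by (intro card_mono) auto
  then show "card {u\<in>B. E v u} \<le> 2"
    using assms \<open>v \<in> B\<close> unfolding linear_forest_def by (meson le_trans subsetD)
qed (use assms in \<open>auto simp: linear_forest_def\<close>)

text \<open>A vertex of degree at most one is inserted next to its neighbour, on the side
  where that neighbour has no neighbour yet.\<close>

lemma linear_forest_layout:
  assumes "finite A" "linear_forest A E" "\<And>a b. E a b \<Longrightarrow> E b a" "\<And>a. \<not> E a a"
  shows "\<exists>f. line_layout A E f"
  using assms(1,2)
proof (induction A rule: finite_psubset_induct)
  case (psubset A)
  show ?case
  proof (cases "A = {}")
    case False
    then obtain v where v: "v \<in> A" "\<not> 2 \<le> card {u\<in>A. E v u}"
      using psubset.prems unfolding linear_forest_def min_degree_two_def by blast
    let ?B = "A - {v}"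
    have "linear_forest ?B E"
      using linear_forest_subset[OF psubset.prems] psubset.hyps by auto
    then obtain f where f: "line_layout ?B E f" using psubset.IH[of ?B] v(1) by auto
    have inj: "inj_on f ?B" and E: "\<And>a b. a \<in> ?B \<Longrightarrow> b \<in> ?B \<Longrightarrow> E a b \<Longrightarrow> f a = Suc (f b) \<or> f b = Suc (f a)"
      using f unfolding line_layout_def by auto
    have fin: "finite {u\<in>A. E v u}" using psubset.hyps by simp
    show ?thesis
    proof (cases "\<exists>u\<in>A. E v u")
      case False
      let ?f = "f(v := Suc (Max (f ` A)))"
      have "f a < Suc (Max (f ` A))" if "a \<in> A" for a
        using psubset.hyps that by (simp add: le_imp_less_Suc)
      then have "inj_on ?f A"
        using inj v(1) unfolding inj_on_def by (metis fun_upd_apply insertE insert_Diff nat_neq_iff)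
      moreover have "\<forall>a\<in>A. \<forall>b\<in>A. E a b \<longrightarrow> ?f a = Suc (?f b) \<or> ?f b = Suc (?f a)"
        using E False assms(3) by auto
      ultimately show ?thesis unfolding line_layout_def by blast
    next
      case True
      then obtain u where u: "u \<in> A" "E v u" by blast
      have uniq: "w = u" if "w \<in> A" "E v w" for w
      proof (rule ccontr)
        assume "w \<noteq> u"
        then have "card {u, w} \<le> card {u\<in>A. E v u}" using u that fin by (intro card_mono) auto
        then show False using \<open>w \<noteq> u\<close> v(2) by simp
      qed
      have uB: "u \<in> ?B" using u assms(4) by auto
      show ?thesis
      proof (cases "\<exists>w\<in>?B. E u w \<and> f w = Suc (f u)")
        case False
        \<comment> \<open>\<open>v\<close> is put right above \<open>u\<close>, and everything above
          \<open>u\<close> moves up by one. Only an edge from \<open>u\<close> to the old position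
          \<open>Suc (f u)\<close> would be stretched, and the case assumption excludes it.\<close>
        define g where "g x = (if x = v then Suc (f u) else if f x \<le> f u then f x else Suc (f x))" for x
        have "inj_on g A"
          using inj unfolding inj_on_def g_def by (auto split: if_splits)
        moreover have "g a = Suc (g b) \<or> g b = Suc (g a)" if ab: "a \<in> A" "b \<in> A" "E a b" for a b
        proof -
          consider "a = v" "b = u" | "b = v" "a = u" | "a \<in> ?B" "b \<in> ?B"
            using ab uniq[of a] uniq[of b] assms(3)[of a b] by blast
          then show ?thesis
          proof cases
            case 3
            have *: "\<not> (f c = f u \<and> f d = Suc (f u))" if "c \<in> ?B" "d \<in> ?B" "E c d" for c d
              using that False inj uB unfolding inj_on_def by blast
            show ?thesis
              using E[OF 3 ab(3)] *[OF 3 ab(3)] *[OF 3(2,1) assms(3)[OF ab(3)]] 3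
              unfolding g_def by auto
          qed (use assms(4) u in \<open>auto simp: g_def\<close>)
        qed
        ultimately show ?thesis unfolding line_layout_def by blast
      next
        case True
        then obtain w where w: "w \<in> ?B" "E u w" "f w = Suc (f u)" by blast
        \<comment> \<open>A neighbour of \<open>u\<close> below \<open>u\<close> would be its third
          one, besides \<open>v\<close> and \<open>w\<close>.\<close>
        have no: False if "x \<in> ?B" "E u x" "Suc (f x) = f u" for x
        proof -
          have "x \<noteq> w" using that w by auto
          then have "card {v, w, x} = 3" using that w by auto
          moreover have "card {v, w, x} \<le> card {y\<in>A. E u y}"
            using u v that w assms(3) psubset.hyps by (intro card_mono) auto
          moreover have "card {y\<in>A. E u y} \<le> 2"
            using psubset.prems u(1) unfolding linear_forest_def by blast
          ultimately show False by linarith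
        qed
        \<comment> \<open>Mirror image: \<open>v\<close> takes the position of \<open>u\<close>,
          while \<open>u\<close> and everything above it move up. Only an edge from \<open>u\<close>
          to the position just below it would be stretched.\<close>
        define g where "g x = (if x = v then f u else if f x < f u then f x else Suc (f x))" for x
        have "inj_on g A"
          using inj unfolding inj_on_def g_def by (auto split: if_splits)
        moreover have "g a = Suc (g b) \<or> g b = Suc (g a)" if ab: "a \<in> A" "b \<in> A" "E a b" for a b
        proof -
          consider "a = v" "b = u" | "b = v" "a = u" | "a \<in> ?B" "b \<in> ?B"
            using ab uniq[of a] uniq[of b] assms(3)[of a b] by blast
          then show ?thesis
          proof cases
            case 3
            have *: "\<not> (f c = f u \<and> Suc (f d) = f u)" if "c \<in> ?B" "d \<in> ?B" "E c d" for c d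
              using that no inj uB unfolding inj_on_def by metis
            show ?thesis
              using E[OF 3 ab(3)] *[OF 3 ab(3)] *[OF 3(2,1) assms(3)[OF ab(3)]] 3
              unfolding g_def by auto
          qed (use assms(4) u in \<open>auto simp: g_def\<close>)
        qed
        ultimately show ?thesis unfolding line_layout_def by blast
      qed
    qed
  qed (auto simp: line_layout_def)
qed

lemma card_le_1_inj:
  assumes "\<And>a b. a \<in> S \<Longrightarrow> b \<in> S \<Longrightarrow> a = b"
  shows "card S \<le> 1"
  using assms by (cases "finite S") (auto simp: card_le_Suc0_iff_eq)

definition shares :: "('a \<Rightarrow> 'b \<Rightarrow> bool) \<Rightarrow> 'b set \<Rightarrow> 'a \<Rightarrow> 'a \<Rightarrow> bool" where
  "shares inc J u v \<longleftrightarrow> u \<noteq> v \<and> (\<exists>j\<in>J. inc u j \<and> inc v j)"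

text \<open>Two rows that share a column are next to each other in the order: a row between them
  would be a third one in that column. So every vertex has at most one neighbour on either side, and
  the topmost vertex of a set has at most one neighbour inside the set.\<close>

lemma consec_linear_forest:
  assumes fin: "finite A" and two: "\<And>j. j \<in> J \<Longrightarrow> card {v\<in>A. inc v j} \<le> 2"
    and inj: "inj_on f A" and con: "\<And>j. j \<in> J \<Longrightarrow> consec_by f A (\<lambda>v. inc v j)"
  shows "linear_forest A (shares inc J)"
proof -
  let ?E = "shares inc J"
  have sym: "?E b a" if "?E a b" for a b using that unfolding shares_def by blast
  have no: False if abc: "a \<in> A" "b \<in> A" "c \<in> A" "f a < f c" "f c < f b" and E: "?E a b" for a b c
  proof -
    obtain j where j: "j \<in> J" "inc a j" "inc b j" using E unfolding shares_def by blast
    have "inc c j" using con[OF j(1)] abc j less_imp_le unfolding consec_by_def by blast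
    then have "card {a, b, c} \<le> card {v\<in>A. inc v j}" using abc j fin by (intro card_mono) auto
    moreover have "a \<noteq> b" "a \<noteq> c" "b \<noteq> c" using abc(4,5) by auto
    then have "card {a, b, c} = 3" by simp
    ultimately show False using two[OF j(1)] by simp
  qed
  have ne: "f a \<noteq> f b" if "a \<in> A" "b \<in> A" "a \<noteq> b" for a b using inj that by (meson inj_onD)
  have lo: "card {u\<in>A. ?E v u \<and> f u < f v} \<le> 1" if "v \<in> A" for v
  proof (rule card_le_1_inj, rule ccontr)
    fix a b assume *: "a \<in> {u\<in>A. ?E v u \<and> f u < f v}" "b \<in> {u\<in>A. ?E v u \<and> f u < f v}" "a \<noteq> b"
    then consider "f a < f b" | "f b < f a" using ne by (metis (no_types, lifting) mem_Collect_eq nat_neq_iff)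
    then show False using no * sym that by cases blast+
  qed
  have hi: "card {u\<in>A. ?E v u \<and> f v < f u} \<le> 1" if "v \<in> A" for v
  proof (rule card_le_1_inj, rule ccontr)
    fix a b assume *: "a \<in> {u\<in>A. ?E v u \<and> f v < f u}" "b \<in> {u\<in>A. ?E v u \<and> f v < f u}" "a \<noteq> b"
    then consider "f a < f b" | "f b < f a" using ne by (metis (no_types, lifting) mem_Collect_eq nat_neq_iff)
    then show False using no * sym that by cases blast+
  qed
  have "card {u\<in>A. ?E v u} \<le> 2" if v: "v \<in> A" for v
  proof -
    have "{u\<in>A. ?E v u} \<subseteq> {u\<in>A. ?E v u \<and> f u < f v} \<union> {u\<in>A. ?E v u \<and> f v < f u}"
      using ne[OF v] unfolding shares_def by (auto simp: neq_iff)
    then have "card {u\<in>A. ?E v u} \<le> card ({u\<in>A. ?E v u \<and> f u < f v} \<union> {u\<in>A. ?E v u \<and> f v < f u})"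
      using fin by (intro card_mono) auto
    also have "\<dots> \<le> card {u\<in>A. ?E v u \<and> f u < f v} + card {u\<in>A. ?E v u \<and> f v < f u}"
      by (rule card_Un_le)
    finally show ?thesis using lo[OF v] hi[OF v] by linarith
  qed
  moreover have "\<not> min_degree_two ?E S" if S: "S \<subseteq> A" "S \<noteq> {}" for S
  proof
    assume m: "min_degree_two ?E S"
    have "finite S" using S fin finite_subset by blast
    then have "Max (f ` S) \<in> f ` S" "\<And>u. u \<in> S \<Longrightarrow> f u \<le> Max (f ` S)"
      using S(2) by (auto intro: Max_in)
    then obtain v where v: "v \<in> S" "\<And>u. u \<in> S \<Longrightarrow> f u \<le> f v" by (metis imageE)
    have "{u\<in>S. ?E v u} \<subseteq> {u\<in>A. ?E v u \<and> f u < f v}"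
    proof
      fix u assume u: "u \<in> {u\<in>S. ?E v u}"
      then have "f u \<noteq> f v" using ne[of u v] S v(1) unfolding shares_def by auto
      then show "u \<in> {u\<in>A. ?E v u \<and> f u < f v}" using u S v(2)[of u] by auto
    qed
    then have "card {u\<in>S. ?E v u} \<le> card {u\<in>A. ?E v u \<and> f u < f v}"
      using fin by (intro card_mono) auto
    also have "\<dots> \<le> 1" using lo v(1) S by blast
    finally show False using m v(1) unfolding min_degree_two_def by fastforce
  qed
  ultimately show ?thesis unfolding linear_forest_def by blast
qed

text \<open>Sort the columns by their position along the paths: the vertex at position \<open>p\<close> owns the
  keys \<open>2p + 1\<close>, \<open>2p + 2\<close>, \<open>2p + 3\<close>, where odd keys belong to columns with two ones.\<close>

lemma layout_consec:
  assumes fin: "finite A" and two: "\<And>j. j \<in> J \<Longrightarrow> card {v\<in>A. inc v j} \<le> 2"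
    and lay: "line_layout A (shares inc J) f"
  shows "\<forall>j\<in>J. consec_by f A (\<lambda>v. inc v j)"
    and "\<exists>g. \<forall>v\<in>A. consec_by g J (inc v)"
proof -
  have inj: "\<And>a b. a \<in> A \<Longrightarrow> b \<in> A \<Longrightarrow> f a = f b \<Longrightarrow> a = b"
    and E: "\<And>a b. a \<in> A \<Longrightarrow> b \<in> A \<Longrightarrow> shares inc J a b \<Longrightarrow> f a = Suc (f b) \<or> f b = Suc (f a)"
    using lay unfolding line_layout_def inj_on_def by auto
  show "\<forall>j\<in>J. consec_by f A (\<lambda>v. inc v j)"
    unfolding consec_by_def
  proof (intro ballI impI)
    fix j x y z
    assume *: "j \<in> J" "x \<in> A" "y \<in> A" "z \<in> A" "f x \<le> f y" "f y \<le> f z" "inc x j" "inc z j"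
    have "x = z \<or> f z = Suc (f x)"
      using E[of x z] * unfolding shares_def by auto
    then have "f y = f x \<or> f y = f z" using * by auto
    then show "inc y j" using inj * by blast
  qed
  define K where "K j = {v\<in>A. inc v j}" for j
  \<comment> \<open>The key is twice the mean of \<open>Suc (f v)\<close> over the ones of the
    column: \<open>2p + 2\<close> for a single one at \<open>p\<close>, \<open>2p + 3\<close> for
    ones at \<open>p\<close> and \<open>p + 1\<close>. An empty column gets 0, which lies below
    every owned key.\<close>
  define g where "g j = (if card (K j) = 1 then 2 else 1) * (\<Sum>v\<in>K j. Suc (f v))" for j
  have key: "inc v j \<longleftrightarrow> 2 * f v + 1 \<le> g j \<and> g j \<le> 2 * f v + 3" if v: "v \<in> A" and j: "j \<in> J" for v j
  proof -
    have finK: "finite (K j)" using fin by (simp add: K_def)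
    have inc: "inc v j \<longleftrightarrow> v \<in> K j" using v by (simp add: K_def)
    have "card (K j) \<le> 2" using two[OF j] by (simp add: K_def)
    then consider "card (K j) = 0" | "card (K j) = 1" | "card (K j) = 2" by linarith
    then show ?thesis
    proof cases
      case 1
      then have "K j = {}" using finK by simp
      then show ?thesis using inc by (simp add: g_def)
    next
      case 2
      then obtain w where w: "K j = {w}" using card_1_singletonE by blast
      then have "g j = 2 * f w + 2" by (simp add: g_def)
      moreover have "w \<in> A" using w by (auto simp: K_def)
      then have "v = w \<longleftrightarrow> f v = f w" using inj[OF v] by blast
      moreover have "f v = f w \<longleftrightarrow> 2 * f v + 1 \<le> 2 * f w + 2 \<and> 2 * f w + 2 \<le> 2 * f v + 3" by linarith
      ultimately show ?thesis using inc w by simp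
    next
      case 3
      then obtain a b where ab: "K j = {a, b}" "a \<noteq> b" by (auto simp: card_2_iff)
      then have g: "g j = f a + f b + 2" by (simp add: g_def)
      have A: "a \<in> A" "b \<in> A" "inc a j" "inc b j" using ab by (auto simp: K_def)
      then have "shares inc J a b" using ab j unfolding shares_def by blast
      then have "f a = Suc (f b) \<or> f b = Suc (f a)" using E A by blast
      then have "f v = f a \<or> f v = f b \<longleftrightarrow> 2 * f v + 1 \<le> f a + f b + 2 \<and> f a + f b + 2 \<le> 2 * f v + 3"
        by linarith
      moreover have "v \<in> K j \<longleftrightarrow> f v = f a \<or> f v = f b" using ab inj[OF v A(1)] inj[OF v A(2)] by auto
      ultimately show ?thesis using inc g by simp
    qed
  qed
  have "consec_by g J (inc v)" if v: "v \<in> A" for v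
    unfolding consec_by_def using key[OF v] by (meson order_trans)
  then show "\<exists>g. \<forall>v\<in>A. consec_by g J (inc v)" by blast
qed

text \<open>A suitable row order already forces a linear forest, and a layout of the forest yields
  the row order and the column order at once.\<close>

lemma consec_iff_linear_forest:
  assumes "finite A" "\<And>j. j \<in> J \<Longrightarrow> card {v\<in>A. inc v j} \<le> 2"
  shows "(\<exists>f. inj_on f A \<and> (\<forall>j\<in>J. consec_by f A (\<lambda>v. inc v j))) \<and>
      (\<exists>g. \<forall>v\<in>A. consec_by g J (inc v)) \<longleftrightarrow> linear_forest A (shares inc J)" (is "?L \<longleftrightarrow> ?R")
proof
  assume ?L
  then obtain f where "inj_on f A" "\<And>j. j \<in> J \<Longrightarrow> consec_by f A (\<lambda>v. inc v j)" by blast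
  then show ?R using assms by (intro consec_linear_forest[where f = f]) auto
next
  assume R: ?R
  have "\<exists>f. line_layout A (shares inc J) f"
    by (rule linear_forest_layout[OF assms(1) R]) (auto simp: shares_def)
  then obtain f where f: "line_layout A (shares inc J) f" by blast
  moreover from layout_consec[where inc = inc and J = J, OF assms(1) _ f]
  have "\<forall>j\<in>J. consec_by f A (\<lambda>v. inc v j)" "\<exists>g. \<forall>v\<in>A. consec_by g J (inc v)"
    using assms(2) by simp_all
  moreover have "inj_on f A" using f by (simp add: line_layout_def)
  ultimately show ?L by blast
qed

section \<open>Rankings, permutations and deleted rows\<close>

lemma sorting_permutation:
  fixes f :: "nat \<Rightarrow> nat"
  shows "\<exists>\<sigma>. \<sigma> permutes {..<N} \<and> (\<forall>i j. i \<le> j \<longrightarrow> j < N \<longrightarrow> f (\<sigma> i) \<le> f (\<sigma> j))"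
proof -
  define xs where "xs = sort_key f [0..<N]"
  have xs: "distinct xs" "set xs = {..<N}" "length xs = N" "sorted (map f xs)"
    by (auto simp: xs_def lessThan_atLeast0)
  define \<sigma> where "\<sigma> i = (if i < N then xs ! i else i)" for i
  have "bij_betw ((!) xs) {..<N} {..<N}" using xs by (intro bij_betw_nth) auto
  then have "bij_betw \<sigma> {..<N} {..<N}" by (subst bij_betw_cong[where g = "(!) xs"]) (auto simp: \<sigma>_def)
  then have "\<sigma> permutes {..<N}" by (rule bij_imp_permutes) (simp add: \<sigma>_def)
  moreover have "f (\<sigma> i) \<le> f (\<sigma> j)" if "i \<le> j" "j < N" for i j
    using that xs sorted_nth_mono[of "map f xs" i j] by (simp add: \<sigma>_def)
  ultimately show ?thesis by blast
qed

lemma permutation_if_consec_by: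
  assumes "\<forall>i\<in>I. consec_by f {..<N} (\<lambda>j. v i j = (1::nat))"
  shows "\<exists>\<sigma>. \<sigma> permutes {..<N} \<and> (\<forall>i\<in>I. consecutive_ones N (\<lambda>j. v i (\<sigma> j)))"
proof -
  obtain \<sigma> where \<sigma>: "\<sigma> permutes {..<N}" "\<forall>i j. i \<le> j \<longrightarrow> j < N \<longrightarrow> f (\<sigma> i) \<le> f (\<sigma> j)"
    using sorting_permutation[of N f] by blast
  have lt: "\<sigma> i < N" if "i < N" for i using permutes_in_image[OF \<sigma>(1), of i] that by simp
  have "consecutive_ones N (\<lambda>j. v i (\<sigma> j))" if i: "i \<in> I" for i
    unfolding consecutive_ones_def
  proof (intro allI impI)
    fix a b c assume *: "a \<le> b" "b \<le> c" "c < N" "v i (\<sigma> a) = 1" "v i (\<sigma> c) = 1"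
    then show "v i (\<sigma> b) = 1"
      using assms[rule_format, OF i, unfolded consec_by_def, rule_format, of "\<sigma> a" "\<sigma> b" "\<sigma> c"]
        \<sigma>(2) lt[of a] lt[of b] lt[of c] by simp
  qed
  then show ?thesis using \<sigma>(1) by blast
qed

lemma consec_by_if_permutation:
  assumes "\<sigma> permutes {..<N}" "\<forall>i\<in>I. consecutive_ones N (\<lambda>j. v i (\<sigma> j))"
  shows "\<exists>f. inj_on f {..<N} \<and> (\<forall>i\<in>I. consec_by f {..<N} (\<lambda>j. v i j = (1::nat)))"
proof (intro exI conjI ballI)
  show "inj_on (inv_into UNIV \<sigma>) {..<N}" using permutes_inj[OF permutes_inv[OF assms(1)]] inj_on_subset by blast
  fix i assume i: "i \<in> I"
  have lt: "inv_into UNIV \<sigma> x < N" if "x < N" for x using permutes_in_image[OF permutes_inv[OF assms(1)], of x] that by simp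
  show "consec_by (inv_into UNIV \<sigma>) {..<N} (\<lambda>j. v i j = 1)"
    unfolding consec_by_def
  proof (intro ballI impI)
    fix x y z
    assume *: "x \<in> {..<N}" "y \<in> {..<N}" "z \<in> {..<N}" "inv_into UNIV \<sigma> x \<le> inv_into UNIV \<sigma> y" "inv_into UNIV \<sigma> y \<le> inv_into UNIV \<sigma> z"
      "v i x = 1" "v i z = 1"
    then have "v i (\<sigma> (inv_into UNIV \<sigma> y)) = 1"
      using assms(2)[rule_format, OF i, unfolded consecutive_ones_def, rule_format, of "inv_into UNIV \<sigma> x" "inv_into UNIV \<sigma> y" "inv_into UNIV \<sigma> z"]
        lt[of z] permutes_inverses(1)[OF assms(1)] by simp
    then show "v i y = 1" by (simp add: permutes_inverses(1)[OF assms(1)])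
  qed
qed

text \<open>Carries rankings over to another numbering, as needed when the rows that survive a
  deletion are renumbered.\<close>

lemma consec_by_bij:
  assumes "bij_betw h B A"
  shows "(\<exists>f. inj_on f B \<and> (\<forall>i\<in>I. consec_by f B (\<lambda>x. P i (h x)))) \<longleftrightarrow>
      (\<exists>f. inj_on f A \<and> (\<forall>i\<in>I. consec_by f A (P i)))" (is "?L \<longleftrightarrow> ?R")
proof
  assume ?L
  then obtain f where f: "inj_on f B" "\<forall>i\<in>I. consec_by f B (\<lambda>x. P i (h x))" by blast
  let ?g = "the_inv_into B h"
  have g: "bij_betw ?g A B" using assms by (rule bij_betw_the_inv_into)
  have "inj_on (f \<circ> ?g) A" using g f(1) by (metis bij_betw_def comp_inj_on)
  moreover have "consec_by (f \<circ> ?g) A (P i)" if "i \<in> I" for i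
    unfolding consec_by_def
  proof (intro ballI impI)
    fix x y z assume *: "x \<in> A" "y \<in> A" "z \<in> A" "(f \<circ> ?g) x \<le> (f \<circ> ?g) y" "(f \<circ> ?g) y \<le> (f \<circ> ?g) z" "P i x" "P i z"
    have "h (?g w) = w" "?g w \<in> B" if "w \<in> A" for w
      using that assms g by (auto simp: f_the_inv_into_f_bij_betw bij_betw_apply)
    then show "P i y" using f(2)[rule_format, OF that, unfolded consec_by_def, rule_format, of "?g x" "?g y" "?g z"] *
      by simp
  qed
  ultimately show ?R by blast
next
  assume ?R
  then obtain f where f: "inj_on f A" "\<forall>i\<in>I. consec_by f A (P i)" by blast
  have "inj_on (f \<circ> h) B" using assms f(1) by (metis bij_betw_def comp_inj_on)
  moreover have "consec_by (f \<circ> h) B (\<lambda>x. P i (h x))" if "i \<in> I" for i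
    unfolding consec_by_def
  proof (intro ballI impI)
    fix x y z assume "x \<in> B" "y \<in> B" "z \<in> B" "(f \<circ> h) x \<le> (f \<circ> h) y" "(f \<circ> h) y \<le> (f \<circ> h) z"
      "P i (h x)" "P i (h z)"
    then show "P i (h y)"
      using f(2)[rule_format, OF that, unfolded consec_by_def, rule_format, of "h x" "h y" "h z"]
        bij_betw_apply[OF assms] by simp
  qed
  ultimately show ?L by blast
qed

lemma consec_by_iff_permutation:
  "(\<exists>\<sigma>. \<sigma> permutes {..<N} \<and> (\<forall>i\<in>I. consecutive_ones N (\<lambda>j. v i (\<sigma> j)))) \<longleftrightarrow>
   (\<exists>f. inj_on f {..<N} \<and> (\<forall>i\<in>I. consec_by f {..<N} (\<lambda>j. v i j = (1::nat))))" (is "?L \<longleftrightarrow> ?R")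
proof
  assume ?L
  then obtain \<sigma> where "\<sigma> permutes {..<N}" "\<forall>i\<in>I. consecutive_ones N (\<lambda>j. v i (\<sigma> j))" by blast
  then show ?R by (rule consec_by_if_permutation)
next
  assume ?R
  then obtain f where "\<forall>i\<in>I. consec_by f {..<N} (\<lambda>j. v i j = (1::nat))" by blast
  then show ?L by (rule permutation_if_consec_by)
qed

lemma C1P_rows_iff:
  "C1P_rows M \<longleftrightarrow> (\<exists>f. inj_on f {..<dim_col M} \<and>
     (\<forall>i\<in>{..<dim_row M}. consec_by f {..<dim_col M} (\<lambda>j. M $$ (i, j) = 1)))"
  using consec_by_iff_permutation[where I = "{..<dim_row M}" and v = "\<lambda>i j. M $$ (i, j)" and N = "dim_col M"]
  by (simp add: C1P_rows_def Ball_def)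

lemma C1P_cols_iff:
  "C1P_cols M \<longleftrightarrow> (\<exists>f. inj_on f {..<dim_row M} \<and>
     (\<forall>j\<in>{..<dim_col M}. consec_by f {..<dim_row M} (\<lambda>i. M $$ (i, j) = 1)))"
  using consec_by_iff_permutation[where I = "{..<dim_col M}" and v = "\<lambda>j i. M $$ (i, j)" and N = "dim_row M"]
  by (simp add: C1P_cols_def Ball_def)

text \<open>A submatrix numbers its rows by \<open>pick\<close> on the infinite set
  \<open>- R\<close>, hence injectively. The first \<open>card ({..<n} - R)\<close> values all lie
  in \<open>{..<n} - R\<close>, and by counting they exhaust it.\<close>

lemma bij_betw_pick_Compl:
  assumes "R \<subseteq> {..<n}"
  shows "bij_betw (pick (- R)) {..<card ({..<n} - R)} ({..<n} - R)"
proof -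
  have inf: "infinite (- R)" using assms finite_subset by fastforce
  have eq: "{i. i < n \<and> i \<in> - R} = {..<n} - R" by auto
  have inj: "inj_on (pick (- R)) {..<card ({..<n} - R)}"
    using pick_eq_iff_inf[OF inf] by (auto simp: inj_on_def)
  have sub: "pick (- R) ` {..<card ({..<n} - R)} \<subseteq> {..<n} - R"
    using pick_le[of _ n "- R"] pick_in_set_inf[OF inf] unfolding eq by auto
  have "card (pick (- R) ` {..<card ({..<n} - R)}) = card ({..<n} - R)"
    using card_image[OF inj] by simp
  then have "pick (- R) ` {..<card ({..<n} - R)} = {..<n} - R"
    using card_subset_eq[OF _ sub] by simp
  then show ?thesis using inj by (simp add: bij_betw_def)
qed

text \<open>Speaks about the original row indices only, so that submatrices and their renumbering do
  not occur in the graph arguments.\<close>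

lemma SC1P_delete_rows_iff:
  fixes M :: "nat mat"
  assumes R: "R \<subseteq> {..<dim_row M}"
  defines "A \<equiv> {..<dim_row M} - R" and "J \<equiv> {..<dim_col M}"
  shows "SC1P (delete_rows R M) \<longleftrightarrow>
     (\<exists>f. inj_on f A \<and> (\<forall>j\<in>J. consec_by f A (\<lambda>i. M $$ (i, j) = 1))) \<and>
     (\<exists>g. inj_on g J \<and> (\<forall>i\<in>A. consec_by g J (\<lambda>j. M $$ (i, j) = 1)))"
proof -
  let ?D = "delete_rows R M" and ?h = "pick (- R)"
  have "{i. i < dim_row M \<and> i \<in> - R} = A" by (auto simp: A_def)
  then have dims: "dim_row ?D = card A" "dim_col ?D = dim_col M"
    unfolding delete_rows_def by (simp_all add: dim_submatrix)
  have ix: "?D $$ (i, j) = M $$ (?h i, j)" if "i < card A" "j < dim_col M" for i j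
    using that \<open>{i. i < dim_row M \<and> i \<in> - R} = A\<close> unfolding delete_rows_def
    by (simp add: submatrix_index pick_UNIV)
  have bij: "bij_betw ?h {..<card A} A" unfolding A_def by (rule bij_betw_pick_Compl[OF R])
  have "C1P_cols ?D \<longleftrightarrow> (\<exists>f. inj_on f {..<card A} \<and>
      (\<forall>j\<in>J. consec_by f {..<card A} (\<lambda>i. M $$ (?h i, j) = 1)))"
    unfolding C1P_cols_iff dims J_def using ix by (simp add: consec_by_def)
  also have "\<dots> \<longleftrightarrow> (\<exists>f. inj_on f A \<and> (\<forall>j\<in>J. consec_by f A (\<lambda>i. M $$ (i, j) = 1)))"
    by (rule consec_by_bij[OF bij, where P = "\<lambda>j i. M $$ (i, j) = 1"])
  finally have cols: "C1P_cols ?D \<longleftrightarrow> \<dots>" .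
  have "(\<forall>i\<in>{..<card A}. consec_by g J (\<lambda>j. ?D $$ (i, j) = 1)) \<longleftrightarrow>
      (\<forall>i\<in>?h ` {..<card A}. consec_by g J (\<lambda>j. M $$ (i, j) = 1))" for g
    using ix by (simp add: consec_by_def J_def)
  then have rows: "C1P_rows ?D \<longleftrightarrow> (\<exists>g. inj_on g J \<and> (\<forall>i\<in>A. consec_by g J (\<lambda>j. M $$ (i, j) = 1)))"
    unfolding bij_betw_imp_surj_on[OF bij] C1P_rows_iff dims by (simp add: J_def)
  show ?thesis unfolding SC1P_def using cols rows by blast
qed

text \<open>Ties are removed by a detour through permutations: enumerate \<open>A\<close>, sort by
  \<open>g\<close>, and rank each element by its place in the sorted order. The predicate is turned
  into a 0/1 row by \<open>of_bool\<close> to fit the lemma on permutations.\<close>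

lemma consec_by_inj_iff:
  assumes "finite A"
  shows "(\<exists>g. inj_on g A \<and> (\<forall>i\<in>I. consec_by g A (P i))) \<longleftrightarrow> (\<exists>g. \<forall>i\<in>I. consec_by g A (P i))"
proof
  assume "\<exists>g. \<forall>i\<in>I. consec_by g A (P i)"
  then obtain g where g: "\<forall>i\<in>I. consec_by g A (P i)" by blast
  define N where "N = card A"
  obtain h where h: "bij_betw h {..<N} A"
    using ex_bij_betw_nat_finite[OF assms] unfolding N_def atLeast0LessThan by blast
  have hA: "h x \<in> A" if "x < N" for x using bij_betw_apply[OF h] that by simp
  have "consec_by (g \<circ> h) {..<N} (\<lambda>x. of_bool (P i (h x)) = (1::nat))" if "i \<in> I" for i
    unfolding consec_by_def of_bool_eq_1_iff
  proof (intro ballI impI)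
    fix x y z assume "x \<in> {..<N}" "y \<in> {..<N}" "z \<in> {..<N}" "(g \<circ> h) x \<le> (g \<circ> h) y"
      "(g \<circ> h) y \<le> (g \<circ> h) z" "P i (h x)" "P i (h z)"
    then show "P i (h y)"
      using g[rule_format, OF that, unfolded consec_by_def, rule_format, of "h x" "h y" "h z"] hA by simp
  qed
  then have "\<exists>f. inj_on f {..<N} \<and> (\<forall>i\<in>I. consec_by f {..<N} (\<lambda>x. of_bool (P i (h x)) = (1::nat)))"
    unfolding consec_by_iff_permutation[where v = "\<lambda>i x. of_bool (P i (h x))", symmetric]
    by (intro permutation_if_consec_by[where f = "g \<circ> h"]) blast
  then show "\<exists>g. inj_on g A \<and> (\<forall>i\<in>I. consec_by g A (P i))"
    unfolding of_bool_eq_1_iff consec_by_bij[OF h, where P = P] .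
qed blast

text \<open>\<open>X\<close> is the set of rows deleted so far; the machine represents it by rows of zeros, which
  leaves deleted rows as isolated vertices of the row graph.\<close>

definition row_graph :: "(nat \<Rightarrow> nat \<Rightarrow> bool) \<Rightarrow> nat \<Rightarrow> nat \<Rightarrow> nat set \<Rightarrow> nat \<Rightarrow> nat \<Rightarrow> bool" where
  "row_graph inc n m X a b \<longleftrightarrow> a < n \<and> b < n \<and> a \<noteq> b \<and>
     (\<exists>j<m. (a \<notin> X \<and> inc a j) \<and> (b \<notin> X \<and> inc b j))"

definition col_graph :: "(nat \<Rightarrow> nat \<Rightarrow> bool) \<Rightarrow> nat \<Rightarrow> nat \<Rightarrow> nat set \<Rightarrow> nat \<Rightarrow> nat \<Rightarrow> bool" where
  "col_graph inc n m X a b \<longleftrightarrow> a < m \<and> b < m \<and> a \<noteq> b \<and>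
     (\<exists>i<n. (i \<notin> X \<and> inc i a) \<and> (i \<notin> X \<and> inc i b))"

text \<open>A vertex outside \<open>A\<close> has no edge in \<open>E'\<close>, so it neither raises
  a degree nor belongs to a set of minimum degree two. This keeps the vertex set fixed while rows
  are deleted.\<close>

lemma linear_forest_isolated:
  assumes "finite B" "A \<subseteq> B" "\<And>a b. a \<in> B \<Longrightarrow> b \<in> B \<Longrightarrow> E' a b \<longleftrightarrow> a \<in> A \<and> b \<in> A \<and> E a b"
  shows "linear_forest A E \<longleftrightarrow> linear_forest B E'"
proof -
  have nb: "{u\<in>B. E' v u} = (if v \<in> A then {u\<in>A. E v u} else {})" if "v \<in> B" for v
    using assms that by auto
  have "min_degree_two E' S \<Longrightarrow> S \<subseteq> A" if "S \<subseteq> B" for S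
  proof
    fix v assume "min_degree_two E' S" "v \<in> S"
    then obtain u where "u \<in> S" "E' v u" by (rule min_degree_two_nbr)
    then show "v \<in> A" using assms that \<open>v \<in> S\<close> by blast
  qed
  moreover have "min_degree_two E' S \<longleftrightarrow> min_degree_two E S" if "S \<subseteq> A" for S
  proof -
    have "{u\<in>S. E' v u} = {u\<in>S. E v u}" if "v \<in> S" for v using assms(2) assms(3)[of v] that \<open>S \<subseteq> A\<close> by blast
    then show ?thesis unfolding min_degree_two_def by simp
  qed
  ultimately have "(\<forall>S\<subseteq>A. S \<noteq> {} \<longrightarrow> \<not> min_degree_two E S) \<longleftrightarrow> (\<forall>S\<subseteq>B. S \<noteq> {} \<longrightarrow> \<not> min_degree_two E' S)"
    using assms(2) by (meson subset_trans)
  moreover have "(\<forall>v\<in>A. card {u\<in>A. E v u} \<le> 2) \<longleftrightarrow> (\<forall>v\<in>B. card {u\<in>B. E' v u} \<le> 2)"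
    using nb assms(2) by (auto split: if_splits)
  ultimately show ?thesis unfolding linear_forest_def by simp
qed

lemma SC1P_two_star_iff:
  assumes "two_star_mat M" "X \<subseteq> {..<dim_row M}"
  shows "SC1P (delete_rows X M) \<longleftrightarrow>
     linear_forest {..<dim_row M} (row_graph (\<lambda>i j. M $$ (i, j) = 1) (dim_row M) (dim_col M) X)"
proof -
  let ?A = "{..<dim_row M} - X" and ?J = "{..<dim_col M}" and ?inc = "\<lambda>i j. M $$ (i, j) = 1"
  have two: "card {v\<in>?A. ?inc v j} \<le> 2" if "j \<in> ?J" for j
  proof -
    have "card {v\<in>?A. ?inc v j} \<le> card {i. i < dim_row M \<and> ?inc i j}" by (intro card_mono) auto
    then show ?thesis using assms(1) that unfolding two_star_mat_def by (meson le_trans lessThan_iff)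
  qed
  have "SC1P (delete_rows X M) \<longleftrightarrow> (\<exists>f. inj_on f ?A \<and> (\<forall>j\<in>?J. consec_by f ?A (\<lambda>v. ?inc v j))) \<and>
      (\<exists>g. \<forall>v\<in>?A. consec_by g ?J (?inc v))"
    unfolding SC1P_delete_rows_iff[OF assms(2)]
    by (subst consec_by_inj_iff[of ?J ?A ?inc]) simp_all
  also have "\<dots> \<longleftrightarrow> linear_forest ?A (shares ?inc ?J)"
    by (rule consec_iff_linear_forest) (use two in auto)
  also have "\<dots> \<longleftrightarrow> linear_forest {..<dim_row M} (row_graph ?inc (dim_row M) (dim_col M) X)"
    by (rule linear_forest_isolated) (auto simp: row_graph_def shares_def)
  finally show ?thesis .
qed

text \<open>The same equivalence with rows and columns exchanged. The surviving rows are now the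
  edges, so a deletion removes a copy of an edge and all vertices stay.\<close>

lemma SC1P_star_two_iff:
  assumes "star_two_mat M" "X \<subseteq> {..<dim_row M}"
  shows "SC1P (delete_rows X M) \<longleftrightarrow>
     linear_forest {..<dim_col M} (col_graph (\<lambda>i j. M $$ (i, j) = 1) (dim_row M) (dim_col M) X)"
proof -
  let ?A = "{..<dim_row M} - X" and ?J = "{..<dim_col M}" and ?inc = "\<lambda>i j. M $$ (i, j) = 1"
  have two: "card {v\<in>?J. ?inc i v} \<le> 2" if "i \<in> ?A" for i
    using assms(1) that unfolding star_two_mat_def by auto
  have "SC1P (delete_rows X M) \<longleftrightarrow> (\<exists>g. inj_on g ?J \<and> (\<forall>i\<in>?A. consec_by g ?J (\<lambda>j. ?inc i j))) \<and>
      (\<exists>f. \<forall>j\<in>?J. consec_by f ?A (\<lambda>v. ?inc v j))"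
    unfolding SC1P_delete_rows_iff[OF assms(2)]
    by (subst consec_by_inj_iff[of ?A ?J "\<lambda>j i. ?inc i j"]) auto
  also have "\<dots> \<longleftrightarrow> linear_forest ?J (shares (\<lambda>j i. ?inc i j) ?A)"
    by (rule consec_iff_linear_forest) (use two in auto)
  also have "\<dots> \<longleftrightarrow> linear_forest ?J (col_graph ?inc (dim_row M) (dim_col M) X)"
    by (rule linear_forest_isolated) (auto simp: col_graph_def shares_def)
  finally show ?thesis .
qed

section \<open>Exchanging solutions on a cycle\<close>

lemma min_degree_two_absorbs:
  assumes "finite A" "\<forall>v\<in>A. card {u\<in>A. E v u} \<le> 2" "T \<subseteq> A" "min_degree_two E' T"
    "\<And>a b. E' a b \<Longrightarrow> E a b" "w \<in> T" "E w u" "u \<in> A"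
  shows "u \<in> T \<and> E' w u"
proof -
  have sub: "{u\<in>T. E' w u} \<subseteq> {u\<in>A. E w u}" using assms by auto
  have fin: "finite {u\<in>A. E w u}" using assms(1) by simp
  have "card {u\<in>A. E w u} \<le> card {u\<in>T. E' w u}"
    using assms(2,3,4,6) unfolding min_degree_two_def by (meson le_trans subsetD)
  then have "{u\<in>T. E' w u} = {u\<in>A. E w u}" 
    by (intro card_subset_eq[OF fin sub] le_antisym card_mono[OF fin sub])
  then show ?thesis using assms(7,8) by blast
qed

text \<open>Degrees in \<open>E\<close> are at most two, and a vertex of \<open>T\<close> has two
  neighbours within \<open>T\<close> already for the smaller relation \<open>E'\<close>. So these
  are all its \<open>E\<close>-neighbours, and \<open>T\<close> swallows whole
  \<open>E\<close>-components.\<close>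

lemma min_degree_two_absorbs_component:
  assumes "finite A" "\<forall>v\<in>A. card {u\<in>A. E v u} \<le> 2" "T \<subseteq> A" "min_degree_two E' T"
    "\<And>a b. E' a b \<Longrightarrow> E a b" "\<And>a b. E a b \<Longrightarrow> a \<in> A \<and> b \<in> A" "w \<in> T" "E\<^sup>*\<^sup>* w u"
  shows "u \<in> T"
  using assms(8,7)
proof (induction rule: rtranclp_induct)
  case (step y z)
  then show ?case using min_degree_two_absorbs[OF assms(1-5)] assms(6) by blast
qed

text \<open>Absorption applied to \<open>C\<close> itself keeps the component \<open>K\<close>
  inside \<open>C\<close>. All neighbours of a vertex of \<open>K\<close> lie in \<open>K\<close>,
  so it loses no degree when passing from \<open>C\<close> to \<open>K\<close>. These components are
  the cycles of the exchange lemmas.\<close>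

lemma component_min_degree_two:
  assumes "finite A" "\<forall>v\<in>A. card {u\<in>A. E v u} \<le> 2" "C \<subseteq> A" "min_degree_two E C"
    "\<And>a b. E a b \<Longrightarrow> a \<in> A \<and> b \<in> A" "v \<in> C"
  defines "K \<equiv> {u. E\<^sup>*\<^sup>* v u}"
  shows "K \<subseteq> C" "min_degree_two E K" "v \<in> K" "\<And>a b. a \<in> K \<Longrightarrow> E a b \<Longrightarrow> b \<in> K"
proof -
  show KC: "K \<subseteq> C"
    using min_degree_two_absorbs_component[OF assms(1-4) _ assms(5) assms(6)] unfolding K_def by auto
  show "v \<in> K" by (simp add: K_def)
  show cl: "b \<in> K" if "a \<in> K" "E a b" for a b
    using that unfolding K_def by (simp add: rtranclp.rtrancl_into_rtrancl)
  show "min_degree_two E K"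
    unfolding min_degree_two_def
  proof
    fix w assume w: "w \<in> K"
    have "finite K" by (rule finite_subset[OF KC finite_subset[OF assms(3,1)]])
    then have "card {u\<in>C. E w u} \<le> card {u\<in>K. E w u}" using cl[OF w] by (intro card_mono) auto
    then show "2 \<le> card {u\<in>K. E w u}" using assms(4) w KC unfolding min_degree_two_def by fastforce
  qed
qed

lemma rtranclp_symmetric:
  assumes "E\<^sup>*\<^sup>* a b" "\<And>a b. E a b \<Longrightarrow> E b a"
  shows "E\<^sup>*\<^sup>* b a"
  using assms(1)
proof (induction rule: rtranclp_induct)
  case (step y z)
  then show ?case using assms(2) converse_rtranclp_into_rtranclp[of E z y a] by simp
qed simp

text \<open>With maximum degree two, every component of the core is a cycle, and a solution that meets
  the cycle may as well meet it in the chosen vertex only.\<close>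

lemma exchange_vertex:
  fixes inc n m X
  defines "E \<equiv> row_graph inc n m"
  assumes deg: "\<forall>v\<in>{..<n}. card {u\<in>{..<n}. E X v u} \<le> 2"
    and C: "C \<subseteq> {..<n}" "min_degree_two (E X) C" "v \<in> C"
    and S: "X \<subseteq> S" "S \<subseteq> {..<n}" "linear_forest {..<n} (E S)"
  shows "\<exists>S'. X \<subseteq> S' \<and> S' \<subseteq> {..<n} \<and> linear_forest {..<n} (E S') \<and> card S' \<le> card S \<and> v \<in> S'"
proof -
  define K where "K = {u. (E X)\<^sup>*\<^sup>* v u}"
  have dom: "a \<in> {..<n} \<and> b \<in> {..<n}" if "E X a b" for a b using that by (auto simp: E_def row_graph_def)
  note comp = component_min_degree_two[where E = "E X", OF _ deg C(1,2) dom C(3), folded K_def, simplified]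
  have nX: "a \<notin> X" if a: "a \<in> K" for a
  proof -
    obtain u where "E X a u" by (rule min_degree_two_nbr[OF comp(2) a])
    then show ?thesis by (auto simp: E_def row_graph_def)
  qed
  have Kn: "K \<subseteq> {..<n}" using comp(1) C(1) by blast
  have "S \<inter> K \<noteq> {}"
  proof
    assume dis: "S \<inter> K = {}"
    have "E S a b" if "a \<in> K" "b \<in> K" "E X a b" for a b
      using that dis unfolding E_def row_graph_def by blast
    then have "min_degree_two (E S) K" by (intro min_degree_two_mono[OF comp(2) finite_subset[OF Kn]]) auto
    then show False using S(3) Kn comp(3) unfolding linear_forest_def by blast
  qed
  \<comment> \<open>\<open>S\<close> meets \<open>K\<close>, as otherwise \<open>K\<close> would
    still have minimum degree two after deleting \<open>S\<close>. So trading
    \<open>S \<inter> K\<close> for the single vertex \<open>v\<close> does not increase the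
    size.\<close>
  define S' where "S' = insert v (S - K)"
  have fS: "finite S" using S(2) finite_subset by blast
  obtain s where "s \<in> S" "s \<in> K" using \<open>S \<inter> K \<noteq> {}\<close> by blast
  then have "card (S - K) < card S" using fS by (intro psubset_card_mono) auto
  then have card: "card S' \<le> card S" unfolding S'_def using fS by (simp add: card_insert_if)
  have XS': "X \<subseteq> S'" using S(1) nX by (auto simp: S'_def)
  have sub: "E X a b" if "E S' a b" for a b using that XS' unfolding E_def row_graph_def by blast
  have "card {u\<in>{..<n}. E S' w u} \<le> card {u\<in>{..<n}. E X w u}" for w
    using sub by (intro card_mono) auto
  then have deg': "\<forall>w\<in>{..<n}. card {u\<in>{..<n}. E S' w u} \<le> 2" using deg by (meson le_trans)
  have "\<not> min_degree_two (E S') T" if T: "T \<subseteq> {..<n}" "T \<noteq> {}" for T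
  proof
    assume mT: "min_degree_two (E S') T"
    show False
    proof (cases "T \<inter> K = {}")
      case True
      have "E S a b" if "a \<in> T" "b \<in> T" "E S' a b" for a b
        using that True unfolding E_def row_graph_def S'_def by blast
      then have "min_degree_two (E S) T" by (intro min_degree_two_mono[OF mT finite_subset[OF T(1)]]) auto
      then show False using S(3) T unfolding linear_forest_def by blast
    next
      case False
      \<comment> \<open>\<open>T\<close> meets the cycle, so it absorbs \<open>v\<close>. But
        \<open>v\<close> is deleted by \<open>S'\<close> and has no neighbour left.\<close>
      then obtain w where w: "w \<in> T" "w \<in> K" by blast
      have "(E X)\<^sup>*\<^sup>* w v"
        by (rule rtranclp_symmetric) (use w in \<open>auto simp: K_def E_def row_graph_def\<close>)
      then have "v \<in> T"
        using min_degree_two_absorbs_component[where E = "E X" and E' = "E S'", OF _ deg T(1) mT sub dom w(1)] by simp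
      then obtain u where "E S' v u" by (rule min_degree_two_nbr[OF mT])
      then show False by (auto simp: E_def row_graph_def S'_def)
    qed
  qed
  then have "linear_forest {..<n} (E S')" using deg' unfolding linear_forest_def by blast
  then show ?thesis using XS' card S(2) C by (intro exI[of _ S']) (auto simp: S'_def)
qed

text \<open>A solution removes all parallel copies of some edge of the cycle, and an edge with the fewest
  copies is the best choice.\<close>

lemma exchange_edge:
  fixes inc n m X
  defines "E \<equiv> col_graph inc n m" and "P \<equiv> \<lambda>a b. {i. i < n \<and> i \<notin> X \<and> inc i a \<and> inc i b}"
  assumes two: "\<forall>i<n. card {j. j < m \<and> inc i j} \<le> 2"
    and deg: "\<forall>v\<in>{..<m}. card {u\<in>{..<m}. E X v u} \<le> 2"
    and C: "C \<subseteq> {..<m}" "min_degree_two (E X) C" "a \<in> C" "b \<in> C" "a \<noteq> b"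
    and r: "r \<in> P a b"
    and min: "\<forall>a'\<in>C. \<forall>b'\<in>C. a' \<noteq> b' \<longrightarrow> P a' b' \<noteq> {} \<longrightarrow> card (P a b) \<le> card (P a' b')"
    and S: "X \<subseteq> S" "S \<subseteq> {..<n}" "linear_forest {..<m} (E S)"
  shows "\<exists>S'. X \<subseteq> S' \<and> S' \<subseteq> {..<n} \<and> linear_forest {..<m} (E S') \<and> card S' \<le> card S \<and> r \<in> S'"
proof -
  define K where "K = {u. (E X)\<^sup>*\<^sup>* a u}"
  have dom: "c \<in> {..<m} \<and> d \<in> {..<m}" if "E X c d" for c d using that by (auto simp: E_def col_graph_def)
  note comp = component_min_degree_two[where E = "E X", OF _ deg C(1,2) dom C(3), folded K_def, simplified]
  have Km: "K \<subseteq> {..<m}" using comp(1) C(1) by blast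
  have Eab: "E X a b" using C r unfolding E_def P_def col_graph_def by blast
  then have bK: "b \<in> K" using comp(3,4) by blast
  have ends: "j = c \<or> j = d" if "i < n" "c < m" "d < m" "j < m" "c \<noteq> d" "inc i c" "inc i d" "inc i j" for i c d j
  proof (rule ccontr)
    assume "\<not> ?thesis"
    then have "card {c, d, j} = 3" using that by auto
    moreover have "card {c, d, j} \<le> card {j. j < m \<and> inc i j}" using that by (intro card_mono) auto
    ultimately show False using two that(1) by fastforce
  qed
  have "\<exists>x\<in>K. \<exists>y\<in>K. E X x y \<and> \<not> E S x y"
  proof (rule ccontr)
    assume "\<not> ?thesis"
    then have "min_degree_two (E S) K"
      by (intro min_degree_two_mono[OF comp(2) finite_subset[OF Km]]) auto
    then show False using S(3) Km comp(3) unfolding linear_forest_def by blast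
  qed
  then obtain x y where xy: "x \<in> K" "y \<in> K" "E X x y" "\<not> E S x y" by blast
  \<comment> \<open>\<open>Q\<close> consists of the rows that are edges inside the cycle.
    \<open>S\<close> contains all copies of its edge between \<open>x\<close> and \<open>y\<close>;
    \<open>S'\<close> gives up everything that \<open>S\<close> has in \<open>Q\<close> and pays
    \<open>P a b\<close>, which has no more elements than \<open>P x y\<close>.\<close>
  define Q where "Q = {i. i < n \<and> i \<notin> X \<and> (\<exists>c\<in>K. \<exists>d\<in>K. c \<noteq> d \<and> inc i c \<and> inc i d)}"
  define S' where "S' = (S - Q) \<union> P a b"
  have fS: "finite S" using S(2) finite_subset by blast
  have xy': "x \<noteq> y" "x < m" "y < m" "P x y \<noteq> {}" using xy(3) by (auto simp: E_def col_graph_def P_def)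
  have PS: "P x y \<subseteq> S \<inter> Q" using xy xy' unfolding P_def E_def col_graph_def Q_def by blast
  have "card (P a b) \<le> card (P x y)" using min xy xy' comp(1) by blast
  also have "\<dots> \<le> card (S \<inter> Q)" using PS fS by (intro card_mono) auto
  finally have "card (P a b) \<le> card (S \<inter> Q)" .
  moreover have "card S' \<le> card (S - Q) + card (P a b)" unfolding S'_def by (rule card_Un_le)
  moreover have "card S = card (S - Q) + card (S \<inter> Q)"
    using card_Int_Diff[OF fS, of Q] by simp
  ultimately have card: "card S' \<le> card S" by linarith
  have XS': "X \<subseteq> S'" using S(1) by (auto simp: S'_def Q_def)
  have S'n: "S' \<subseteq> {..<n}" using S(2) by (auto simp: S'_def P_def)
  have sub: "E X c d" if "E S' c d" for c d using that XS' unfolding E_def col_graph_def by blast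
  have "card {u\<in>{..<m}. E S' w u} \<le> card {u\<in>{..<m}. E X w u}" for w
    using sub by (intro card_mono) auto
  then have deg': "\<forall>w\<in>{..<m}. card {u\<in>{..<m}. E S' w u} \<le> 2" using deg by (meson le_trans)
  have "\<not> min_degree_two (E S') T" if T: "T \<subseteq> {..<m}" "T \<noteq> {}" for T
  proof
    assume mT: "min_degree_two (E S') T"
    show False
    proof (cases "T \<inter> K = {}")
      case True
      have "E S c d" if cd: "c \<in> T" "d \<in> T" "E S' c d" for c d
      proof -
        obtain i where i: "i < n" "i \<notin> S'" "inc i c" "inc i d" "c < m" "d < m" "c \<noteq> d"
          using cd(3) unfolding E_def col_graph_def by blast
        \<comment> \<open>A row has at most two ones. The two of row \<open>i\<close> are in
          \<open>T\<close>, which is disjoint from \<open>K\<close>, so none is left for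
          \<open>K\<close>.\<close>
        have "i \<notin> Q"
        proof
          assume "i \<in> Q"
          then obtain c' where "c' \<in> K" "inc i c'" unfolding Q_def by blast
          then show False using ends[OF i(1,5,6) _ i(7,3,4)] Km True cd by blast
        qed
        then show ?thesis using i unfolding E_def col_graph_def S'_def by blast
      qed
      then have "min_degree_two (E S) T" by (intro min_degree_two_mono[OF mT finite_subset[OF T(1)]]) auto
      then show False using S(3) T unfolding linear_forest_def by blast
    next
      case False
      then obtain w where w: "w \<in> T" "w \<in> K" by blast
      have "(E X)\<^sup>*\<^sup>* w a"
        by (rule rtranclp_symmetric) (use w in \<open>auto simp: K_def E_def col_graph_def\<close>)
      then have "a \<in> T"
        using min_degree_two_absorbs_component[where E = "E X" and E' = "E S'", OF _ deg T(1) mT sub dom w(1)] by simp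
      \<comment> \<open>Absorption also says that the edges of the cycle are present in
        \<open>E S'\<close>, but \<open>S'\<close> deletes every copy of the one between
        \<open>a\<close> and \<open>b\<close>.\<close>
      then have "E S' a b"
        using min_degree_two_absorbs[where E = "E X" and E' = "E S'", OF _ deg T(1) mT sub _ Eab] C by auto
      then obtain i where "i < n" "i \<notin> S'" "inc i a" "inc i b" unfolding E_def col_graph_def by blast
      then show False using XS' unfolding S'_def P_def by blast
    qed
  qed
  then have "linear_forest {..<m} (E S')" using deg' unfolding linear_forest_def by blast
  then show ?thesis using XS' S'n card r by (intro exI[of _ S']) (auto simp: S'_def)
qed

text \<open>From left to right the invariant is that some solution \<open>S\<close> with at most
  \<open>d\<close> elements contains \<open>X w t\<close>, and that \<open>X w t\<close> is either
  good or has exactly \<open>t\<close> elements. Since \<open>safe\<close> provides a possibly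
  different solution, \<open>S\<close> is chosen anew in every step. Conversely,
  \<open>X w d\<close> has at most \<open>d\<close> elements, as each step adds at most one.\<close>

lemma branching_correct:
  fixes OK :: "'a set \<Rightarrow> bool" and pick :: "'a set \<Rightarrow> nat \<Rightarrow> 'a" and X :: "(nat \<Rightarrow> nat) \<Rightarrow> nat \<Rightarrow> 'a set"
  assumes fin: "finite U"
    and pick: "\<And>Y i. Y \<subseteq> U \<Longrightarrow> \<not> OK Y \<Longrightarrow> i < b \<Longrightarrow> pick Y i \<in> U - Y"
    and safe: "\<And>Y S. Y \<subseteq> S \<Longrightarrow> S \<subseteq> U \<Longrightarrow> \<not> OK Y \<Longrightarrow> OK S \<Longrightarrow>
      \<exists>S'. Y \<subseteq> S' \<and> S' \<subseteq> U \<and> OK S' \<and> card S' \<le> card S \<and> (\<exists>i<b. pick Y i \<in> S')"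
    and X0: "\<And>w. X w 0 = {}"
    and XS: "\<And>w t. X w (Suc t) = (if OK (X w t) then X w t else insert (pick (X w t) (w t)) (X w t))"
    and b: "0 < b"
  shows "(\<exists>S\<subseteq>U. card S \<le> d \<and> OK S) \<longleftrightarrow> (\<exists>w. (\<forall>t. w t < b) \<and> OK (X w d))"
proof
  assume "\<exists>S\<subseteq>U. card S \<le> d \<and> OK S"
  then obtain S0 where S0: "S0 \<subseteq> U" "card S0 \<le> d" "OK S0" by blast
  \<comment> \<open>Only the letters before \<open>t\<close> matter for \<open>X w t\<close>, so
    letter \<open>t\<close> can be fixed afterwards.\<close>
  have cong: "X w t = X w' t" if "\<And>s. s < t \<Longrightarrow> w s = w' s" for w w' t
    using that by (induction t) (auto simp: X0 XS)
  have "\<exists>w S. (\<forall>t. w t < b) \<and> X w t \<subseteq> S \<and> S \<subseteq> U \<and> OK S \<and> card S \<le> d \<and> (OK (X w t) \<or> card (X w t) = t)" for t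
  proof (induction t)
    case 0
    then show ?case using S0 b by (intro exI[of _ "\<lambda>_. 0"] exI[of _ S0]) (simp add: X0)
  next
    case (Suc t)
    then obtain w S where w: "\<forall>t. w t < b" "X w t \<subseteq> S" "S \<subseteq> U" "OK S" "card S \<le> d" "OK (X w t) \<or> card (X w t) = t"
      by blast
    show ?case
    proof (cases "OK (X w t)")
      case True
      then show ?thesis using w by (intro exI[of _ w] exI[of _ S]) (simp add: XS)
    next
      case False
      then obtain S' i where S': "X w t \<subseteq> S'" "S' \<subseteq> U" "OK S'" "card S' \<le> card S" "i < b" "pick (X w t) i \<in> S'"
        using safe[OF w(2,3) _ w(4)] by blast
      define w' where "w' = w(t := i)"
      have eq: "X w' t = X w t" by (rule cong) (simp add: w'_def)
      have X: "X w' (Suc t) = insert (pick (X w t) i) (X w t)" using False by (simp add: XS eq) (simp add: w'_def)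
      have "pick (X w t) i \<notin> X w t" using pick[of "X w t" i] w False S'(5) by blast
      moreover have "finite (X w t)" using w fin finite_subset by metis
      ultimately have "card (X w' (Suc t)) = Suc t" using X w(6) False by simp
      moreover have "\<forall>t. w' t < b" using w(1) S'(5) by (simp add: w'_def)
      ultimately show ?thesis using S' w(5) X by (intro exI[of _ w'] exI[of _ S']) auto
    qed
  qed
  then obtain w S where w: "\<forall>t. w t < b" "X w d \<subseteq> S" "S \<subseteq> U" "OK S" "card S \<le> d" "OK (X w d) \<or> card (X w d) = d"
    by blast
  \<comment> \<open>If every step has added an element, there is no room left between
    \<open>X w d\<close> and the solution around it.\<close>
  have "X w d = S" if "card (X w d) = d"
    using card_subset_eq[of S "X w d"] card_mono[of S "X w d"] w that fin finite_subset by (metis le_antisym)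
  then show "\<exists>w. (\<forall>t. w t < b) \<and> OK (X w d)" using w by metis
next
  assume "\<exists>w. (\<forall>t. w t < b) \<and> OK (X w d)"
  then obtain w where w: "\<forall>t. w t < b" "OK (X w d)" by blast
  have "X w t \<subseteq> U \<and> card (X w t) \<le> t" for t
  proof (induction t)
    case (Suc t)
    then have "finite (X w t)" using fin finite_subset by metis
    then show ?case using Suc pick[of "X w t" "w t"] w(1) by (auto simp: XS card_insert_if)
  qed (simp add: X0)
  then show "\<exists>S\<subseteq>U. card S \<le> d \<and> OK S" using w by blast
qed

section \<open>The branching rule\<close>

text \<open>The default \<open>N\<close> is out of range; the program recognizes a failed search by
  comparing the result with \<open>N\<close>.\<close>

definition least_below :: "nat \<Rightarrow> (nat \<Rightarrow> bool) \<Rightarrow> nat" where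
  "least_below N Q = (if \<exists>j<N. Q j then LEAST j. Q j else N)"

lemma least_below_less:
  assumes "j < N" "Q j"
  shows "least_below N Q < N" "Q (least_below N Q)"
proof -
  have "least_below N Q = (LEAST j. Q j)" using assms by (auto simp: least_below_def)
  moreover have "(LEAST j. Q j) \<le> j" using assms by (simp add: Least_le)
  ultimately show "least_below N Q < N" using assms by simp
  show "Q (least_below N Q)"
    using \<open>least_below N Q = _\<close> assms(2) LeastI by metis
qed

lemma least_below_eq: "(\<And>j. j < N \<Longrightarrow> \<not> Q j) \<Longrightarrow> least_below N Q = N"
  by (auto simp: least_below_def)

lemma least_below_eq_iff: "least_below N Q = N \<longleftrightarrow> (\<forall>j<N. \<not> Q j)"
  using least_below_less(1)[of _ N Q] least_below_eq[of N Q] by (metis less_irrefl)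

definition claw :: "nat \<Rightarrow> (nat \<Rightarrow> nat \<Rightarrow> bool) \<Rightarrow> nat" where
  "claw N E = least_below N (\<lambda>v. 3 \<le> card {u. u < N \<and> E v u})"

definition nbr1 :: "nat \<Rightarrow> (nat \<Rightarrow> nat \<Rightarrow> bool) \<Rightarrow> nat" where
  "nbr1 N E = least_below N (\<lambda>u. E (claw N E) u)"

definition nbr2 :: "nat \<Rightarrow> (nat \<Rightarrow> nat \<Rightarrow> bool) \<Rightarrow> nat" where
  "nbr2 N E = least_below N (\<lambda>u. E (claw N E) u \<and> u \<noteq> nbr1 N E)"

definition nbr3 :: "nat \<Rightarrow> (nat \<Rightarrow> nat \<Rightarrow> bool) \<Rightarrow> nat" where
  "nbr3 N E = least_below N (\<lambda>u. E (claw N E) u \<and> u \<noteq> nbr1 N E \<and> u \<noteq> nbr2 N E)"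

text \<open>The 2-core of the graph.\<close>

definition core :: "nat \<Rightarrow> (nat \<Rightarrow> nat \<Rightarrow> bool) \<Rightarrow> nat set" where
  "core N E = \<Union>{T. T \<subseteq> {..<N} \<and> min_degree_two E T}"

lemma claw_le: "claw N E \<le> N"
  unfolding claw_def using least_below_less least_below_eq by (metis (no_types, lifting) le_less)

lemma claw_nbrs:
  assumes "claw N E < N"
  shows "nbr1 N E < N" "E (claw N E) (nbr1 N E)" "nbr2 N E < N" "E (claw N E) (nbr2 N E)"
    "nbr3 N E < N" "E (claw N E) (nbr3 N E)" "nbr1 N E \<noteq> nbr2 N E" "nbr1 N E \<noteq> nbr3 N E" "nbr2 N E \<noteq> nbr3 N E"
proof -
  have three: "3 \<le> card {u. u < N \<and> E (claw N E) u}"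
    using assms least_below_eq_iff[of N "\<lambda>v. 3 \<le> card {u. u < N \<and> E v u}"]
      least_below_less(2)[of _ N "\<lambda>v. 3 \<le> card {u. u < N \<and> E v u}"]
    unfolding claw_def[symmetric] by (metis less_irrefl)
  have ex: "\<exists>u<N. E (claw N E) u \<and> u \<notin> A" if "finite A" "card A < 3" for A
  proof (rule ccontr)
    assume "\<not> ?thesis"
    then have "{u. u < N \<and> E (claw N E) u} \<subseteq> A" by blast
    then have "card {u. u < N \<and> E (claw N E) u} \<le> card A" by (rule card_mono[OF that(1)])
    then show False using three that(2) by linarith
  qed
  obtain u1 where "u1 < N" "E (claw N E) u1" using ex[of "{}"] by auto
  from least_below_less[of _ _ "\<lambda>u. E (claw N E) u", OF this, folded nbr1_def]
  show "nbr1 N E < N" "E (claw N E) (nbr1 N E)" .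
  obtain u2 where "u2 < N" "E (claw N E) u2 \<and> u2 \<noteq> nbr1 N E" using ex[of "{nbr1 N E}"] by auto
  from least_below_less[of _ _ "\<lambda>u. E (claw N E) u \<and> u \<noteq> nbr1 N E", OF this, folded nbr2_def]
  show "nbr2 N E < N" "E (claw N E) (nbr2 N E)" "nbr1 N E \<noteq> nbr2 N E" by auto
  have "card {nbr1 N E, nbr2 N E} < 3" by (simp add: card_insert_if)
  then have "\<exists>u<N. E (claw N E) u \<and> u \<noteq> nbr1 N E \<and> u \<noteq> nbr2 N E"
    using ex[of "{nbr1 N E, nbr2 N E}"] by auto
  then obtain u where u: "u < N" "E (claw N E) u \<and> u \<noteq> nbr1 N E \<and> u \<noteq> nbr2 N E" by blast
  from least_below_less[of _ _ "\<lambda>u. E (claw N E) u \<and> u \<noteq> nbr1 N E \<and> u \<noteq> nbr2 N E", OF u, folded nbr3_def]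
  show "nbr3 N E < N" "E (claw N E) (nbr3 N E)" "nbr1 N E \<noteq> nbr3 N E" "nbr2 N E \<noteq> nbr3 N E" by auto
qed

lemma core_subset: "core N E \<subseteq> {..<N}"
  by (auto simp: core_def)

lemma min_degree_two_core: "min_degree_two E (core N E)"
  unfolding min_degree_two_def
proof
  fix v assume "v \<in> core N E"
  then obtain T where T: "T \<subseteq> {..<N}" "min_degree_two E T" "v \<in> T" by (auto simp: core_def)
  have "T \<subseteq> core N E" using T by (auto simp: core_def)
  moreover have "finite (core N E)" using core_subset finite_subset by blast
  ultimately have "card {u\<in>T. E v u} \<le> card {u\<in>core N E. E v u}" by (intro card_mono) auto
  then show "2 \<le> card {u\<in>core N E. E v u}" using T unfolding min_degree_two_def by fastforce
qed

lemma core_greatest: "T \<subseteq> {..<N} \<Longrightarrow> min_degree_two E T \<Longrightarrow> T \<subseteq> core N E"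
  by (auto simp: core_def)

text \<open>Replaces the quantification over all vertex sets by two tests that take polynomial
  time.\<close>

lemma linear_forest_iff_claw_core:
  "linear_forest {..<N} E \<longleftrightarrow> claw N E = N \<and> core N E = {}"
proof -
  have "(\<forall>v\<in>{..<N}. card {u\<in>{..<N}. E v u} \<le> 2) \<longleftrightarrow> claw N E = N"
    unfolding claw_def least_below_eq_iff by (auto simp: not_le le_less_Suc_eq less_Suc_eq_le numeral_3_eq_3 numeral_2_eq_2)
  moreover have "(\<forall>S\<subseteq>{..<N}. S \<noteq> {} \<longrightarrow> \<not> min_degree_two E S) \<longleftrightarrow> core N E = {}"
    using core_greatest[of _ N E] core_subset[of N E] min_degree_two_core[of E N] by (metis subset_empty)
  ultimately show ?thesis unfolding linear_forest_def by simp
qed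

lemma claw_not_linear_forest:
  fixes N :: nat
  assumes "linear_forest {..<N} E" "v < N" "a < N" "b < N" "c < N" "a \<noteq> b" "a \<noteq> c" "b \<noteq> c"
    "E v a" "E v b" "E v c"
  shows False
proof -
  have "finite {u\<in>{..<N}. E v u}" by (rule finite_subset[of _ "{..<N}"]) auto
  then have "card {a, b, c} \<le> card {u\<in>{..<N}. E v u}" using assms(2-) by (intro card_mono) auto
  moreover have "card {a, b, c} = 3" using assms by simp
  moreover have "card {u\<in>{..<N}. E v u} \<le> 2" using assms(1,2) by (simp add: linear_forest_def)
  ultimately show False by linarith
qed

text \<open>The branch number \<open>i\<close> matters only at a claw. On a cycle any vertex is a
  safe choice, so all branches agree.\<close>

definition row_pick :: "(nat \<Rightarrow> nat \<Rightarrow> bool) \<Rightarrow> nat \<Rightarrow> nat \<Rightarrow> nat set \<Rightarrow> nat \<Rightarrow> nat" where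
  "row_pick inc n m X i = (let E = row_graph inc n m X in
     if claw n E < n then
       if i = 0 then claw n E else if i = 1 then nbr1 n E else if i = 2 then nbr2 n E else nbr3 n E
     else least_below n (\<lambda>v. v \<in> core n E))"

text \<open>The chosen vertex has a neighbour in the current graph, whereas deleted rows are
  isolated there.\<close>

lemma row_pick:
  assumes "\<not> linear_forest {..<n} (row_graph inc n m X)"
  shows "row_pick inc n m X i \<in> {..<n} - X"
proof (cases "claw n (row_graph inc n m X) < n")
  case True
  note nb = claw_nbrs[OF True]
  show ?thesis using True nb(2,4,6) unfolding row_pick_def Let_def row_graph_def by auto
next
  case False
  let ?E = "row_graph inc n m X"
  have "claw n ?E = n" using False claw_le[of _ ?E] by (metis le_neq_implies_less)
  then have "core n ?E \<noteq> {}" using assms linear_forest_iff_claw_core by metis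
  then obtain v where "v \<in> core n ?E" "v < n" using core_subset by blast
  from least_below_less[OF this(2), of "\<lambda>v. v \<in> core n ?E", OF this(1)]
  have p: "row_pick inc n m X i < n" "row_pick inc n m X i \<in> core n ?E"
    using False unfolding row_pick_def Let_def by simp_all
  obtain u where "?E (row_pick inc n m X i) u" by (rule min_degree_two_nbr[OF min_degree_two_core p(2)])
  then show ?thesis by (auto simp: row_graph_def)
qed

text \<open>If \<open>S\<close> avoids the claw, all four vertices keep their edges and a vertex of
  degree three survives, so some branch already agrees with \<open>S\<close>. Without a claw, the
  exchange on a cycle applies.\<close>

lemma row_pick_safe:
  assumes "X \<subseteq> S" "S \<subseteq> {..<n}" "\<not> linear_forest {..<n} (row_graph inc n m X)"
    "linear_forest {..<n} (row_graph inc n m S)"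
  shows "\<exists>S'. X \<subseteq> S' \<and> S' \<subseteq> {..<n} \<and> linear_forest {..<n} (row_graph inc n m S') \<and>
      card S' \<le> card S \<and> (\<exists>i<4. row_pick inc n m X i \<in> S')"
proof (cases "claw n (row_graph inc n m X) < n")
  case True
  let ?E = "row_graph inc n m X"
  note nb = claw_nbrs[OF True]
  have "claw n ?E \<in> S \<or> nbr1 n ?E \<in> S \<or> nbr2 n ?E \<in> S \<or> nbr3 n ?E \<in> S"
  proof (rule ccontr)
    assume *: "\<not> ?thesis"
    have E: "row_graph inc n m S (claw n ?E) u" if "?E (claw n ?E) u" "u \<notin> S" for u
      using that * unfolding row_graph_def by blast
    show False
      using claw_not_linear_forest[OF assms(4) True nb(1,3,5,7,8,9)] E nb * by blast
  qed
  then have "row_pick inc n m X 0 \<in> S \<or> row_pick inc n m X 1 \<in> S \<or> row_pick inc n m X 2 \<in> S \<or> row_pick inc n m X 3 \<in> S"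
    using True by (simp add: row_pick_def)
  moreover have "(0::nat) < 4" "(1::nat) < 4" "(2::nat) < 4" "(3::nat) < 4" by simp_all
  ultimately have "\<exists>i<4. row_pick inc n m X i \<in> S" by blast
  then show ?thesis using assms by blast
next
  case False
  let ?E = "row_graph inc n m X"
  have cl: "claw n ?E = n" using False claw_le[of _ ?E] by (metis le_neq_implies_less)
  then have "core n ?E \<noteq> {}" using assms(3) linear_forest_iff_claw_core by metis
  then obtain v where "v \<in> core n ?E" "v < n" using core_subset by blast
  from least_below_less[OF this(2), of "\<lambda>v. v \<in> core n ?E", OF this(1)]
  have p: "row_pick inc n m X 0 \<in> core n ?E"
    using False unfolding row_pick_def Let_def by simp_all
  have deg: "\<forall>v\<in>{..<n}. card {u\<in>{..<n}. ?E v u} \<le> 2"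
    using cl unfolding claw_def least_below_eq_iff by (auto simp: not_le)
  from exchange_vertex[OF deg core_subset min_degree_two_core p assms(1,2,4)]
  show ?thesis by (metis zero_less_numeral)
qed

text \<open>Phrased with cardinalities because the program can only count; for
  \<open>r \<notin> X\<close> it says that the edge \<open>r\<close> has both ends in the
  core.\<close>

definition core_edge :: "(nat \<Rightarrow> nat \<Rightarrow> bool) \<Rightarrow> nat \<Rightarrow> nat \<Rightarrow> nat set \<Rightarrow> nat \<Rightarrow> bool" where
  "core_edge inc n m X r \<longleftrightarrow>
     2 \<le> card {j. j < m \<and> (r \<notin> X \<and> inc r j) \<and> j \<in> core m (col_graph inc n m X)}"

text \<open>With at most two ones per row, sharing two ones with \<open>r\<close> means being
  parallel to \<open>r\<close>. For an undeleted row \<open>r\<close> with two ones,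
  \<open>r\<close> itself is counted.\<close>

definition row_copies :: "(nat \<Rightarrow> nat \<Rightarrow> bool) \<Rightarrow> nat \<Rightarrow> nat \<Rightarrow> nat set \<Rightarrow> nat \<Rightarrow> nat" where
  "row_copies inc n m X r =
     card {i. i < n \<and> 2 \<le> card {j. j < m \<and> (i \<notin> X \<and> inc i j) \<and> (r \<notin> X \<and> inc r j)}}"

definition col_pick :: "(nat \<Rightarrow> nat \<Rightarrow> bool) \<Rightarrow> nat \<Rightarrow> nat \<Rightarrow> nat set \<Rightarrow> nat \<Rightarrow> nat" where
  "col_pick inc n m X i = (let E = col_graph inc n m X;
       u = (if i = 0 then nbr1 m E else if i = 1 then nbr2 m E else nbr3 m E) in
     if claw m E < m then least_below n (\<lambda>r. (r \<notin> X \<and> inc r (claw m E)) \<and> (r \<notin> X \<and> inc r u))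
     else least_below n (\<lambda>r. core_edge inc n m X r \<and>
       (\<forall>r'<n. core_edge inc n m X r' \<longrightarrow> row_copies inc n m X r \<le> row_copies inc n m X r')))"

lemma col_graph_pick:
  assumes "col_graph inc n m X a b"
  defines "r \<equiv> least_below n (\<lambda>r. (r \<notin> X \<and> inc r a) \<and> (r \<notin> X \<and> inc r b))"
  shows "r < n" "r \<notin> X" "inc r a" "inc r b"
proof -
  obtain i where i: "i < n" "(i \<notin> X \<and> inc i a) \<and> (i \<notin> X \<and> inc i b)"
    using assms(1) unfolding col_graph_def by blast
  from least_below_less[of i n "\<lambda>r. (r \<notin> X \<and> inc r a) \<and> (r \<notin> X \<and> inc r b)", OF i]
  show "r < n" "r \<notin> X" "inc r a" "inc r b" unfolding r_def by blast+
qed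

lemma col_graph_pick_persists:
  assumes "col_graph inc n m X a b" "least_below n (\<lambda>r. (r \<notin> X \<and> inc r a) \<and> (r \<notin> X \<and> inc r b)) \<notin> S"
  shows "col_graph inc n m S a b"
  using assms(1) col_graph_pick[OF assms(1)] assms(2) unfolding col_graph_def by blast

lemma two_le_card_iff:
  fixes S :: "nat set"
  assumes "finite S"
  shows "2 \<le> card S \<longleftrightarrow> (\<exists>a\<in>S. \<exists>b\<in>S. a \<noteq> b)"
proof -
  have "2 \<le> card S \<longleftrightarrow> \<not> card S \<le> Suc 0" by linarith
  then show ?thesis unfolding card_le_Suc0_iff_eq[OF assms] by blast
qed

lemma core_edge_iff:
  "core_edge inc n m X r \<longleftrightarrow> r \<notin> X \<and> (\<exists>a\<in>core m (col_graph inc n m X). \<exists>b\<in>core m (col_graph inc n m X).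
     a \<noteq> b \<and> inc r a \<and> inc r b)"
  unfolding core_edge_def
  by (subst two_le_card_iff) (use core_subset[of m "col_graph inc n m X"] in auto)

text \<open>Row \<open>r\<close> has no ones besides \<open>a\<close> and \<open>b\<close>, so a row
  shares two ones with it iff it has ones in both.\<close>

lemma row_copies_eq:
  assumes two: "\<forall>i<n. card {j. j < m \<and> inc i j} \<le> 2"
    and r: "r < n" "r \<notin> X" "inc r a" "inc r b" "a \<noteq> b" "a < m" "b < m"
  shows "row_copies inc n m X r = card {i. i < n \<and> i \<notin> X \<and> inc i a \<and> inc i b}"
proof -
  have ab: "{j. j < m \<and> inc r j} = {a, b}"
  proof (rule card_seteq[symmetric])
    show "{a, b} \<subseteq> {j. j < m \<and> inc r j}" using r by auto
    show "card {j. j < m \<and> inc r j} \<le> card {a, b}" using two[rule_format, OF r(1)] r(5) by simp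
  qed simp
  have "2 \<le> card {j. j < m \<and> (i \<notin> X \<and> inc i j) \<and> (r \<notin> X \<and> inc r j)} \<longleftrightarrow> i \<notin> X \<and> inc i a \<and> inc i b" for i

  proof -
    have eq: "{j. j < m \<and> (i \<notin> X \<and> inc i j) \<and> (r \<notin> X \<and> inc r j)} = {j\<in>{a, b}. i \<notin> X \<and> inc i j}"
      using ab r(2) by blast
    show ?thesis unfolding eq using r(5) by (subst two_le_card_iff) auto
  qed
  then show ?thesis unfolding row_copies_def by simp
qed

lemma col_pick_core:
  assumes "\<not> linear_forest {..<m} (col_graph inc n m X)" "\<not> claw m (col_graph inc n m X) < m"
  shows "col_pick inc n m X i < n" "core_edge inc n m X (col_pick inc n m X i)"
    "\<And>r. r < n \<Longrightarrow> core_edge inc n m X r \<Longrightarrow> row_copies inc n m X (col_pick inc n m X i) \<le> row_copies inc n m X r"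
proof -
  let ?E = "col_graph inc n m X" and ?mul = "row_copies inc n m X"
  let ?R = "{r. r < n \<and> core_edge inc n m X r}"
  have "claw m ?E = m" using assms(2) claw_le[of _ ?E] by (metis le_neq_implies_less)
  then have "core m ?E \<noteq> {}" using assms(1) linear_forest_iff_claw_core by metis
  then obtain v where v: "v \<in> core m ?E" by blast
  then obtain u where u: "u \<in> core m ?E" "?E v u" by (rule min_degree_two_nbr[OF min_degree_two_core])
  \<comment> \<open>The core is nonempty and each of its vertices has a neighbour in it; a row
    joining two such vertices is a core edge, so the minimum is taken over a nonempty set.\<close>
  then obtain r0 where r0: "r0 < n" "core_edge inc n m X r0"
    using v unfolding core_edge_iff unfolding col_graph_def by blast
  then obtain r1 where r1: "r1 \<in> ?R" "\<And>r. r \<in> ?R \<Longrightarrow> ?mul r1 \<le> ?mul r"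
    using ex_has_least_nat[of "\<lambda>r. r \<in> ?R" r0 ?mul] by blast
  let ?Q = "\<lambda>r. core_edge inc n m X r \<and> (\<forall>r'<n. core_edge inc n m X r' \<longrightarrow> ?mul r \<le> ?mul r')"
  have "r1 < n" "?Q r1" using r1 by auto
  from least_below_less[of r1 n ?Q, OF this]
  show "col_pick inc n m X i < n" "core_edge inc n m X (col_pick inc n m X i)"
    "\<And>r. r < n \<Longrightarrow> core_edge inc n m X r \<Longrightarrow> ?mul (col_pick inc n m X i) \<le> ?mul r"
    using assms(2) unfolding col_pick_def Let_def by auto
qed

lemma col_pick:
  assumes "\<not> linear_forest {..<m} (col_graph inc n m X)"
  shows "col_pick inc n m X i \<in> {..<n} - X"
proof (cases "claw m (col_graph inc n m X) < m")
  case True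
  note nb = claw_nbrs[OF True]
  show ?thesis
    using True col_graph_pick[OF nb(2)] col_graph_pick[OF nb(4)] col_graph_pick[OF nb(6)]
    unfolding col_pick_def Let_def by auto
next
  case False
  from col_pick_core[OF assms False, of i] show ?thesis unfolding core_edge_iff by auto
qed

text \<open>At a claw, one of the three edges must lose all its copies, in particular the copy that
  was picked. The centre gives no branch of its own because vertices cannot be deleted here; hence
  three branches.\<close>

lemma col_pick_safe:
  assumes two: "\<forall>i<n. card {j. j < m \<and> inc i j} \<le> 2"
    and "X \<subseteq> S" "S \<subseteq> {..<n}" "\<not> linear_forest {..<m} (col_graph inc n m X)"
    "linear_forest {..<m} (col_graph inc n m S)"
  shows "\<exists>S'. X \<subseteq> S' \<and> S' \<subseteq> {..<n} \<and> linear_forest {..<m} (col_graph inc n m S') \<and>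
      card S' \<le> card S \<and> (\<exists>i<3. col_pick inc n m X i \<in> S')"
proof (cases "claw m (col_graph inc n m X) < m")
  case True
  let ?E = "col_graph inc n m X"
  let ?r = "\<lambda>u. least_below n (\<lambda>r. (r \<notin> X \<and> inc r (claw m ?E)) \<and> (r \<notin> X \<and> inc r u))"
  note nb = claw_nbrs[OF True]
  have "?r (nbr1 m ?E) \<in> S \<or> ?r (nbr2 m ?E) \<in> S \<or> ?r (nbr3 m ?E) \<in> S"
  proof (rule ccontr)
    assume *: "\<not> ?thesis"
    have E: "col_graph inc n m S (claw m ?E) u" if "?E (claw m ?E) u" "?r u \<notin> S" for u
      by (rule col_graph_pick_persists[OF that])
    show False
      using claw_not_linear_forest[OF assms(5) True nb(1,3,5,7,8,9)] E nb * by blast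
  qed
  then have "col_pick inc n m X 0 \<in> S \<or> col_pick inc n m X 1 \<in> S \<or> col_pick inc n m X 2 \<in> S"
    unfolding col_pick_def Let_def using True by simp
  moreover have "(0::nat) < 3" "(1::nat) < 3" "(2::nat) < 3" by simp_all
  ultimately have "\<exists>i<3. col_pick inc n m X i \<in> S" by blast
  then show ?thesis using assms by blast
next
  case False
  let ?E = "col_graph inc n m X" and ?r = "col_pick inc n m X 0"
  let ?P = "\<lambda>a b. {i. i < n \<and> i \<notin> X \<and> inc i a \<and> inc i b}"
  have cl: "claw m ?E = m" using False claw_le[of _ ?E] by (metis le_neq_implies_less)
  have deg: "\<forall>v\<in>{..<m}. card {u\<in>{..<m}. ?E v u} \<le> 2"
    using cl unfolding claw_def least_below_eq_iff by (auto simp: not_le)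
  note p = col_pick_core[OF assms(4) False, where i = 0]
  obtain a b where ab: "a \<in> core m ?E" "b \<in> core m ?E" "a \<noteq> b" "inc ?r a" "inc ?r b" "?r \<notin> X"
    using p(2) unfolding core_edge_iff by blast
  have r: "?r \<in> ?P a b" using ab p(1) by blast
  have lt: "c < m" if "c \<in> core m ?E" for c using that core_subset by blast
  have le: "card (?P a b) \<le> card (?P a' b')"
    if c: "a' \<in> core m ?E" "b' \<in> core m ?E" "a' \<noteq> b'" "?P a' b' \<noteq> {}" for a' b'
  proof -
    obtain r' where r': "r' < n" "r' \<notin> X" "inc r' a'" "inc r' b'" using c(4) by blast
    then have "core_edge inc n m X r'" using c unfolding core_edge_iff by blast
    from p(3)[OF r'(1) this] show ?thesis
      unfolding row_copies_eq[OF two r' c(3) lt[OF c(1)] lt[OF c(2)]]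
        row_copies_eq[OF two p(1) ab(6,4,5,3) lt[OF ab(1)] lt[OF ab(2)]] .
  qed
  have min: "\<forall>a'\<in>core m ?E. \<forall>b'\<in>core m ?E. a' \<noteq> b' \<longrightarrow> ?P a' b' \<noteq> {} \<longrightarrow> card (?P a b) \<le> card (?P a' b')"
    using le by blast
  from exchange_edge[OF two deg core_subset min_degree_two_core ab(1-3) r min assms(2,3,5)]
  show ?thesis by (metis zero_less_numeral)
qed

section \<open>A loop language compiled to the random access machine\<close>

text \<open>The bounded sum is the only iteration within expressions. It serves as multiplication,
  counting, quantifier, conditional and search.\<close>

datatype expr =
    C nat
  | V nat
  | Plus expr expr
  | Minus expr expr
  | Ld expr
  | SumE nat expr expr

fun eval :: "expr \<Rightarrow> (nat \<Rightarrow> nat) \<Rightarrow> (nat \<Rightarrow> nat) \<Rightarrow> nat" where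
  "eval (C c) \<eta> m = c"
| "eval (V x) \<eta> m = \<eta> x"
| "eval (Plus a b) \<eta> m = eval a \<eta> m + eval b \<eta> m"
| "eval (Minus a b) \<eta> m = eval a \<eta> m - eval b \<eta> m"
| "eval (Ld a) \<eta> m = m (eval a \<eta> m)"
| "eval (SumE x a b) \<eta> m = (\<Sum>i<eval a \<eta> m. eval b (\<eta>(x := i)) m)"

text \<open>The first argument of \<open>Put\<close> is a constant cap on the stored value. So no
  repetition of a command, however long, can push the memory contents above a bound that covers the
  initial contents and the caps. Variables cannot be assigned; they are introduced by
  \<open>For\<close> and \<open>Bind\<close> only.\<close>

datatype cmd =
    Put nat expr expr
  | Seq cmd cmd
  | When expr cmd
  | For nat expr cmd
  | Bind nat expr cmd

fun exec :: "cmd \<Rightarrow> (nat \<Rightarrow> nat) \<Rightarrow> (nat \<Rightarrow> nat) \<Rightarrow> (nat \<Rightarrow> nat)" where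
  "exec (Put k a b) \<eta> m = m(eval a \<eta> m := min (eval b \<eta> m) k)"
| "exec (Seq c d) \<eta> m = exec d \<eta> (exec c \<eta> m)"
| "exec (When a c) \<eta> m = (if eval a \<eta> m = 0 then m else exec c \<eta> m)"
| "exec (For x a c) \<eta> m = fold (\<lambda>i. exec c (\<eta>(x := i))) [0..<eval a \<eta> m] m"
| "exec (Bind x a c) \<eta> m = exec c (\<eta>(x := eval a \<eta> m)) m"

text \<open>\<open>\<rho>\<close> assigns registers to variables, registers from \<open>k\<close> on
  are scratch, and \<open>q\<close> is the absolute position of the code, needed for its jumps. The
  value ends up in register \<open>k\<close>. A register is copied by adding it to zero. In a sum,
  \<open>k\<close> accumulates, \<open>k + 1\<close> holds the limit and \<open>k + 2\<close> the
  counter.\<close>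

fun ecomp :: "(nat \<Rightarrow> nat) \<Rightarrow> nat \<Rightarrow> nat \<Rightarrow> expr \<Rightarrow> instr list" where
  "ecomp \<rho> k q (C c) = [Const k c]"
| "ecomp \<rho> k q (V x) = [Const k 0, Add k (\<rho> x) k]"
| "ecomp \<rho> k q (Plus a b) =
    (let ca = ecomp \<rho> k q a; cb = ecomp \<rho> (Suc k) (q + length ca) b
     in ca @ cb @ [Add k k (Suc k)])"
| "ecomp \<rho> k q (Minus a b) =
    (let ca = ecomp \<rho> k q a; cb = ecomp \<rho> (Suc k) (q + length ca) b
     in ca @ cb @ [Sub k k (Suc k)])"
| "ecomp \<rho> k q (Ld a) = ecomp \<rho> k q a @ [Load k k]"
| "ecomp \<rho> k q (SumE x a b) =
    (let ca = ecomp \<rho> (k + 1) q a;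
         l = q + length ca + 2;
         cb = ecomp (\<rho>(x := k + 2)) (k + 3) (l + 2) b
     in ca @ [Const k 0, Const (k + 2) 0, Sub (k + 3) (k + 1) (k + 2),
        Jump_Zero (k + 3) (l + 6 + length cb)] @ cb @
        [Add k k (k + 3), Const (k + 3) 1, Add (k + 2) (k + 2) (k + 3), Jump l])"

text \<open>The cap of \<open>Put\<close> is applied by truncated subtraction, as
  \<open>v - (v - c) = min v c\<close>. A \<open>For\<close> keeps its limit in register
  \<open>k\<close>, so that the limit is evaluated only once, before the body changes the
  memory.\<close>

fun ccomp :: "(nat \<Rightarrow> nat) \<Rightarrow> nat \<Rightarrow> nat \<Rightarrow> cmd \<Rightarrow> instr list" where
  "ccomp \<rho> k q (Put c a b) =
    (let ca = ecomp \<rho> k q a; cb = ecomp \<rho> (k + 1) (q + length ca) b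
     in ca @ cb @ [Const (k + 2) c, Sub (k + 2) (k + 1) (k + 2), Sub (k + 1) (k + 1) (k + 2),
        Store k (k + 1)])"
| "ccomp \<rho> k q (Seq c d) =
    (let cc = ccomp \<rho> k q c in cc @ ccomp \<rho> k (q + length cc) d)"
| "ccomp \<rho> k q (When a c) =
    (let ca = ecomp \<rho> k q a; cc = ccomp \<rho> k (q + length ca + 1) c
     in ca @ [Jump_Zero k (q + length ca + 1 + length cc)] @ cc)"
| "ccomp \<rho> k q (For x a c) =
    (let ca = ecomp \<rho> k q a;
         l = q + length ca + 1;
         cc = ccomp (\<rho>(x := k + 1)) (k + 2) (l + 2) c
     in ca @ [Const (k + 1) 0, Sub (k + 2) k (k + 1),
        Jump_Zero (k + 2) (l + 5 + length cc)] @ cc @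
        [Const (k + 2) 1, Add (k + 1) (k + 1) (k + 2), Jump l])"
| "ccomp \<rho> k q (Bind x a c) =
    (let ca = ecomp \<rho> k q a in ca @ ccomp (\<rho>(x := k)) (k + 1) (q + length ca) c)"

text \<open>\<open>B\<close> bounds the variables and the memory contents. Since all values stay polynomial, bit
  lengths are estimated by the values themselves.\<close>

fun vbound :: "expr \<Rightarrow> nat \<Rightarrow> nat" where
  "vbound (C c) B = c"
| "vbound (V x) B = B"
| "vbound (Plus a b) B = vbound a B + vbound b B"
| "vbound (Minus a b) B = vbound a B"
| "vbound (Ld a) B = B"
| "vbound (SumE x a b) B = vbound a B * vbound b (B + vbound a B)"

text \<open>The body of a sum is estimated at \<open>B + vbound a B\<close>, since its loop variable
  may exceed \<open>B\<close>. The factor \<open>vbound a B + 1\<close> leaves room for the final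
  test that ends the loop.\<close>

fun ebound :: "expr \<Rightarrow> nat \<Rightarrow> nat" where
  "ebound (C c) B = c + 1"
| "ebound (V x) B = B + 3"
| "ebound (Plus a b) B = ebound a B + ebound b B + (vbound a B + vbound b B + 2)"
| "ebound (Minus a b) B = ebound a B + ebound b B + (vbound a B + vbound b B + 2)"
| "ebound (Ld a) B = ebound a B + (vbound a B + B + 2)"
| "ebound (SumE x a b) B =
    ebound a B + 2 + (vbound a B + 1) * (ebound b (B + vbound a B) + 5 * vbound a B +
      vbound a B * vbound b (B + vbound a B) + vbound b (B + vbound a B) + 20)"

fun cbound :: "cmd \<Rightarrow> nat \<Rightarrow> nat" where
  "cbound (Put c a b) B = ebound a B + ebound b B + (vbound a B + 4 * vbound b B + 2 * c + 20)"
| "cbound (Seq c d) B = cbound c B + cbound d B"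
| "cbound (When a c) B = ebound a B + cbound c B + vbound a B + 1"
| "cbound (For x a c) B =
    ebound a B + 1 + (vbound a B + 1) * (cbound c (B + vbound a B) + 5 * vbound a B + 20)"
| "cbound (Bind x a c) B = ebound a B + cbound c (B + vbound a B)"

fun kmax :: "cmd \<Rightarrow> nat" where
  "kmax (Put c a b) = c"
| "kmax (Seq c d) = max (kmax c) (kmax d)"
| "kmax (When a c) = kmax c"
| "kmax (For x a c) = kmax c"
| "kmax (Bind x a c) = kmax c"

lemma eval_le_vbound:
  assumes "\<And>x. \<eta> x \<le> B" "\<And>a. m a \<le> B"
  shows "eval e \<eta> m \<le> vbound e B"
  using assms
proof (induction e arbitrary: \<eta> B)
  case (SumE x a b)
  have a: "eval a \<eta> m \<le> vbound a B" using SumE by blast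
  have "eval b (\<eta>(x := i)) m \<le> vbound b (B + vbound a B)" if "i < eval a \<eta> m" for i
  proof (rule SumE.IH(2))
    show "(\<eta>(x := i)) y \<le> B + vbound a B" for y
      using a that SumE.prems(1)[of y] by auto
    show "m y \<le> B + vbound a B" for y using SumE.prems(2)[of y] by simp
  qed
  then have "(\<Sum>i<eval a \<eta> m. eval b (\<eta>(x := i)) m) \<le> (\<Sum>i<eval a \<eta> m. vbound b (B + vbound a B))"
    by (intro sum_mono) auto
  also have "\<dots> \<le> vbound a B * vbound b (B + vbound a B)" using a by simp
  finally show ?case by simp
qed (auto intro: add_mono diff_le_self le_trans)

lemma exec_bounded:
  assumes "\<And>a. m a \<le> B" "kmax c \<le> B"
  shows "exec c \<eta> m a \<le> B"
  using assms
proof (induction c arbitrary: \<eta> m a)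
  case (For x e c)
  have "\<forall>a. fold (\<lambda>i. exec c (\<eta>(x := i))) xs m' a \<le> B" if "\<forall>a. m' a \<le> B" for xs m'
    using that
  proof (induction xs arbitrary: m')
    case (Cons i xs)
    then show ?case using For.IH[of m'] For.prems(2) by simp
  qed simp
  then show ?case using For.prems by simp
qed auto

text \<open>Unlike \<open>halts_in\<close>, these computations may stop anywhere, so the runs of
  consecutive code fragments can be concatenated.\<close>

inductive runs :: "instr list \<Rightarrow> config \<Rightarrow> nat \<Rightarrow> config \<Rightarrow> bool" for p where
  runs_refl: "runs p s 0 s"
| runs_step: "pc s < length p \<Longrightarrow> runs p (step (p ! pc s) s) t s' \<Longrightarrow>
    runs p s (cost (p ! pc s) s + t) s'"

lemma runs_trans: "runs p s t s' \<Longrightarrow> runs p s' t' s'' \<Longrightarrow> runs p s (t + t') s''"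
  by (induction rule: runs.induct) (auto simp: add.assoc intro: runs.intros)

lemma runs_halts: "runs p s t s' \<Longrightarrow> halts_in p s' t' s'' \<Longrightarrow> halts_in p s (t + t') s''"
  by (induction rule: runs.induct) (auto simp: add.assoc intro: halts_in.intros)

definition runs_le :: "instr list \<Rightarrow> config \<Rightarrow> nat \<Rightarrow> config \<Rightarrow> bool" where
  "runs_le p s T s' \<longleftrightarrow> (\<exists>t\<le>T. runs p s t s')"

lemma runs_le_refl: "runs_le p s 0 s"
  by (auto simp: runs_le_def intro: runs.intros)

lemma runs_le_trans: "runs_le p s t s' \<Longrightarrow> runs_le p s' t' s'' \<Longrightarrow> runs_le p s (t + t') s''"
  unfolding runs_le_def by (meson add_mono runs_trans)

lemma runs_le_mono: "runs_le p s t s' \<Longrightarrow> t \<le> t' \<Longrightarrow> runs_le p s t' s'"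
  unfolding runs_le_def using order_trans by blast

lemma runs_le_step:
  assumes "q < length p" "p ! q = i" "step i (Config q r m) = s" "cost i (Config q r m) \<le> t"
  shows "runs_le p (Config q r m) t s"
  unfolding runs_le_def
  using runs_step[of "Config q r m" p 0 s] runs_refl assms by auto

definition code_at :: "instr list \<Rightarrow> nat \<Rightarrow> instr list \<Rightarrow> bool" where
  "code_at p q c \<longleftrightarrow> (\<forall>i<length c. q + i < length p \<and> p ! (q + i) = c ! i)"

lemma code_at_append:
  "code_at p q (c @ d) \<longleftrightarrow> code_at p q c \<and> code_at p (q + length c) d"
proof
  assume l: "code_at p q (c @ d)"
  show "code_at p q c \<and> code_at p (q + length c) d"
    unfolding code_at_def
  proof (intro conjI allI impI)
    fix i assume "i < length d"
    then show "q + length c + i < length p" "p ! (q + length c + i) = d ! i"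
      using l[unfolded code_at_def, rule_format, of "length c + i"] by (auto simp: add.assoc)
  qed (use l[unfolded code_at_def] in \<open>auto simp: nth_append dest!: spec\<close>)
next
  assume r: "code_at p q c \<and> code_at p (q + length c) d"
  show "code_at p q (c @ d)"
    unfolding code_at_def
  proof (intro allI impI)
    fix i assume i: "i < length (c @ d)"
    show "q + i < length p \<and> p ! (q + i) = (c @ d) ! i"
    proof (cases "i < length c")
      case False
      then show ?thesis using i r[unfolded code_at_def, THEN conjunct2, rule_format, of "i - length c"]
        by (auto simp: nth_append)
    qed (use r in \<open>auto simp: code_at_def nth_append\<close>)
  qed
qed

lemma code_at_Cons:
  "code_at p q (i # c) \<longleftrightarrow> q < length p \<and> p ! q = i \<and> code_at p (Suc q) c"
  using code_at_append[of p q "[i]" c] by (simp add: code_at_def)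

lemma code_at_Nil: "code_at p q []"
  by (simp add: code_at_def)

lemma code_at_self: "code_at (pre @ c @ post) (length pre) c"
  by (auto simp: code_at_def nth_append)

lemma bit_length_le: "bit_length n \<le> n + 1"
proof -
  have "floorlog 2 n \<le> n"
    by (rule floorlog_leI) (auto simp: less_exp)
  then show ?thesis by (simp add: bit_length_def)
qed

lemma bit_length_bound: "n \<le> B \<Longrightarrow> bit_length n \<le> Suc B"
  using bit_length_le[of n] by simp

lemma runs_le_stepI:
  assumes "code_at p q (i # c)" "step i (Config q r m) = s" "cost i (Config q r m) \<le> t"
  shows "runs_le p (Config q r m) t s"
  using assms runs_le_step by (auto simp: code_at_Cons)

text \<open>All variables live in registers below \<open>k\<close>, and these are preserved. So the
  second operand is evaluated in the same environment as the first, with the first value safe in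
  register \<open>k\<close>.\<close>

lemma ecomp_correct:
  assumes "code_at p q (ecomp \<rho> k q e)" "\<forall>x. \<rho> x < k" "\<forall>x. r (\<rho> x) \<le> B" "\<forall>a. m a \<le> B"
  shows "\<exists>r'. runs_le p (Config q r m) (ebound e B) (Config (q + length (ecomp \<rho> k q e)) r' m) \<and>
    r' k = eval e (\<lambda>x. r (\<rho> x)) m \<and> (\<forall>i<k. r' i = r i)"
  using assms
proof (induction e arbitrary: \<rho> k q r B)
  case (C c)
  have "runs_le p (Config q r m) (c + 1) (Config (Suc q) (r(k := c)) m)"
    by (rule runs_le_stepI) (use C bit_length_le[of c] in auto)
  then show ?case by (auto intro!: exI[of _ "r(k := c)"])
next
  case (V x)
  have 1: "runs_le p (Config q r m) 1 (Config (Suc q) (r(k := 0)) m)"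
    by (rule runs_le_stepI) (use V in \<open>auto simp: bit_length_def floorlog_def\<close>)
  have 2: "runs_le p (Config (Suc q) (r(k := 0)) m) (B + 2)
     (Config (Suc (Suc q)) (r(k := r (\<rho> x))) m)"
  proof (rule runs_le_stepI)
    show "code_at p (Suc q) [Add k (\<rho> x) k]" using V(1) by (simp add: code_at_Cons)
    show "cost (Add k (\<rho> x) k) (Config (Suc q) (r(k := 0)) m) \<le> B + 2"
      using bit_length_bound[OF V(3)[rule_format, of x]] V(2)[rule_format, of x] by (simp add: bit_length_def floorlog_def)
  qed (use V(2)[rule_format, of x] in auto)
  have *: "runs_le p (Config q r m) (ebound (V x) B)
      (Config (q + length (ecomp \<rho> k q (V x))) (r(k := r (\<rho> x))) m)"
    using runs_le_trans[OF 1 2] by (simp add: Let_def add.assoc numeral_3_eq_3)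
  show ?case
    by (intro exI conjI, rule *) (use V in auto)
next
  case (Plus a b)
  let ?ca = "ecomp \<rho> k q a" and ?cb = "ecomp \<rho> (Suc k) (q + length (ecomp \<rho> k q a)) b"
  have code: "code_at p q ?ca" "code_at p (q + length ?ca) ?cb"
    "code_at p (q + length ?ca + length ?cb) [Add k k (Suc k)]"
    using Plus.prems(1) by (simp_all add: Let_def code_at_append)
  obtain r1 where r1: "runs_le p (Config q r m) (ebound a B) (Config (q + length ?ca) r1 m)"
    "r1 k = eval a (\<lambda>x. r (\<rho> x)) m" "\<And>i. i < k \<Longrightarrow> r1 i = r i"
    using Plus.IH(1)[OF code(1) Plus.prems(2-4)] by auto
  have eq: "(\<lambda>x. r1 (\<rho> x)) = (\<lambda>x. r (\<rho> x))" using r1(3) Plus.prems(2) by auto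
  obtain r2 where r2: "runs_le p (Config (q + length ?ca) r1 m) (ebound b B)
      (Config (q + length ?ca + length ?cb) r2 m)"
    "r2 (Suc k) = eval b (\<lambda>x. r (\<rho> x)) m" "\<And>i. i < Suc k \<Longrightarrow> r2 i = r1 i"
    using Plus.IH(2)[OF code(2), of r1 B] Plus.prems(2-4) r1(3)[OF Plus.prems(2)[rule_format]] less_SucI
    unfolding eq by metis
  have v: "r2 k \<le> vbound a B" "r2 (Suc k) \<le> vbound b B"
    using r1(2) r2(2) r2(3)[of k] eval_le_vbound[where \<eta> = "\<lambda>x. r (\<rho> x)" and B = B and m = m] Plus.prems
    by auto
  have 3: "runs_le p (Config (q + length ?ca + length ?cb) r2 m) (vbound a B + vbound b B + 2)
      (Config (Suc (q + length ?ca + length ?cb)) (r2(k := r2 k + r2 (Suc k))) m)"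
    by (rule runs_le_stepI[OF code(3)])
      (use bit_length_bound[OF v(1)] bit_length_bound[OF v(2)] in auto)
  have *: "runs_le p (Config q r m) (ebound (Plus a b) B)
      (Config (q + length (ecomp \<rho> k q (Plus a b))) (r2(k := r2 k + r2 (Suc k))) m)"
    using runs_le_trans[OF runs_le_trans[OF r1(1) r2(1)] 3] by (simp add: Let_def add.assoc numeral_3_eq_3)
  show ?case
    by (intro exI conjI, rule *) (use r1 r2 in auto)
next
  case (Minus a b)
  let ?ca = "ecomp \<rho> k q a" and ?cb = "ecomp \<rho> (Suc k) (q + length (ecomp \<rho> k q a)) b"
  have code: "code_at p q ?ca" "code_at p (q + length ?ca) ?cb"
    "code_at p (q + length ?ca + length ?cb) [Sub k k (Suc k)]"
    using Minus.prems(1) by (simp_all add: Let_def code_at_append)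
  obtain r1 where r1: "runs_le p (Config q r m) (ebound a B) (Config (q + length ?ca) r1 m)"
    "r1 k = eval a (\<lambda>x. r (\<rho> x)) m" "\<And>i. i < k \<Longrightarrow> r1 i = r i"
    using Minus.IH(1)[OF code(1) Minus.prems(2-4)] by auto
  have eq: "(\<lambda>x. r1 (\<rho> x)) = (\<lambda>x. r (\<rho> x))" using r1(3) Minus.prems(2) by auto
  obtain r2 where r2: "runs_le p (Config (q + length ?ca) r1 m) (ebound b B)
      (Config (q + length ?ca + length ?cb) r2 m)"
    "r2 (Suc k) = eval b (\<lambda>x. r (\<rho> x)) m" "\<And>i. i < Suc k \<Longrightarrow> r2 i = r1 i"
    using Minus.IH(2)[OF code(2), of r1 B] Minus.prems(2-4) r1(3)[OF Minus.prems(2)[rule_format]] less_SucI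
    unfolding eq by metis
  have v: "r2 k \<le> vbound a B" "r2 (Suc k) \<le> vbound b B"
    using r1(2) r2(2) r2(3)[of k] eval_le_vbound[where \<eta> = "\<lambda>x. r (\<rho> x)" and B = B and m = m] Minus.prems
    by auto
  have 3: "runs_le p (Config (q + length ?ca + length ?cb) r2 m) (vbound a B + vbound b B + 2)
      (Config (Suc (q + length ?ca + length ?cb)) (r2(k := r2 k - r2 (Suc k))) m)"
    by (rule runs_le_stepI[OF code(3)])
      (use bit_length_bound[OF v(1)] bit_length_bound[OF v(2)] in auto)
  have *: "runs_le p (Config q r m) (ebound (Minus a b) B)
      (Config (q + length (ecomp \<rho> k q (Minus a b))) (r2(k := r2 k - r2 (Suc k))) m)"
    using runs_le_trans[OF runs_le_trans[OF r1(1) r2(1)] 3] by (simp add: Let_def add.assoc numeral_3_eq_3)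
  show ?case
    by (intro exI conjI, rule *) (use r1 r2 in auto)
next
  case (Ld a)
  let ?ca = "ecomp \<rho> k q a"
  have code: "code_at p q ?ca" "code_at p (q + length ?ca) [Load k k]"
    using Ld.prems(1) by (simp_all add: code_at_append)
  obtain r1 where r1: "runs_le p (Config q r m) (ebound a B) (Config (q + length ?ca) r1 m)"
    "r1 k = eval a (\<lambda>x. r (\<rho> x)) m" "\<And>i. i < k \<Longrightarrow> r1 i = r i"
    using Ld.IH[OF code(1) Ld.prems(2-4)] by auto
  have v: "r1 k \<le> vbound a B"
    using r1(2) eval_le_vbound[where \<eta> = "\<lambda>x. r (\<rho> x)" and B = B and m = m] Ld.prems by auto
  have 3: "runs_le p (Config (q + length ?ca) r1 m) (vbound a B + B + 2)
      (Config (Suc (q + length ?ca)) (r1(k := m (r1 k))) m)"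
    by (rule runs_le_stepI[OF code(2)])
      (use bit_length_bound[OF v(1)] bit_length_bound[OF Ld.prems(4)[rule_format, of "r1 k"]] in auto)
  have *: "runs_le p (Config q r m) (ebound (Ld a) B)
      (Config (q + length (ecomp \<rho> k q (Ld a))) (r1(k := m (r1 k))) m)"
    using runs_le_trans[OF r1(1) 3] by (simp add: Let_def add.assoc numeral_3_eq_3)
  show ?case
    by (intro exI conjI, rule *) (use r1 in auto)
next
  case (SumE x a b)
  let ?\<eta> = "\<lambda>x. r (\<rho> x)"
  let ?ca = "ecomp \<rho> (k + 1) q a"
  define l where "l = q + length ?ca + 2"
  let ?cb = "ecomp (\<rho>(x := k + 2)) (k + 3) (l + 2) b"
  let ?n = "eval a ?\<eta> m"
  define f where "f i = eval b (?\<eta>(x := i)) m" for i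
  define B' where "B' = B + vbound a B"
  define va where "va = vbound a B"
  define vb where "vb = vbound b B'"
  define E where "E = l + 6 + length ?cb"
  let ?c1 = "[Const k 0, Const (k + 2) 0]" and ?c2 = "[Sub (k + 3) (k + 1) (k + 2), Jump_Zero (k + 3) E]"
    and ?c3 = "[Add k k (k + 3), Const (k + 3) 1, Add (k + 2) (k + 2) (k + 3), Jump l]"
  have eq1: "ecomp \<rho> k q (SumE x a b) = ?ca @ ?c1 @ ?c2 @ ?cb @ ?c3"
    by (simp add: Let_def l_def E_def)
  have eq2: "q + length ?ca + length ?c1 = l" "l + length ?c2 = l + 2" by (simp_all add: l_def)
  have code0: "code_at p q ?ca \<and> code_at p (q + length ?ca) ?c1 \<and> code_at p l ?c2 \<and>
      code_at p (l + 2) ?cb \<and> code_at p (l + 2 + length ?cb) ?c3"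
    using SumE.prems(1) unfolding eq1 code_at_append eq2 by blast
  have code: "code_at p q ?ca" "code_at p (q + length ?ca) [Const k 0, Const (k + 2) 0]"
    "code_at p l [Sub (k + 3) (k + 1) (k + 2), Jump_Zero (k + 3) E]"
    "code_at p (l + 2) ?cb"
    "code_at p (l + 2 + length ?cb) [Add k k (k + 3), Const (k + 3) 1, Add (k + 2) (k + 2) (k + 3), Jump l]"
    using code0 by blast+
  have B: "\<And>x. ?\<eta> x \<le> B" "\<And>a. m a \<le> B" using SumE.prems by auto
  have n: "?n \<le> va" unfolding va_def using eval_le_vbound[OF B] by auto
  have f_le: "f i \<le> vb" if "i < ?n" for i
    unfolding vb_def f_def using that B n
    by (intro eval_le_vbound) (auto simp: B'_def va_def trans_le_add1 intro: order.trans less_imp_le)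
  have acc: "(\<Sum>j<i. f j) \<le> va * vb" if "i \<le> ?n" for i
  proof -
    have "(\<Sum>j<i. f j) \<le> (\<Sum>j<i. vb)" using that f_le by (intro sum_mono) auto
    also have "\<dots> \<le> va * vb" using that n by simp
    finally show ?thesis .
  qed
  obtain r1 where r1: "runs_le p (Config q r m) (ebound a B) (Config (q + length ?ca) r1 m)"
    "r1 (k + 1) = ?n" "\<And>i. i < k + 1 \<Longrightarrow> r1 i = r i"
    using SumE.IH(1)[OF code(1) _ SumE.prems(3,4)] SumE.prems(2) by (auto simp: less_SucI)
  define r2 where "r2 = r1(k := 0, k + 2 := 0)"
  have "runs_le p (Config (q + length ?ca) r1 m) (1 + 1) (Config l r2 m)"
    by (rule runs_le_trans; rule runs_le_step)
      (use code(2) in \<open>auto simp: code_at_Cons l_def r2_def bit_length_def floorlog_def\<close>)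
  note init = runs_le_trans[OF r1(1) this]
  define it where "it = ebound b B' + 4 * va + va * vb + vb + 9"
  have test: "runs_le p (Config l r' m) (3 * va + 3)
     (Config (if i < ?n then l + 2 else E) (r'(k + 3 := ?n - i)) m)"
    if "r' (k + 1) = ?n" "r' (k + 2) = i" "i \<le> ?n" for r' i
  proof -
    have bl: "bit_length ?n \<le> va + 1" "bit_length i \<le> va + 1" "bit_length (?n - i) \<le> va + 1"
      using n that by (auto intro!: bit_length_bound)
    have 1: "runs_le p (Config l r' m) (2 * va + 2) (Config (Suc l) (r'(k + 3 := ?n - i)) m)"
      by (rule runs_le_stepI[OF code(3)]) (use that bl in auto)
    have 2: "runs_le p (Config (Suc l) (r'(k + 3 := ?n - i)) m) (va + 1)
      (Config (if i < ?n then l + 2 else E) (r'(k + 3 := ?n - i)) m)"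
      by (rule runs_le_step[where i = "Jump_Zero (k + 3) E"])
        (use code(3) that bl in \<open>auto simp: code_at_Cons\<close>)
    show ?thesis using runs_le_trans[OF 1 2] by (rule runs_le_mono) simp
  qed
  \<comment> \<open>\<open>j\<close> is the number of iterations left. Each costs at most
    \<open>it\<close>, its test included, and the last summand \<open>3 * va + 3\<close> pays for
    the test that fails.\<close>
  have loop: "\<exists>r''. runs_le p (Config l r' m) (j * it + 3 * va + 3) (Config E r'' m) \<and>
      r'' k = (\<Sum>i<?n. f i) \<and> (\<forall>i<k. r'' i = r i)"
    if "r' k = (\<Sum>j<i. f j)" "r' (k + 1) = ?n" "r' (k + 2) = i" "\<forall>i<k. r' i = r i" "i + j = ?n"
    for r' i j
    using that
  proof (induction j arbitrary: i r')
    case 0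
    then have *: "runs_le p (Config l r' m) (0 * it + 3 * va + 3) (Config E (r'(k + 3 := ?n - i)) m)"
      using test[of r' i] by simp
    show ?case by (intro exI conjI, rule *) (use 0 in auto)
  next
    case (Suc j)
    have i: "i < ?n" using Suc.prems by simp
    let ?r1 = "r'(k + 3 := ?n - i)"
    have 1: "runs_le p (Config l r' m) (3 * va + 3) (Config (l + 2) ?r1 m)"
      using test[of r' i] Suc.prems i by auto
    \<comment> \<open>The counter register is at the same time the register of the bound
      variable.\<close>
    have eta: "(\<lambda>y. ?r1 ((\<rho>(x := k + 2)) y)) = ?\<eta>(x := i)"
    proof
      fix y show "?r1 ((\<rho>(x := k + 2)) y) = (?\<eta>(x := i)) y"
        using Suc.prems(3,4) SumE.prems(2)[rule_format, of y] by auto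
    qed
    have "?r1 ((\<rho>(x := k + 2)) y) \<le> B'" for y
    proof -
      have "(?\<eta>(x := i)) y \<le> B'" using B(1)[of y] i n by (auto simp: B'_def va_def)
      then show ?thesis using fun_cong[OF eta, of y] by metis
    qed
    moreover have "(\<rho>(x := k + 2)) y < k + 3" for y using SumE.prems(2)[rule_format, of y] by auto
    moreover have "m y \<le> B'" for y using B(2)[of y] by (simp add: B'_def)
    ultimately obtain r2 where r2: "runs_le p (Config (l + 2) ?r1 m) (ebound b B') (Config (l + 2 + length ?cb) r2 m)"
      "r2 (k + 3) = f i" "\<And>i. i < k + 3 \<Longrightarrow> r2 i = ?r1 i"
      using SumE.IH(2)[OF code(4), of ?r1 B'] unfolding eta f_def by blast
    let ?r3 = "r2(k := r2 k + r2 (k + 3))"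
    let ?r4 = "?r3(k + 3 := 1)"
    let ?r5 = "?r4(k + 2 := Suc i)"
    let ?q = "l + 2 + length ?cb"
    have r2': "r2 k = (\<Sum>j<i. f j)" "r2 (k + 2) = i" "r2 (k + 1) = ?n" "\<forall>i<k. r2 i = r i"
      using r2(3) Suc.prems by auto
    have bl: "bit_length (\<Sum>j<i. f j) \<le> va * vb + 1" "bit_length (f i) \<le> vb + 1" "bit_length i \<le> va + 1"
      using acc[of i] f_le[of i] i n by (auto intro!: bit_length_bound)
    have 3: "runs_le p (Config ?q r2 m) (va * vb + 1 + (vb + 1)) (Config (Suc ?q) ?r3 m)"
      by (rule runs_le_stepI[OF code(5)]) (use r2' r2(2) bl in auto)
    have 4: "runs_le p (Config (Suc ?q) ?r3 m) 1 (Config (Suc (Suc ?q)) ?r4 m)"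
      by (rule runs_le_step[where i = "Const (k + 3) 1"])
       (use code(5) in \<open>auto simp: code_at_Cons code_at_Nil bit_length_def floorlog_def\<close>)
    have 5: "runs_le p (Config (Suc (Suc ?q)) ?r4 m) (va + 2) (Config (Suc (Suc (Suc ?q))) ?r5 m)"
      by (rule runs_le_step[where i = "Add (k + 2) (k + 2) (k + 3)"])
       (use code(5) r2' bl in \<open>auto simp: code_at_Cons code_at_Nil bit_length_def floorlog_def\<close>)
    have 6: "runs_le p (Config (Suc (Suc (Suc ?q))) ?r5 m) 1 (Config l ?r5 m)"
      by (rule runs_le_step[where i = "Jump l"])
       (use code(5) in \<open>auto simp: code_at_Cons code_at_Nil\<close>)
    note once = runs_le_trans[OF runs_le_trans[OF runs_le_trans[OF runs_le_trans[OF runs_le_trans[OF 1 r2(1)] 3] 4] 5] 6]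
    have "\<exists>r''. runs_le p (Config l ?r5 m) (j * it + 3 * va + 3) (Config E r'' m) \<and>
      r'' k = (\<Sum>i<?n. f i) \<and> (\<forall>i<k. r'' i = r i)"
      by (rule Suc.IH[of _ "Suc i"]) (use r2' r2(2) Suc.prems(5) in auto)
    then obtain r'' where r'': "runs_le p (Config l ?r5 m) (j * it + 3 * va + 3) (Config E r'' m)"
      "r'' k = (\<Sum>i<?n. f i)" "\<forall>i<k. r'' i = r i" by blast
    have "runs_le p (Config l r' m) (Suc j * it + 3 * va + 3) (Config E r'' m)"
      by (rule runs_le_mono[OF runs_le_trans[OF once r''(1)]]) (simp add: it_def)
    then show ?case using r'' by blast
  qed
  obtain r'' where r'': "runs_le p (Config l r2 m) (?n * it + 3 * va + 3) (Config E r'' m)"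
      "r'' k = (\<Sum>i<?n. f i)" "\<forall>i<k. r'' i = r i"
    using loop[of r2 0 ?n] r1 by (auto simp: r2_def)
  have "?n * it \<le> va * it" using n by simp
  \<comment> \<open>\<open>X\<close> dominates both \<open>it\<close> and the final test, which
    accounts for \<open>va + 1\<close> copies of it.\<close>
  moreover define X where "X = ebound b B' + 5 * va + va * vb + vb + 20"
  moreover have "va * it \<le> va * X" by (intro mult_le_mono2) (simp add: it_def X_def)
  moreover have "ebound (SumE x a b) B = ebound a B + 2 + (va + 1) * X"
    by (simp add: va_def B'_def vb_def X_def)
  ultimately have "ebound a B + (1 + 1) + (?n * it + 3 * va + 3) \<le> ebound (SumE x a b) B"
    unfolding add_mult_distrib mult_1 by linarith
  then have *: "runs_le p (Config q r m) (ebound (SumE x a b) B) (Config E r'' m)"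
    using runs_le_trans[OF init r''(1)] runs_le_mono by blast
  moreover have "q + length (ecomp \<rho> k q (SumE x a b)) = E"
    by (simp add: Let_def E_def l_def)
  moreover have "eval (SumE x a b) ?\<eta> m = (\<Sum>i<?n. f i)" by (simp only: eval.simps f_def)
  ultimately show ?case using r'' by metis
qed

text \<open>The assumption \<open>kmax c \<le> B\<close> makes \<open>B\<close> a bound on the
  memory after each command as well, so the next command starts under the same hypotheses.\<close>

lemma ccomp_correct:
  assumes "code_at p q (ccomp \<rho> k q c)" "\<forall>x. \<rho> x < k" "\<forall>x. r (\<rho> x) \<le> B" "\<forall>a. m a \<le> B"
    "kmax c \<le> B"
  shows "\<exists>r'. runs_le p (Config q r m) (cbound c B)
      (Config (q + length (ccomp \<rho> k q c)) r' (exec c (\<lambda>x. r (\<rho> x)) m)) \<and> (\<forall>i<k. r' i = r i)"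
  using assms
proof (induction c arbitrary: \<rho> k q r B m)
  case (Put c a b)
  let ?\<eta> = "\<lambda>x. r (\<rho> x)"
  let ?ca = "ecomp \<rho> k q a" and ?cb = "ecomp \<rho> (k + 1) (q + length (ecomp \<rho> k q a)) b"
  let ?q = "q + length ?ca + length ?cb"
  have code: "code_at p q ?ca" "code_at p (q + length ?ca) ?cb"
    "code_at p ?q [Const (k + 2) c, Sub (k + 2) (k + 1) (k + 2), Sub (k + 1) (k + 1) (k + 2), Store k (k + 1)]"
    using Put.prems(1) by (simp_all add: Let_def code_at_append)
  obtain r1 where r1: "runs_le p (Config q r m) (ebound a B) (Config (q + length ?ca) r1 m)"
    "r1 k = eval a ?\<eta> m" "\<And>i. i < k \<Longrightarrow> r1 i = r i"
    using ecomp_correct[OF code(1) Put.prems(2-4)] by auto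
  have eq: "(\<lambda>x. r1 (\<rho> x)) = ?\<eta>" using r1(3) Put.prems(2) by auto
  have "\<forall>x. \<rho> x < k + 1" "\<forall>x. r1 (\<rho> x) \<le> B" using Put.prems(2,3) r1(3) by (auto simp: less_SucI)
  then obtain r2 where r2: "runs_le p (Config (q + length ?ca) r1 m) (ebound b B) (Config ?q r2 m)"
    "r2 (k + 1) = eval b ?\<eta> m" "\<And>i. i < k + 1 \<Longrightarrow> r2 i = r1 i"
    using ecomp_correct[OF code(2) _ _ Put.prems(4), of r1] unfolding eq by blast
  have v: "eval a ?\<eta> m \<le> vbound a B" "eval b ?\<eta> m \<le> vbound b B"
    using eval_le_vbound[where \<eta> = ?\<eta> and B = B and m = m] Put.prems by auto
  let ?v = "eval b ?\<eta> m"
  let ?r3 = "r2(k + 2 := c)" let ?r4 = "?r3(k + 2 := ?v - c)" let ?r5 = "?r4(k + 1 := ?v - (?v - c))"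
  have bl: "bit_length (eval a ?\<eta> m) \<le> Suc (vbound a B)" "bit_length ?v \<le> Suc (vbound b B)"
    "bit_length (?v - c) \<le> Suc (vbound b B)" "bit_length (?v - (?v - c)) \<le> Suc (vbound b B)"
    "bit_length c \<le> Suc c"
    by (intro bit_length_bound; use v in linarith)+
  have 1: "runs_le p (Config ?q r2 m) (Suc c) (Config (Suc ?q) ?r3 m)"
    by (rule runs_le_step[where i = "Const (k + 2) c"]) (use code(3) bl in \<open>auto simp: code_at_Cons\<close>)
  have 2: "runs_le p (Config (Suc ?q) ?r3 m) (Suc (vbound b B) + Suc c) (Config (Suc (Suc ?q)) ?r4 m)"
    by (rule runs_le_step[where i = "Sub (k + 2) (k + 1) (k + 2)"])
      (use code(3) bl r2(2) in \<open>auto simp: code_at_Cons\<close>)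
  have 3: "runs_le p (Config (Suc (Suc ?q)) ?r4 m) (Suc (vbound b B) + Suc (vbound b B))
      (Config (Suc (Suc (Suc ?q))) ?r5 m)"
    by (rule runs_le_step[where i = "Sub (k + 1) (k + 1) (k + 2)"])
      (use code(3) bl r2(2) in \<open>auto simp: code_at_Cons\<close>)
  have m: "?v - (?v - c) = min ?v c" by simp
  have 4: "runs_le p (Config (Suc (Suc (Suc ?q))) ?r5 m) (Suc (vbound a B) + Suc (vbound b B))
      (Config (Suc (Suc (Suc (Suc ?q)))) ?r5 (m(eval a ?\<eta> m := min ?v c)))"
    by (rule runs_le_step[where i = "Store k (k + 1)"])
      (use code(3) bl r2(3)[of k] r1(2) in \<open>auto simp: code_at_Cons m[symmetric] simp del: diff_diff_cancel\<close>)
  note run = runs_le_trans[OF runs_le_trans[OF runs_le_trans[OF runs_le_trans[OF runs_le_trans[OF r1(1) r2(1)] 1] 2] 3] 4]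
  have pos: "q + length (ccomp \<rho> k q (Put c a b)) = Suc (Suc (Suc (Suc ?q)))"
    by (simp add: Let_def)
  have *: "runs_le p (Config q r m) (cbound (Put c a b) B)
      (Config (q + length (ccomp \<rho> k q (Put c a b))) ?r5 (exec (Put c a b) ?\<eta> m))"
    unfolding pos exec.simps by (rule runs_le_mono[OF run]) simp
  show ?case by (intro exI conjI, rule *) (use r1 r2 in auto)
next
  case (Seq c d)
  let ?\<eta> = "\<lambda>x. r (\<rho> x)"
  let ?cc = "ccomp \<rho> k q c"
  let ?cd = "ccomp \<rho> k (q + length ?cc) d"
  have code: "code_at p q ?cc" "code_at p (q + length ?cc) ?cd"
    using Seq.prems(1) by (simp_all add: Let_def code_at_append)
  obtain r1 where r1: "runs_le p (Config q r m) (cbound c B) (Config (q + length ?cc) r1 (exec c ?\<eta> m))"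
    "\<And>i. i < k \<Longrightarrow> r1 i = r i"
    using Seq.IH(1)[OF code(1) Seq.prems(2-4)] Seq.prems(5) by auto
  have eq: "(\<lambda>x. r1 (\<rho> x)) = ?\<eta>" using r1(2) Seq.prems(2) by auto
  have "\<forall>x. r1 (\<rho> x) \<le> B" using Seq.prems(2,3) r1(2) by auto
  moreover have "\<forall>a. exec c ?\<eta> m a \<le> B" using exec_bounded[of m B c] Seq.prems by auto
  ultimately obtain r2 where r2: "runs_le p (Config (q + length ?cc) r1 (exec c ?\<eta> m)) (cbound d B)
      (Config (q + length ?cc + length ?cd) r2 (exec d ?\<eta> (exec c ?\<eta> m)))" "\<And>i. i < k \<Longrightarrow> r2 i = r1 i"
    using Seq.IH(2)[OF code(2) Seq.prems(2), of r1 B "exec c ?\<eta> m"] Seq.prems(5) unfolding eq by auto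
  have *: "runs_le p (Config q r m) (cbound (Seq c d) B)
      (Config (q + length (ccomp \<rho> k q (Seq c d))) r2 (exec (Seq c d) ?\<eta> m))"
    using runs_le_trans[OF r1(1) r2(1)] by (simp add: Let_def add.assoc)
  show ?case by (intro exI conjI, rule *) (use r1 r2 in auto)
next
  case (When a c)
  let ?\<eta> = "\<lambda>x. r (\<rho> x)"
  let ?ca = "ecomp \<rho> k q a"
  let ?q = "q + length ?ca"
  let ?cc = "ccomp \<rho> k (?q + 1) c"
  have code: "code_at p q ?ca" "code_at p ?q [Jump_Zero k (?q + 1 + length ?cc)]" "code_at p (?q + 1) ?cc"
    using When.prems(1) by (simp_all add: Let_def code_at_append code_at_Cons code_at_Nil)
  obtain r1 where r1: "runs_le p (Config q r m) (ebound a B) (Config ?q r1 m)"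
    "r1 k = eval a ?\<eta> m" "\<And>i. i < k \<Longrightarrow> r1 i = r i"
    using ecomp_correct[OF code(1) When.prems(2-4)] by auto
  have eq: "(\<lambda>x. r1 (\<rho> x)) = ?\<eta>" using r1(3) When.prems(2) by auto
  have v: "eval a ?\<eta> m \<le> vbound a B"
    using eval_le_vbound[where \<eta> = ?\<eta> and B = B and m = m] When.prems by auto
  have 1: "runs_le p (Config ?q r1 m) (Suc (vbound a B))
    (Config (if eval a ?\<eta> m = 0 then ?q + 1 + length ?cc else ?q + 1) r1 m)"
    by (rule runs_le_stepI[OF code(2)]) (use r1(2) bit_length_bound[OF v] in auto)
  have pos: "q + length (ccomp \<rho> k q (When a c)) = ?q + 1 + length ?cc"
    by (simp add: Let_def)
  have "\<exists>r2. runs_le p (Config (if eval a ?\<eta> m = 0 then ?q + 1 + length ?cc else ?q + 1) r1 m) (cbound c B)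
     (Config (?q + 1 + length ?cc) r2 (exec (When a c) ?\<eta> m)) \<and> (\<forall>i<k. r2 i = r1 i)"
  proof (cases "eval a ?\<eta> m = 0")
    case True
    then show ?thesis using runs_le_mono[OF runs_le_refl] by (intro exI[of _ r1]) simp
  next
    case False
    have "\<forall>x. r1 (\<rho> x) \<le> B" using When.prems(2,3) r1(3) by auto
    then show ?thesis
      using When.IH[OF code(3) When.prems(2) _ When.prems(4), of r1] When.prems(5) False unfolding eq by auto
  qed
  then obtain r2 where r2: "runs_le p (Config (if eval a ?\<eta> m = 0 then ?q + 1 + length ?cc else ?q + 1) r1 m)
     (cbound c B) (Config (?q + 1 + length ?cc) r2 (exec (When a c) ?\<eta> m))" "\<forall>i<k. r2 i = r1 i"
    by blast
  have *: "runs_le p (Config q r m) (cbound (When a c) B)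
      (Config (q + length (ccomp \<rho> k q (When a c))) r2 (exec (When a c) ?\<eta> m))"
    unfolding pos by (rule runs_le_mono[OF runs_le_trans[OF runs_le_trans[OF r1(1) 1] r2(1)]]) simp
  show ?case by (intro exI conjI, rule *) (use r1 r2 in auto)
next
  case (Bind x a c)
  let ?\<eta> = "\<lambda>x. r (\<rho> x)"
  let ?ca = "ecomp \<rho> k q a"
  let ?q = "q + length ?ca"
  let ?cc = "ccomp (\<rho>(x := k)) (k + 1) ?q c"
  let ?B = "B + vbound a B"
  have code: "code_at p q ?ca" "code_at p ?q ?cc"
    using Bind.prems(1) by (simp_all add: Let_def code_at_append)
  obtain r1 where r1: "runs_le p (Config q r m) (ebound a B) (Config ?q r1 m)"
    "r1 k = eval a ?\<eta> m" "\<And>i. i < k \<Longrightarrow> r1 i = r i"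
    using ecomp_correct[OF code(1) Bind.prems(2-4)] by auto
  have eq: "(\<lambda>y. r1 ((\<rho>(x := k)) y)) = ?\<eta>(x := eval a ?\<eta> m)"
    using r1(2,3) Bind.prems(2) by (auto simp: fun_eq_iff)
  have v: "eval a ?\<eta> m \<le> vbound a B"
    using eval_le_vbound[where \<eta> = ?\<eta> and B = B and m = m] Bind.prems by auto
  have b1: "\<forall>y. r1 ((\<rho>(x := k)) y) \<le> ?B" 
  proof
    fix y
    have "(?\<eta>(x := eval a ?\<eta> m)) y \<le> ?B" using v Bind.prems(3)[rule_format, of y] by auto
    then show "r1 ((\<rho>(x := k)) y) \<le> ?B" using fun_cong[OF eq, of y] by metis
  qed
  have b2: "\<forall>y. m y \<le> ?B" "kmax c \<le> ?B" using Bind.prems(4,5) by (auto simp: trans_le_add1)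
  have b3: "\<forall>y. (\<rho>(x := k)) y < k + 1" using Bind.prems(2) by (auto simp: less_SucI)
  obtain r2 where r2: "runs_le p (Config ?q r1 m) (cbound c ?B)
      (Config (?q + length ?cc) r2 (exec (Bind x a c) ?\<eta> m))" "\<And>i. i < k + 1 \<Longrightarrow> r2 i = r1 i"
    using Bind.IH[OF code(2) b3 b1 b2] unfolding eq exec.simps by blast
  have *: "runs_le p (Config q r m) (cbound (Bind x a c) B)
      (Config (q + length (ccomp \<rho> k q (Bind x a c))) r2 (exec (Bind x a c) ?\<eta> m))"
    using runs_le_trans[OF r1(1) r2(1)] by (simp add: Let_def add.assoc)
  show ?case by (intro exI conjI, rule *) (use r1 r2 in auto)
next
  case (For x a c)
  let ?\<eta> = "\<lambda>x. r (\<rho> x)"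
  let ?ca = "ecomp \<rho> k q a"
  define l where "l = q + length ?ca + 1"
  let ?cc = "ccomp (\<rho>(x := k + 1)) (k + 2) (l + 2) c"
  let ?n = "eval a ?\<eta> m"
  define f where "f i = exec c (?\<eta>(x := i))" for i
  define va where "va = vbound a B"
  define B' where "B' = B + va"
  define E where "E = l + 5 + length ?cc"
  let ?c1 = "[Const (k + 1) 0]" and ?c2 = "[Sub (k + 2) k (k + 1), Jump_Zero (k + 2) E]"
    and ?c3 = "[Const (k + 2) 1, Add (k + 1) (k + 1) (k + 2), Jump l]"
  have eq1: "ccomp \<rho> k q (For x a c) = ?ca @ ?c1 @ ?c2 @ ?cc @ ?c3"
    by (simp add: Let_def l_def E_def)
  have eq2: "q + length ?ca + length ?c1 = l" "l + length ?c2 = l + 2" by (simp_all add: l_def)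
  have code0: "code_at p q ?ca \<and> code_at p (q + length ?ca) ?c1 \<and> code_at p l ?c2 \<and>
      code_at p (l + 2) ?cc \<and> code_at p (l + 2 + length ?cc) ?c3"
    using For.prems(1) unfolding eq1 code_at_append eq2 by blast
  then have code: "code_at p q ?ca" "code_at p (q + length ?ca) ?c1" "code_at p l ?c2"
      "code_at p (l + 2) ?cc" "code_at p (l + 2 + length ?cc) ?c3" by blast+
  have B: "\<And>x. ?\<eta> x \<le> B" "\<And>a. m a \<le> B" using For.prems by auto
  have n: "?n \<le> va" unfolding va_def using eval_le_vbound[OF B] by auto
  obtain r1 where r1: "runs_le p (Config q r m) (ebound a B) (Config (q + length ?ca) r1 m)"
    "r1 k = ?n" "\<And>i. i < k \<Longrightarrow> r1 i = r i"
    using ecomp_correct[OF code(1) For.prems(2-4)] by auto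
  have "runs_le p (Config (q + length ?ca) r1 m) 1 (Config l (r1(k + 1 := 0)) m)"
    by (rule runs_le_stepI[OF code(2)]) (auto simp: l_def bit_length_def floorlog_def)
  note init = runs_le_trans[OF r1(1) this]
  define it where "it = cbound c B' + 4 * va + 7"
  have test: "runs_le p (Config l r' m') (3 * va + 3)
     (Config (if i < ?n then l + 2 else E) (r'(k + 2 := ?n - i)) m')"
    if "r' k = ?n" "r' (k + 1) = i" "i \<le> ?n" for r' i m'
  proof -
    have bl: "bit_length ?n \<le> va + 1" "bit_length i \<le> va + 1" "bit_length (?n - i) \<le> va + 1"
      using n that by (auto intro!: bit_length_bound)
    have 1: "runs_le p (Config l r' m') (2 * va + 2) (Config (Suc l) (r'(k + 2 := ?n - i)) m')"
      by (rule runs_le_stepI[OF code(3)]) (use that bl in auto)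
    have 2: "runs_le p (Config (Suc l) (r'(k + 2 := ?n - i)) m') (va + 1)
      (Config (if i < ?n then l + 2 else E) (r'(k + 2 := ?n - i)) m')"
      by (rule runs_le_step[where i = "Jump_Zero (k + 2) E"])
        (use code(3) that bl in \<open>auto simp: code_at_Cons\<close>)
    show ?thesis using runs_le_trans[OF 1 2] by (rule runs_le_mono) simp
  qed
  have loop: "\<exists>r''. runs_le p (Config l r' m') (j * it + 3 * va + 3) (Config E r'' (fold f [i..<?n] m')) \<and>
      (\<forall>i<k. r'' i = r i)"
    if "r' k = ?n" "r' (k + 1) = i" "\<forall>i<k. r' i = r i" "i + j = ?n" "\<forall>a. m' a \<le> B"
    for r' i j m'
    using that
  proof (induction j arbitrary: i r' m')
    case 0
    then have *: "runs_le p (Config l r' m') (0 * it + 3 * va + 3)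
        (Config E (r'(k + 2 := ?n - i)) (fold f [i..<?n] m'))"
      using test[of r' i m'] by simp
    show ?case by (intro exI conjI, rule *) (use 0 in auto)
  next
    case (Suc j)
    have i: "i < ?n" using Suc.prems by simp
    let ?r1 = "r'(k + 2 := ?n - i)"
    have 1: "runs_le p (Config l r' m') (3 * va + 3) (Config (l + 2) ?r1 m')"
      using test[of r' i m'] Suc.prems i by auto
    have eta: "(\<lambda>y. ?r1 ((\<rho>(x := k + 1)) y)) = ?\<eta>(x := i)"
    proof
      fix y show "?r1 ((\<rho>(x := k + 1)) y) = (?\<eta>(x := i)) y"
        using Suc.prems(2,3) For.prems(2)[rule_format, of y] by auto
    qed
    have "?r1 ((\<rho>(x := k + 1)) y) \<le> B'" for y
    proof -
      have "(?\<eta>(x := i)) y \<le> B'" using B(1)[of y] i n by (auto simp: B'_def)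
      then show ?thesis using fun_cong[OF eta, of y] by metis
    qed
    then have b1: "\<forall>y. ?r1 ((\<rho>(x := k + 1)) y) \<le> B'" by blast
    have b2: "\<forall>y. (\<rho>(x := k + 1)) y < k + 2" using For.prems(2) by (auto simp: less_SucI)
    have b3: "\<forall>y. m' y \<le> B'" "kmax c \<le> B'" using Suc.prems(5) For.prems(5)
      by (auto simp: B'_def trans_le_add1)
    obtain r2 where r2: "runs_le p (Config (l + 2) ?r1 m') (cbound c B')
        (Config (l + 2 + length ?cc) r2 (f i m'))"
      "\<And>i. i < k + 2 \<Longrightarrow> r2 i = ?r1 i"
      using For.IH[OF code(4) b2 b1 b3] unfolding eta f_def by blast
    \<comment> \<open>The body was estimated at the larger \<open>B'\<close> because of its loop
      variable, but the memory it leaves is bounded by \<open>B\<close> again. So nothing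
      accumulates over the iterations.\<close>
    have bd: "\<forall>a. f i m' a \<le> B" unfolding f_def using exec_bounded[of m' B c] Suc.prems(5) For.prems(5) by simp
    let ?r4 = "r2(k + 2 := 1)"
    let ?r5 = "?r4(k + 1 := Suc i)"
    let ?q = "l + 2 + length ?cc" and ?m = "f i m'"
    have r2': "r2 k = ?n" "r2 (k + 1) = i" "\<forall>i<k. r2 i = r i"
      using r2(2) Suc.prems by auto
    have bl: "bit_length i \<le> va + 1" using i n by (auto intro!: bit_length_bound)
    have 4: "runs_le p (Config ?q r2 ?m) 1 (Config (Suc ?q) ?r4 ?m)"
      by (rule runs_le_step[where i = "Const (k + 2) 1"])
       (use code(5) in \<open>auto simp: code_at_Cons code_at_Nil bit_length_def floorlog_def\<close>)
    have 5: "runs_le p (Config (Suc ?q) ?r4 ?m) (va + 2) (Config (Suc (Suc ?q)) ?r5 ?m)"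
      by (rule runs_le_step[where i = "Add (k + 1) (k + 1) (k + 2)"])
       (use code(5) r2' bl in \<open>auto simp: code_at_Cons code_at_Nil bit_length_def floorlog_def\<close>)
    have 6: "runs_le p (Config (Suc (Suc ?q)) ?r5 ?m) 1 (Config l ?r5 ?m)"
      by (rule runs_le_step[where i = "Jump l"])
       (use code(5) in \<open>auto simp: code_at_Cons code_at_Nil\<close>)
    note once = runs_le_trans[OF runs_le_trans[OF runs_le_trans[OF runs_le_trans[OF 1 r2(1)] 4] 5] 6]
    have "\<exists>r''. runs_le p (Config l ?r5 ?m) (j * it + 3 * va + 3) (Config E r'' (fold f [Suc i..<?n] ?m)) \<and>
      (\<forall>i<k. r'' i = r i)"
      by (rule Suc.IH[of _ "Suc i"]) (use r2' bd Suc.prems(4) in auto)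
    then obtain r'' where r'': "runs_le p (Config l ?r5 ?m) (j * it + 3 * va + 3)
        (Config E r'' (fold f [Suc i..<?n] ?m))" "\<forall>i<k. r'' i = r i" by blast
    have "fold f [Suc i..<?n] ?m = fold f [i..<?n] m'" using i by (simp add: upt_conv_Cons)
    then have "runs_le p (Config l r' m') (Suc j * it + 3 * va + 3) (Config E r'' (fold f [i..<?n] m'))"
      using runs_le_trans[OF once r''(1)] by (auto simp: it_def elim!: runs_le_mono)
    then show ?case using r'' by blast
  qed
  obtain r'' where r'': "runs_le p (Config l (r1(k + 1 := 0)) m) (?n * it + 3 * va + 3)
      (Config E r'' (fold f [0..<?n] m))" "\<forall>i<k. r'' i = r i"
    using loop[of "r1(k + 1 := 0)" 0 ?n m] r1 For.prems(4) by auto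
  have "?n * it \<le> va * it" using n by simp
  then have "ebound a B + 1 + (?n * it + 3 * va + 3) \<le> cbound (For x a c) B"
    by (simp add: it_def algebra_simps flip: va_def B'_def)
  then have "runs_le p (Config q r m) (cbound (For x a c) B) (Config E r'' (fold f [0..<?n] m))"
    using runs_le_trans[OF init r''(1)] runs_le_mono by blast
  moreover have "q + length (ccomp \<rho> k q (For x a c)) = E"
    by (simp add: Let_def E_def l_def)
  moreover have "exec (For x a c) ?\<eta> m = fold f [0..<?n] m"
    using ext[of f, OF f_def] by (simp only: exec.simps)
  ultimately show ?case using r'' by metis
qed

section \<open>Polynomial bounds\<close>

definition poly_bounded :: "(nat \<Rightarrow> nat) \<Rightarrow> bool" where
  "poly_bounded f \<longleftrightarrow> (\<exists>c k. \<forall>B. f B \<le> c * (B + 1) ^ k)"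

lemma poly_bounded_const: "poly_bounded (\<lambda>B. c)"
  unfolding poly_bounded_def by (rule exI[of _ c], rule exI[of _ 0]) simp

lemma poly_bounded_id: "poly_bounded (\<lambda>B. B)"
  unfolding poly_bounded_def by (rule exI[of _ 1], rule exI[of _ 1]) simp

lemma poly_bounded_mult:
  assumes "poly_bounded f" "poly_bounded g"
  shows "poly_bounded (\<lambda>B. f B * g B)"
proof -
  obtain c k c' k' where "\<And>B. f B \<le> c * (B + 1) ^ k" "\<And>B. g B \<le> c' * (B + 1) ^ k'"
    using assms unfolding poly_bounded_def by blast
  then have "f B * g B \<le> (c * (B + 1) ^ k) * (c' * (B + 1) ^ k')" for B
    by (intro mult_le_mono)
  then have "f B * g B \<le> (c * c') * (B + 1) ^ (k + k')" for B
    by (simp add: power_add ac_simps)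
  then show ?thesis unfolding poly_bounded_def by blast
qed

text \<open>The base \<open>B + 1\<close> is positive, so both bounds can be raised to the common
  exponent \<open>k + k'\<close>.\<close>

lemma poly_bounded_add:
  assumes "poly_bounded f" "poly_bounded g"
  shows "poly_bounded (\<lambda>B. f B + g B)"
proof -
  obtain c k c' k' where *: "\<And>B. f B \<le> c * (B + 1) ^ k" "\<And>B. g B \<le> c' * (B + 1) ^ k'"
    using assms unfolding poly_bounded_def by blast
  have "f B + g B \<le> (c + c') * (B + 1) ^ (k + k')" for B
  proof -
    have "c * (B + 1) ^ k \<le> c * (B + 1) ^ (k + k')" "c' * (B + 1) ^ k' \<le> c' * (B + 1) ^ (k + k')"
      by (intro mult_le_mono2 power_increasing; simp)+
    then have "f B + g B \<le> c * (B + 1) ^ (k + k') + c' * (B + 1) ^ (k + k')"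
      using *[of B] by linarith
    then show ?thesis by (simp only: add_mult_distrib)
  qed
  then show ?thesis unfolding poly_bounded_def by blast
qed

text \<open>Needed because the bodies of sums and loops are estimated at
  \<open>B + vbound a B\<close> instead of \<open>B\<close>.\<close>

lemma poly_bounded_comp:
  assumes "poly_bounded f" "poly_bounded g"
  shows "poly_bounded (\<lambda>B. f (g B))"
proof -
  obtain c k c' k' where *: "\<And>B. f B \<le> c * (B + 1) ^ k" "\<And>B. g B \<le> c' * (B + 1) ^ k'"
    using assms unfolding poly_bounded_def by blast
  have "f (g B) \<le> (c * (c' + 1) ^ k) * (B + 1) ^ (k' * k)" for B
  proof -
    have "g B + 1 \<le> (c' + 1) * (B + 1) ^ k'" 
      using *(2)[of B] one_le_power[of "B + 1" k'] unfolding add_mult_distrib mult_1 by linarith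
    then have "(g B + 1) ^ k \<le> ((c' + 1) * (B + 1) ^ k') ^ k" by (rule power_mono) simp
    also have "\<dots> = (c' + 1) ^ k * (B + 1) ^ (k' * k)" by (simp only: power_mult_distrib power_mult)
    finally have "c * (g B + 1) ^ k \<le> c * ((c' + 1) ^ k * (B + 1) ^ (k' * k))" by (rule mult_le_mono2)
    then show ?thesis using *(1)[of "g B"] unfolding mult.assoc by linarith
  qed
  then show ?thesis unfolding poly_bounded_def by blast
qed

lemma poly_bounded_Suc: "poly_bounded f \<Longrightarrow> poly_bounded (\<lambda>B. Suc (f B))"
  using poly_bounded_add[OF poly_bounded_const[of 1]] by simp

lemmas poly_bounded_intros =
  poly_bounded_const poly_bounded_id poly_bounded_Suc poly_bounded_add poly_bounded_mult

lemma poly_bounded_vbound: "poly_bounded (vbound e)"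
proof (induction e)
  case (SumE x a b)
  have "poly_bounded (\<lambda>B. vbound b (B + vbound a B))"
    by (intro poly_bounded_comp[OF SumE.IH(2)] poly_bounded_intros SumE.IH)
  then show ?case using SumE.IH by (simp add: poly_bounded_intros)
qed (simp_all add: poly_bounded_intros)

lemma poly_bounded_ebound: "poly_bounded (ebound e)"
proof (induction e)
  case (SumE x a b)
  have "poly_bounded (\<lambda>B. vbound b (B + vbound a B))" "poly_bounded (\<lambda>B. ebound b (B + vbound a B))"
    by (intro poly_bounded_comp[OF SumE.IH(2)] poly_bounded_comp[OF poly_bounded_vbound]
        poly_bounded_intros poly_bounded_vbound)+
  then show ?case using SumE.IH
    unfolding ebound.simps by (intro poly_bounded_intros poly_bounded_vbound)
qed (simp_all add: poly_bounded_intros poly_bounded_vbound)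

lemma poly_bounded_cbound: "poly_bounded (cbound c)"
proof (induction c)
  case (For x a c)
  have "poly_bounded (\<lambda>B. cbound c (B + vbound a B))"
    by (intro poly_bounded_comp[OF For.IH] poly_bounded_intros poly_bounded_vbound)
  then show ?case unfolding cbound.simps
    by (intro poly_bounded_intros poly_bounded_vbound poly_bounded_ebound)
next
  case (Bind x a c)
  have "poly_bounded (\<lambda>B. cbound c (B + vbound a B))"
    by (intro poly_bounded_comp[OF Bind.IH] poly_bounded_intros poly_bounded_vbound)
  then show ?case unfolding cbound.simps
    by (intro poly_bounded_intros poly_bounded_vbound poly_bounded_ebound)
qed (simp_all add: poly_bounded_intros poly_bounded_vbound poly_bounded_ebound)

section \<open>The algorithm in the loop language\<close>

text \<open>Numbers serve as truth values, zero being false. With truncated subtraction,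
  \<open>1 - a\<close> is the test for zero.\<close>

definition notE :: "expr \<Rightarrow> expr" where "notE a = Minus (C 1) a"
definition leE :: "expr \<Rightarrow> expr \<Rightarrow> expr" where "leE a b = notE (Minus a b)"
definition ltE :: "expr \<Rightarrow> expr \<Rightarrow> expr" where "ltE a b = leE (Plus a (C 1)) b"
definition eqE :: "expr \<Rightarrow> expr \<Rightarrow> expr" where "eqE a b = notE (Plus (Minus a b) (Minus b a))"
definition andE :: "expr \<Rightarrow> expr \<Rightarrow> expr" where "andE a b = notE (Plus (notE a) (notE b))"

text \<open>Variable 99 is a dummy, and variable 50 runs through the candidates in a minimum search.\<close>

definition ifE :: "expr \<Rightarrow> expr \<Rightarrow> expr \<Rightarrow> expr" where
  "ifE c a b = Plus (SumE 99 (notE (notE c)) a) (SumE 99 (notE c) b)"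
definition leastE :: "nat \<Rightarrow> expr \<Rightarrow> expr \<Rightarrow> expr" where
  "leastE x n P = SumE 50 n (notE (SumE x (Plus (V 50) (C 1)) P))"

lemma eval_notE [simp]: "eval (notE a) \<eta> m = of_bool (eval a \<eta> m = 0)"
  by (simp add: notE_def)

lemma eval_leE [simp]: "eval (leE a b) \<eta> m = of_bool (eval a \<eta> m \<le> eval b \<eta> m)"
  by (simp add: leE_def)

lemma eval_ltE [simp]: "eval (ltE a b) \<eta> m = of_bool (eval a \<eta> m < eval b \<eta> m)"
  by (simp add: ltE_def Suc_le_eq)

lemma eval_eqE [simp]: "eval (eqE a b) \<eta> m = of_bool (eval a \<eta> m = eval b \<eta> m)"
  by (auto simp: eqE_def)

lemma eval_andE [simp]: "eval (andE a b) \<eta> m = of_bool (eval a \<eta> m \<noteq> 0 \<and> eval b \<eta> m \<noteq> 0)"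
  by (simp add: andE_def)

text \<open>A branch is a sum with one or no iteration, which is why the dummy variable is zero
  inside it.\<close>

lemma eval_ifE [simp]:
  "eval (ifE c a b) \<eta> m = (if eval c \<eta> m \<noteq> 0 then eval a (\<eta>(99 := 0)) m else eval b (\<eta>(99 := 0)) m)"
  by (simp add: ifE_def)

lemma sum_of_bool_card: "(\<Sum>i<N. of_bool (P i)) = card {i. i < (N::nat) \<and> P i}"
  by (simp add: sum.If_cases of_bool_def Collect_conj_eq lessThan_def)

lemma sum_of_bool_eq_0: "(\<Sum>i<N. of_bool (P i)) = (0::nat) \<longleftrightarrow> (\<forall>i<(N::nat). \<not> P i)"
  by (simp only: sum_of_bool_card) auto

text \<open>The number of \<open>i\<close> below the bound such that no \<open>j \<le> i\<close>
  satisfies \<open>Q\<close> is the least solution, or the bound itself if there is none.\<close>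

lemma eval_leastE:
  assumes "\<And>i j. j < eval n \<eta> m \<Longrightarrow> eval P (\<eta>(50 := i, x := j)) m \<noteq> 0 \<longleftrightarrow> Q j"
  shows "eval (leastE x n P) \<eta> m = least_below (eval n \<eta> m) Q"
proof -
  let ?N = "eval n \<eta> m"
  have "eval (leastE x n P) \<eta> m =
      (\<Sum>i<?N. of_bool ((\<Sum>j<Suc i. eval P (\<eta>(50 := i, x := j)) m) = 0))"
    by (simp add: leastE_def del: sum.lessThan_Suc sum_eq_0_iff)
  also have "\<dots> = (\<Sum>i<?N. of_bool (\<forall>j\<le>i. \<not> Q j))"
  proof (rule sum.cong)
    fix i assume "i \<in> {..<?N}"
    then have i: "i < ?N" by simp
    have "((\<Sum>j<Suc i. eval P (\<eta>(50 := i, x := j)) m) = 0) \<longleftrightarrow>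
        (\<forall>j\<le>i. \<not> eval P (\<eta>(50 := i, x := j)) m \<noteq> 0)"
      by (simp add: Ball_def less_Suc_eq_le del: sum.lessThan_Suc)
    also have "\<dots> \<longleftrightarrow> (\<forall>j\<le>i. \<not> Q j)" using assms[of _ i] le_less_trans[OF _ i] by blast
    finally show "of_bool ((\<Sum>j<Suc i. eval P (\<eta>(50 := i, x := j)) m) = 0) = (of_bool (\<forall>j\<le>i. \<not> Q j) :: nat)"
      by (simp only:)
  qed simp
  also have "\<dots> = card {i. i < ?N \<and> (\<forall>j\<le>i. \<not> Q j)}" by (rule sum_of_bool_card)
  also have "{i. i < ?N \<and> (\<forall>j\<le>i. \<not> Q j)} = {..<least_below ?N Q}"
  proof (cases "\<exists>j<?N. Q j")
    case True
    then obtain j where "j < ?N" "Q j" by blast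
    note l = least_below_less[of j ?N Q, OF this]
    have "least_below ?N Q = (LEAST j. Q j)" using True by (simp add: least_below_def)
    then have "\<not> Q j" if "j < least_below ?N Q" for j using that not_less_Least[of j Q] by simp
    then have "i < ?N \<and> (\<forall>j\<le>i. \<not> Q j) \<longleftrightarrow> i < least_below ?N Q" for i
      using l by (meson leI le_less_trans less_trans)
    then show ?thesis by auto
  next
    case False
    then show ?thesis by (auto simp: least_below_def)
  qed
  finally show ?thesis by simp
qed

lemma fold_upt_induct:
  assumes "P 0 s" "\<And>i s. i < N \<Longrightarrow> P i s \<Longrightarrow> P (Suc i) (f i s)"
  shows "P N (fold f [0..<N] s)"
  using assms by (induction N) auto

abbreviation nE :: expr where "nE \<equiv> Ld (C 0)"
abbreviation mE :: expr where "mE \<equiv> Ld (C 1)"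
abbreviation dE :: expr where "dE \<equiv> Ld (C 2)"

text \<open>Memory layout, in blocks of length \<open>L = 3 + n \<cdot> m\<close>: the input, the working copy of the
  matrix, the guess, the core of the current graph, and two cells for the overflow flag of the
  guess and for the answer.\<close>

definition baseE :: expr where "baseE = Plus (C 3) (SumE 99 nE mE)"
definition entryE :: "expr \<Rightarrow> expr \<Rightarrow> expr" where "entryE i j = Plus (SumE 99 i mE) j"
definition workA :: "expr \<Rightarrow> expr \<Rightarrow> expr" where "workA i j = Plus baseE (entryE i j)"
definition digitA :: "expr \<Rightarrow> expr" where "digitA t = Plus (Plus baseE baseE) t"
definition coreA :: "expr \<Rightarrow> expr" where "coreA v = Plus (Plus baseE (Plus baseE baseE)) v"
definition flagA :: expr where "flagA = Plus (Plus baseE baseE) (Plus baseE baseE)"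
definition answerA :: expr where "answerA = Plus flagA (C 1)"

abbreviation workE :: "expr \<Rightarrow> expr \<Rightarrow> expr" where "workE i j \<equiv> Ld (workA i j)"

definition peel_cmd :: "expr \<Rightarrow> expr \<Rightarrow> cmd" where
  "peel_cmd nv adj = When (leE (SumE 2 nv (andE (Ld (coreA (V 2))) adj)) (C 1)) (Put 1 (coreA (V 1)) (C 0))"

definition core_cmd :: "expr \<Rightarrow> expr \<Rightarrow> cmd" where
  "core_cmd nv adj = Seq (For 1 nv (Put 1 (coreA (V 1)) (C 1))) (For 3 nv (For 1 nv (peel_cmd nv adj)))"

text \<open>A row number that is out of range is skipped. Candidates use this to idle once the graph
  is a linear forest.\<close>

definition delete_cmd :: "expr \<Rightarrow> cmd" where
  "delete_cmd r = Bind 14 r (When (ltE (V 14) nE) (For 15 mE (Put 1 (workA (V 14) (V 15)) (C 0))))"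

definition step_cmd :: "expr \<Rightarrow> expr \<Rightarrow> expr \<Rightarrow> cmd" where
  "step_cmd nv adj cand = Seq (core_cmd nv adj)
    (Bind 1 (leastE 1 nv (leE (C 3) (SumE 2 nv adj)))
    (Bind 11 (leastE 2 nv adj)
    (Bind 12 (leastE 2 nv (andE adj (notE (eqE (V 2) (V 11)))))
    (Bind 13 (leastE 2 nv (andE adj (andE (notE (eqE (V 2) (V 11))) (notE (eqE (V 2) (V 12))))))
    (delete_cmd cand)))))"

definition copy_cmd :: cmd where
  "copy_cmd = For 1 nE (For 2 mE (Put 1 (workA (V 1) (V 2)) (Ld (Plus (C 3) (entryE (V 1) (V 2))))))"

text \<open>The answer cell is set but never cleared, so it collects the disjunction over all
  guesses.\<close>

definition check_cmd :: "expr \<Rightarrow> expr \<Rightarrow> cmd" where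
  "check_cmd nv adj = Seq (core_cmd nv adj)
    (When (andE (notE (SumE 1 nv (leE (C 3) (SumE 2 nv adj)))) (notE (SumE 1 nv (Ld (coreA (V 1))))))
      (Put 1 answerA (C 1)))"

text \<open>The flag is the carry of an increment in base \<open>b\<close>, lowest digit first. If
  it is still set after the last digit, the counter has wrapped around. Variable 3 keeps the old
  digit for the carry test, which comes after the digit is overwritten.\<close>

definition increment_cmd :: "nat \<Rightarrow> cmd" where
  "increment_cmd b = Seq (Put 1 flagA (C 1)) (For 20 dE (When (Ld flagA) (Bind 3 (Ld (digitA (V 20)))
    (Seq (Put b (digitA (V 20)) (ifE (eqE (V 3) (C (b - 1))) (C 0) (Plus (V 3) (C 1))))
      (When (notE (eqE (V 3) (C (b - 1)))) (Put 1 flagA (C 0)))))))"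

definition body_cmd :: "expr \<Rightarrow> expr \<Rightarrow> expr \<Rightarrow> nat \<Rightarrow> cmd" where
  "body_cmd nv adj cand b = Seq copy_cmd (Seq (For 20 dE (step_cmd nv adj cand))
    (Seq (check_cmd nv adj) (increment_cmd b)))"

section \<open>Memory blocks and the invariant of the program\<close>

lemma entry_less_mult:
  fixes i j m n :: nat
  assumes "i < n" "j < m"
  shows "i * m + j < n * m"
proof -
  have "i * m + j < (i + 1) * m" using assms by simp
  also have "\<dots> \<le> n * m" using assms by (intro mult_le_mono1) simp
  finally show ?thesis .
qed

text \<open>These are the dimensions that remain after the prologue. They imply that
  \<open>n\<close>, \<open>m\<close> and \<open>d\<close> are below the block length, so the digits
  and the core fit into one block each.\<close>

locale ram_layout =
  fixes n m d :: nat and inc :: "nat \<Rightarrow> nat \<Rightarrow> bool"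
  assumes dims: "(n = 0 \<and> m = 0 \<and> d = 0) \<or> (0 < n \<and> 0 < m \<and> d < n)"
begin

definition L :: nat where "L = 3 + n * m"

lemma le_L: "n < L" "m < L" "d < L"
proof -
  have "n \<le> n * m" "m \<le> n * m" "d \<le> n * m"
    using dims by (auto intro: less_imp_le elim!: order.strict_trans2)
  then show "n < L" "m < L" "d < L" unfolding L_def by linarith+
qed

definition has_dims :: "(nat \<Rightarrow> nat) \<Rightarrow> bool" where
  "has_dims \<mu> \<longleftrightarrow> \<mu> 0 = n \<and> \<mu> 1 = m \<and> \<mu> 2 = d"

definition input_ok :: "(nat \<Rightarrow> nat) \<Rightarrow> bool" where
  "input_ok \<mu> \<longleftrightarrow> has_dims \<mu> \<and> (\<forall>i<n. \<forall>j<m. \<mu> (3 + (i * m + j)) = of_bool (inc i j))"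

definition work_ok :: "nat set \<Rightarrow> (nat \<Rightarrow> nat) \<Rightarrow> bool" where
  "work_ok X \<mu> \<longleftrightarrow> (\<forall>i<n. \<forall>j<m. \<mu> (L + (i * m + j)) = of_bool (i \<notin> X \<and> inc i j))"

definition digits_ok :: "(nat \<Rightarrow> nat) \<Rightarrow> (nat \<Rightarrow> nat) \<Rightarrow> bool" where
  "digits_ok w \<mu> \<longleftrightarrow> (\<forall>t<d. \<mu> (2 * L + t) = w t)"

text \<open>Nothing is said about the core block and the overflow flag, so both may be overwritten
  freely.\<close>

definition holds :: "nat set \<Rightarrow> (nat \<Rightarrow> nat) \<Rightarrow> bool \<Rightarrow> (nat \<Rightarrow> nat) \<Rightarrow> bool" where
  "holds X w ans \<mu> \<longleftrightarrow> input_ok \<mu> \<and> work_ok X \<mu> \<and> digits_ok w \<mu> \<and> \<mu> (4 * L + 1) = of_bool ans"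

lemma entry_less: "i < n \<Longrightarrow> j < m \<Longrightarrow> 3 + (i * m + j) < L"
  using entry_less_mult[of i n j m] by (simp add: L_def)

lemma entry_inj:
  assumes "j < m" "j' < m"
  shows "i * m + j = i' * m + j' \<longleftrightarrow> i = i' \<and> j = j'"
proof
  assume eq: "i * m + j = i' * m + j'"
  have "(i * m + j) div m = i" "(i' * m + j') div m = i'" using assms by simp_all
  then show "i = i' \<and> j = j'" using eq by simp
qed simp

lemma input_ok_upd: "L \<le> a \<Longrightarrow> input_ok \<mu> \<Longrightarrow> input_ok (\<mu>(a := x))"
proof -
  assume a: "L \<le> a" "input_ok \<mu>"
  have "a \<noteq> 3 + (i * m + j)" if "i < n" "j < m" for i j using entry_less[OF that] a(1) by simp
  moreover have "3 \<le> a" using a(1) by (simp add: L_def)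
  ultimately show ?thesis using a(2) by (auto simp: input_ok_def has_dims_def)
qed

lemma work_ok_upd: "2 * L \<le> a \<Longrightarrow> work_ok X \<mu> \<Longrightarrow> work_ok X (\<mu>(a := x))"
proof -
  assume a: "2 * L \<le> a" "work_ok X \<mu>"
  have "a \<noteq> L + (i * m + j)" if "i < n" "j < m" for i j using entry_less[OF that] a(1) by simp
  then show ?thesis using a(2) by (auto simp: work_ok_def)
qed

lemma digits_ok_upd: "a < 2 * L \<or> 3 * L \<le> a \<Longrightarrow> digits_ok w \<mu> \<Longrightarrow> digits_ok w (\<mu>(a := x))"
  using le_L by (auto simp: digits_ok_def)

lemma holds_upd:
  assumes "holds X w ans \<mu>" "3 * L \<le> a" "a \<noteq> 4 * L + 1"
  shows "holds X w ans (\<mu>(a := x))"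
  using assms input_ok_upd[of a \<mu> x] work_ok_upd[of a X \<mu> x] digits_ok_upd[of a w \<mu> x]
  by (auto simp: holds_def)

lemma holds_dims: "holds X w ans \<mu> \<Longrightarrow> has_dims \<mu>"
  by (simp add: holds_def input_ok_def)

context
  fixes \<mu> assumes h: "has_dims \<mu>"
begin

lemma eval_dims: "eval nE \<eta> \<mu> = n" "eval mE \<eta> \<mu> = m" "eval dE \<eta> \<mu> = d"
  using h by (simp_all add: has_dims_def)

lemma eval_baseE: "eval baseE \<eta> \<mu> = L"
  using h by (simp add: baseE_def has_dims_def L_def)

lemma eval_entryE: "eval (entryE i j) \<eta> \<mu> = eval i \<eta> \<mu> * m + eval j \<eta> \<mu>"
  using h by (simp add: entryE_def has_dims_def)

lemma eval_addresses:
  "eval (workA i j) \<eta> \<mu> = L + (eval i \<eta> \<mu> * m + eval j \<eta> \<mu>)"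
  "eval (digitA t) \<eta> \<mu> = 2 * L + eval t \<eta> \<mu>"
  "eval (coreA v) \<eta> \<mu> = 3 * L + eval v \<eta> \<mu>"
  "eval flagA \<eta> \<mu> = 4 * L"
  "eval answerA \<eta> \<mu> = 4 * L + 1"
  using eval_baseE eval_entryE
  by (simp_all add: workA_def digitA_def coreA_def flagA_def answerA_def)

end

end

section \<open>Computing the core by peeling\<close>

definition peel :: "(nat \<Rightarrow> nat \<Rightarrow> bool) \<Rightarrow> nat \<Rightarrow> nat set \<Rightarrow> nat set" where
  "peel E v S = (if card {u\<in>S. E v u} \<le> 1 then S - {v} else S)"

text \<open>A vertex of a set \<open>T\<close> of minimum degree two keeps two neighbours as long as
  \<open>T\<close> is still present, so \<open>T\<close> is never touched. A pass that removes
  nothing has tested every vertex against the full set \<open>S\<close>.\<close>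

lemma peel_pass:
  assumes "finite S"
  shows "fold (peel E) [0..<N] S \<subseteq> S"
    and "S \<subseteq> {..<N} \<Longrightarrow> fold (peel E) [0..<N] S = S \<Longrightarrow> min_degree_two E S"
    and "T \<subseteq> S \<Longrightarrow> min_degree_two E T \<Longrightarrow> T \<subseteq> fold (peel E) [0..<N] S"
proof -
  have 1: "fold (peel E) [0..<N] S \<subseteq> S \<and> (fold (peel E) [0..<N] S = S \<longrightarrow> (\<forall>v<N. v \<in> S \<longrightarrow> 2 \<le> card {u\<in>S. E v u}))"
  proof (rule fold_upt_induct[where P = "\<lambda>i S'. S' \<subseteq> S \<and> (S' = S \<longrightarrow> (\<forall>v<i. v \<in> S \<longrightarrow> 2 \<le> card {u\<in>S. E v u}))"])
    fix i S'
    assume *: "S' \<subseteq> S \<and> (S' = S \<longrightarrow> (\<forall>v<i. v \<in> S \<longrightarrow> 2 \<le> card {u\<in>S. E v u}))"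
    show "peel E i S' \<subseteq> S \<and> (peel E i S' = S \<longrightarrow> (\<forall>v<Suc i. v \<in> S \<longrightarrow> 2 \<le> card {u\<in>S. E v u}))"
    proof (intro conjI impI allI)
      show "peel E i S' \<subseteq> S" using * by (auto simp: peel_def)
      fix v assume eq: "peel E i S' = S" and v: "v < Suc i" "v \<in> S"
      have "S' = S" using eq * by (auto simp: peel_def split: if_splits)
      moreover have "2 \<le> card {u\<in>S. E i u}" if "i \<in> S"
        using eq that \<open>S' = S\<close> by (auto simp: peel_def split: if_splits)
      ultimately show "2 \<le> card {u\<in>S. E v u}" using * v by (auto simp: less_Suc_eq)
    qed
  qed simp
  then show "fold (peel E) [0..<N] S \<subseteq> S" by blast
  show "S \<subseteq> {..<N} \<Longrightarrow> fold (peel E) [0..<N] S = S \<Longrightarrow> min_degree_two E S"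
    using 1 unfolding min_degree_two_def by blast
  assume T: "T \<subseteq> S" "min_degree_two E T"
  have "T \<subseteq> fold (peel E) [0..<N] S \<and> finite (fold (peel E) [0..<N] S)"
  proof (rule fold_upt_induct[where P = "\<lambda>i S'. T \<subseteq> S' \<and> finite S'"])
    fix i S' assume S': "T \<subseteq> S' \<and> finite S'"
    have "\<not> card {u\<in>S'. E i u} \<le> 1" if "i \<in> T"
    proof -
      have "2 \<le> card {u\<in>T. E i u}" using T(2) that by (simp add: min_degree_two_def)
      also have "\<dots> \<le> card {u\<in>S'. E i u}" using S' by (intro card_mono) auto
      finally show ?thesis by simp
    qed
    then show "T \<subseteq> peel E i S' \<and> finite (peel E i S')" using S' by (auto simp: peel_def)
  qed (use T assms in simp)
  then show "T \<subseteq> fold (peel E) [0..<N] S" by blast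
qed

text \<open>A pass that starts from a set without minimum degree two removes a vertex, because it
  must not return the set unchanged. So \<open>N\<close> passes suffice.\<close>

lemma peel_passes: "fold (\<lambda>_. fold (peel E) [0..<N]) [0..<N] {..<N} = core N E"
proof -
  let ?S = "fold (\<lambda>_. fold (peel E) [0..<N]) [0..<N] {..<N}"
  let ?P = "\<lambda>k S. S \<subseteq> {..<N} \<and> core N E \<subseteq> S \<and> (min_degree_two E S \<or> card S + k \<le> N)"
  have "?P N ?S"
  proof (rule fold_upt_induct[where P = ?P])
    fix k S assume S: "?P k S"
    let ?T = "fold (peel E) [0..<N] S"
    have fin: "finite S" using S finite_subset by blast
    have sub: "?T \<subseteq> S" by (rule peel_pass(1)[OF fin])
    have "core N E \<subseteq> ?T" using S min_degree_two_core by (intro peel_pass(3)[OF fin]) auto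
    moreover have "min_degree_two E ?T \<or> card ?T + Suc k \<le> N"
    proof (cases "?T = S")
      case True
      then show ?thesis using peel_pass(2)[OF fin] S by auto
    next
      case False
      then have "card ?T < card S" using sub fin by (intro psubset_card_mono) auto
      moreover have "\<not> min_degree_two E S"
        using peel_pass(3)[OF fin, of S E N] sub False by auto
      ultimately show ?thesis using S by auto
    qed
    ultimately show "?P (Suc k) ?T" using S sub by auto
  qed (auto simp: core_subset)
  \<comment> \<open>Otherwise \<open>N\<close> vertices have been removed, and the empty set has
    minimum degree two.\<close>
  then have "min_degree_two E ?S"
    by (auto simp: min_degree_two_def dest: finite_subset)
  then show ?thesis using \<open>?P N ?S\<close> core_greatest[of ?S N E] by auto
qed

section \<open>Counting in base \<open>b\<close> and the search over all guesses\<close>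

definition digit :: "nat \<Rightarrow> nat \<Rightarrow> nat \<Rightarrow> nat" where
  "digit b i t = i div b ^ t mod b"

text \<open>\<open>b ^ t dvd Suc i\<close> says that all digits of \<open>i\<close> below
  \<open>t\<close> equal \<open>b - 1\<close>, that is, that incrementing carries into position
  \<open>t\<close>. The second part is the propagation of the carry.\<close>

lemma digit_Suc:
  assumes "2 \<le> b"
  shows "digit b (Suc i) t = (if b ^ t dvd Suc i then if digit b i t = b - 1 then 0 else Suc (digit b i t)
      else digit b i t)"
    and "b ^ Suc t dvd Suc i \<longleftrightarrow> b ^ t dvd Suc i \<and> digit b i t = b - 1"
proof -
  let ?q = "i div b ^ t"
  have div: "Suc i div b ^ t = (if b ^ t dvd Suc i then Suc ?q else ?q)"
    by (simp add: div_Suc dvd_eq_mod_eq_0)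
  have lt: "?q mod b < b" using assms by simp
  then show "digit b (Suc i) t = (if b ^ t dvd Suc i then if digit b i t = b - 1 then 0 else Suc (digit b i t)
      else digit b i t)"
    using assms by (auto simp: digit_def div mod_Suc)
  have "b ^ Suc t dvd Suc i \<longleftrightarrow> b ^ t dvd Suc i \<and> b dvd Suc i div b ^ t"
  proof (cases "b ^ t dvd Suc i")
    case True
    then obtain k where k: "Suc i = b ^ t * k" by (rule dvdE)
    have "b ^ t \<noteq> 0" using assms by simp
    then have "b ^ t * b dvd b ^ t * k \<longleftrightarrow> b dvd b ^ t * k div b ^ t"
      by (simp only: dvd_times_left_cancel_iff nonzero_mult_div_cancel_left not_False_eq_True)
    then show ?thesis using True by (simp only: k power_Suc2 simp_thms)
  next
    case False
    then show ?thesis by (auto dest: dvd_mult_right)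
  qed
  also have "\<dots> \<longleftrightarrow> b ^ t dvd Suc i \<and> b dvd Suc ?q" using div by auto
  also have "\<dots> \<longleftrightarrow> b ^ t dvd Suc i \<and> digit b i t = b - 1"
    using lt assms by (auto simp: digit_def dvd_eq_mod_eq_0 mod_Suc)
  finally show "b ^ Suc t dvd Suc i \<longleftrightarrow> b ^ t dvd Suc i \<and> digit b i t = b - 1" .
qed

lemma digits_surj:
  assumes "\<And>t. w t < b"
  shows "\<exists>i<b ^ d. \<forall>t<d. digit b i t = w t"
proof (induction d)
  case (Suc d)
  then obtain i where i: "i < b ^ d" "\<forall>t<d. digit b i t = w t" by blast
  let ?i = "i + w d * b ^ d"
  have b: "0 < b" using assms[of 0] by simp
  have "i + w d * b ^ d < (w d + 1) * b ^ d" using i(1) by simp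
  also have "\<dots> \<le> b * b ^ d" using assms[of d] by (intro mult_le_mono1) simp
  finally have "?i < b ^ Suc d" by simp
  moreover have "digit b ?i t = w t" if t: "t < Suc d" for t
  proof (cases "t = d")
    case True
    then show ?thesis using i(1) assms[of d] b by (simp add: digit_def)
  next
    case False
    then have "t < d" using t by simp
    then have "b ^ d = b ^ t * (b * b ^ (d - Suc t))"
      by (metis Suc_diff_Suc le_add_diff_inverse less_imp_le power_Suc power_add)
    then have eq: "?i = i + b ^ t * (b * (w d * b ^ (d - Suc t)))" by simp
    have "?i div b ^ t = b * (w d * b ^ (d - Suc t)) + i div b ^ t"
      unfolding eq by (rule div_mult_self2) (use b in simp)
    then have "digit b ?i t = digit b i t" unfolding digit_def by simp
    then show ?thesis using i(2) \<open>t < d\<close> by simp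
  qed
  ultimately show ?case by blast
qed simp

text \<open>The common interface of the two problems, which run the same commands with different
  expressions. \<open>adj\<close> reads its vertices from variables 1 and 2. \<open>cand\<close> is
  evaluated when the core is in memory and the claw and its neighbours are bound to 1, 11, 12 and
  13; it returns \<open>n\<close>, no row number, if nothing is left to be deleted.\<close>

locale branching = ram_layout +
  fixes nv :: expr and NV :: nat and adj cand :: expr and G :: "nat set \<Rightarrow> nat \<Rightarrow> nat \<Rightarrow> bool"
    and pick :: "nat set \<Rightarrow> nat \<Rightarrow> nat" and b :: nat
  assumes nv: "\<And>\<mu> \<eta>. has_dims \<mu> \<Longrightarrow> eval nv \<eta> \<mu> = NV" and NV: "NV < L" and b: "2 \<le> b"
    and adj: "\<And>X w ans \<mu> \<eta>. holds X w ans \<mu> \<Longrightarrow> \<eta> 1 < NV \<Longrightarrow> \<eta> 2 < NV \<Longrightarrow>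
      eval adj \<eta> \<mu> = of_bool (G X (\<eta> 1) (\<eta> 2))"
    and cand: "\<And>X w ans \<mu> \<eta>. holds X w ans \<mu> \<Longrightarrow>
      (\<And>v. v < NV \<Longrightarrow> \<mu> (3 * L + v) = of_bool (v \<in> core NV (G X))) \<Longrightarrow> \<eta> 1 = claw NV (G X) \<Longrightarrow>
      (claw NV (G X) < NV \<Longrightarrow> \<eta> 11 = nbr1 NV (G X) \<and> \<eta> 12 = nbr2 NV (G X) \<and> \<eta> 13 = nbr3 NV (G X)) \<Longrightarrow>
      \<eta> 20 < d \<Longrightarrow> eval cand \<eta> \<mu> = (if linear_forest {..<NV} (G X) then n else pick X (w (\<eta> 20)))"
    and pick: "\<And>X i. \<not> linear_forest {..<NV} (G X) \<Longrightarrow> i < b \<Longrightarrow> pick X i \<in> {..<n} - X"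
    and safe: "\<And>X S. X \<subseteq> S \<Longrightarrow> S \<subseteq> {..<n} \<Longrightarrow> \<not> linear_forest {..<NV} (G X) \<Longrightarrow>
      linear_forest {..<NV} (G S) \<Longrightarrow> \<exists>S'. X \<subseteq> S' \<and> S' \<subseteq> {..<n} \<and>
        linear_forest {..<NV} (G S') \<and> card S' \<le> card S \<and> (\<exists>i<b. pick X i \<in> S')"
begin

definition core_ok :: "nat set \<Rightarrow> (nat \<Rightarrow> nat) \<Rightarrow> bool" where
  "core_ok S \<mu> \<longleftrightarrow> S \<subseteq> {..<NV} \<and> (\<forall>v<NV. \<mu> (3 * L + v) = of_bool (v \<in> S))"

lemma peel_cmd_correct:
  assumes h: "holds X w ans \<mu>" and S: "core_ok S \<mu>" and v: "v < NV"
  shows "holds X w ans (exec (peel_cmd nv adj) (\<eta>(1 := v)) \<mu>) \<and>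
    core_ok (peel (G X) v S) (exec (peel_cmd nv adj) (\<eta>(1 := v)) \<mu>)"
proof -
  note hd = holds_dims[OF h]
  have "eval (SumE 2 nv (andE (Ld (coreA (V 2))) adj)) (\<eta>(1 := v)) \<mu> =
      (\<Sum>u<NV. of_bool (u \<in> S \<and> G X v u))"
    using S v unfolding eval.simps nv[OF hd] eval_andE eval_addresses[OF hd] core_ok_def
    by (intro sum.cong) (auto simp: adj[OF h])
  also have "\<dots> = card {u. u < NV \<and> u \<in> S \<and> G X v u}" by (rule sum_of_bool_card)
  also have "{u. u < NV \<and> u \<in> S \<and> G X v u} = {u\<in>S. G X v u}" using S by (auto simp: core_ok_def)
  finally have deg: "eval (SumE 2 nv (andE (Ld (coreA (V 2))) adj)) (\<eta>(1 := v)) \<mu> = card {u\<in>S. G X v u}" .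
  have ex: "exec (peel_cmd nv adj) (\<eta>(1 := v)) \<mu> =
      (if card {u\<in>S. G X v u} \<le> 1 then \<mu>(3 * L + v := 0) else \<mu>)"
    unfolding peel_cmd_def exec.simps eval_leE deg eval_addresses[OF hd] by simp
  have "3 * L + v \<noteq> 4 * L + 1" using v NV by simp
  then have "holds X w ans (\<mu>(3 * L + v := 0))" using holds_upd[OF h] by simp
  moreover have "core_ok (S - {v}) (\<mu>(3 * L + v := 0))" using S by (auto simp: core_ok_def)
  ultimately show ?thesis unfolding ex peel_def using h S by auto
qed

lemma core_cmd_correct:
  assumes h: "holds X w ans \<mu>"
  shows "holds X w ans (exec (core_cmd nv adj) \<eta> \<mu>) \<and> core_ok (core NV (G X)) (exec (core_cmd nv adj) \<eta> \<mu>)"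
proof -
  note hd = holds_dims[OF h]
  let ?\<mu>1 = "exec (For 1 nv (Put 1 (coreA (V 1)) (C 1))) \<eta> \<mu>"
  have "holds X w ans ?\<mu>1 \<and> (\<forall>v<NV. ?\<mu>1 (3 * L + v) = 1)"
    unfolding exec.simps nv[OF hd]
  proof (rule fold_upt_induct[where P = "\<lambda>i \<mu>. holds X w ans \<mu> \<and> (\<forall>v<i. \<mu> (3 * L + v) = 1)"])
    fix i \<mu>' assume i: "i < NV" and P: "holds X w ans \<mu>' \<and> (\<forall>v<i. \<mu>' (3 * L + v) = 1)"
    have "3 * L + i \<noteq> 4 * L + 1" using i NV by simp
    then have "holds X w ans (\<mu>'(3 * L + i := 1))" using P holds_upd by simp
    moreover have "has_dims \<mu>'" using P holds_dims by blast
    then have "\<mu>'(eval (coreA (V 1)) (\<eta>(1 := i)) \<mu>' := min (eval (C 1) (\<eta>(1 := i)) \<mu>') 1) = \<mu>'(3 * L + i := 1)"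
      by (simp add: eval_addresses)
    ultimately show "holds X w ans (\<mu>'(eval (coreA (V 1)) (\<eta>(1 := i)) \<mu>' := min (eval (C 1) (\<eta>(1 := i)) \<mu>') 1)) \<and>
        (\<forall>v<Suc i. (\<mu>'(eval (coreA (V 1)) (\<eta>(1 := i)) \<mu>' := min (eval (C 1) (\<eta>(1 := i)) \<mu>') 1)) (3 * L + v) = 1)"
      using P by (simp only:) (auto simp: less_Suc_eq)
  qed (use h in simp)
  then have h1: "holds X w ans ?\<mu>1" and c1: "core_ok {..<NV} ?\<mu>1" by (auto simp: core_ok_def)
  let ?R = "\<lambda>S \<mu>. holds X w ans \<mu> \<and> core_ok S \<mu>"
  have pass: "?R (fold (peel (G X)) [0..<NV] S) (exec (For 1 nv (peel_cmd nv adj)) \<eta>' \<mu>')" if "?R S \<mu>'" for S \<mu>' \<eta>'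
  proof -
    have hd: "has_dims \<mu>'" using that holds_dims by blast
    show ?thesis unfolding exec.simps nv[OF hd]
    proof (rule fold_upt_induct[where P = "\<lambda>i. ?R (fold (peel (G X)) [0..<i] S)"])
      fix i \<mu>'' assume "i < NV" "?R (fold (peel (G X)) [0..<i] S) \<mu>''"
      then show "?R (fold (peel (G X)) [0..<Suc i] S) (exec (peel_cmd nv adj) (\<eta>'(1 := i)) \<mu>'')"
        using peel_cmd_correct[of X w ans \<mu>'' "fold (peel (G X)) [0..<i] S" i \<eta>'] by simp
    qed (use that in simp)
  qed
  have "?R (fold (\<lambda>_. fold (peel (G X)) [0..<NV]) [0..<NV] {..<NV})
      (exec (For 3 nv (For 1 nv (peel_cmd nv adj))) \<eta> ?\<mu>1)"
    unfolding exec.simps(4)[of 3] nv[OF holds_dims[OF h1]]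
  proof (rule fold_upt_induct[where P = "\<lambda>i. ?R (fold (\<lambda>_. fold (peel (G X)) [0..<NV]) [0..<i] {..<NV})"])
    fix i \<mu>' assume "?R (fold (\<lambda>_. fold (peel (G X)) [0..<NV]) [0..<i] {..<NV}) \<mu>'"
    from pass[OF this] show "?R (fold (\<lambda>_. fold (peel (G X)) [0..<NV]) [0..<Suc i] {..<NV})
        (exec (For 1 nv (peel_cmd nv adj)) (\<eta>(3 := i)) \<mu>')" by simp
  qed (use h1 c1 in simp)
  then show ?thesis unfolding peel_passes core_cmd_def exec.simps(2) .
qed

lemma delete_cmd_correct:
  assumes h: "holds X w ans \<mu>"
  shows "holds (if eval r \<eta> \<mu> < n then insert (eval r \<eta> \<mu>) X else X) w ans (exec (delete_cmd r) \<eta> \<mu>)"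
proof (cases "eval r \<eta> \<mu> < n")
  case False
  then show ?thesis using h eval_dims[OF holds_dims[OF h]] by (simp add: delete_cmd_def)
next
  case True
  define x where "x = eval r \<eta> \<mu>"
  let ?\<eta> = "\<eta>(14 := x)"
  \<comment> \<open>\<open>holds\<close> fails while row \<open>x\<close> is only partly erased, so
    the invariant describes the entries directly: \<open>k\<close> columns of row \<open>x\<close>
    are cleared.\<close>
  let ?P = "\<lambda>k \<mu>. input_ok \<mu> \<and> digits_ok w \<mu> \<and> \<mu> (4 * L + 1) = of_bool ans \<and>
      (\<forall>i<n. \<forall>j<m. \<mu> (L + (i * m + j)) = of_bool (\<not> (i = x \<and> j < k) \<and> i \<notin> X \<and> inc i j))"
  have x: "x < n" using True by (simp add: x_def)
  have "?P m (fold (\<lambda>i. exec (Put 1 (workA (V 14) (V 15)) (C 0)) (?\<eta>(15 := i))) [0..<m] \<mu>)"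
  proof (rule fold_upt_induct[where P = ?P])
    fix k \<mu>' assume k: "k < m" and P: "?P k \<mu>'"
    have hd: "has_dims \<mu>'" using P by (simp add: input_ok_def)
    have lt: "3 + (x * m + k) < L" by (rule entry_less[OF x k])
    have ex: "exec (Put 1 (workA (V 14) (V 15)) (C 0)) (?\<eta>(15 := k)) \<mu>' = \<mu>'(L + (x * m + k) := 0)"
      by (simp add: eval_addresses[OF hd])
    have "input_ok (\<mu>'(L + (x * m + k) := 0))" "digits_ok w (\<mu>'(L + (x * m + k) := 0))"
      "(\<mu>'(L + (x * m + k) := 0)) (4 * L + 1) = of_bool ans"
      using P input_ok_upd digits_ok_upd lt by auto
    moreover have "(\<mu>'(L + (x * m + k) := 0)) (L + (i * m + j)) = of_bool (\<not> (i = x \<and> j < Suc k) \<and> i \<notin> X \<and> inc i j)"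
      if "i < n" "j < m" for i j
      using P that entry_inj[OF that(2) k, of i x] by (auto simp: less_Suc_eq)
    ultimately show "?P (Suc k) (exec (Put 1 (workA (V 14) (V 15)) (C 0)) (?\<eta>(15 := k)) \<mu>')"
      unfolding ex by blast
  qed (use h in \<open>auto simp: holds_def work_ok_def\<close>)
  then have "holds (insert x X) w ans (fold (\<lambda>i. exec (Put 1 (workA (V 14) (V 15)) (C 0)) (?\<eta>(15 := i))) [0..<m] \<mu>)"
    unfolding holds_def work_ok_def by auto
  moreover have "exec (delete_cmd r) \<eta> \<mu> = fold (\<lambda>i. exec (Put 1 (workA (V 14) (V 15)) (C 0)) (?\<eta>(15 := i))) [0..<m] \<mu>"
    unfolding delete_cmd_def exec.simps x_def[symmetric] eval_ltE eval_dims[OF holds_dims[OF h]] using x by simp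
  ultimately show ?thesis using True by (simp add: x_def)
qed

lemma eval_degree:
  assumes h: "holds X w ans \<mu>" and v: "\<eta> 1 < NV"
  shows "eval (SumE 2 nv adj) \<eta> \<mu> = card {u. u < NV \<and> G X (\<eta> 1) u}"
proof -
  have "eval (SumE 2 nv adj) \<eta> \<mu> = (\<Sum>u<NV. of_bool (G X (\<eta> 1) u))"
    unfolding eval.simps nv[OF holds_dims[OF h]] by (intro sum.cong) (use v in \<open>auto simp: adj[OF h]\<close>)
  then show ?thesis by (simp only: sum_of_bool_card)
qed

text \<open>A genuine pick is below \<open>n\<close> and passes the range test of the deletion; the
  value \<open>n\<close>, returned for a linear forest, does not.\<close>

lemma step_cmd_correct:
  assumes h: "holds X w ans \<mu>" and t: "\<eta> 20 < d" "w (\<eta> 20) < b"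
  shows "holds (if linear_forest {..<NV} (G X) then X else insert (pick X (w (\<eta> 20))) X) w ans
    (exec (step_cmd nv adj cand) \<eta> \<mu>)"
proof -
  define \<mu>1 where "\<mu>1 = exec (core_cmd nv adj) \<eta> \<mu>"
  have h1: "holds X w ans \<mu>1" and c1: "core_ok (core NV (G X)) \<mu>1"
    using core_cmd_correct[OF h] unfolding \<mu>1_def by auto
  note nv1 = nv[OF holds_dims[OF h1]]
  define v where "v = eval (leastE 1 nv (leE (C 3) (SumE 2 nv adj))) \<eta> \<mu>1"
  have v: "v = claw NV (G X)"
    unfolding v_def claw_def nv1[of \<eta>, symmetric]
    by (rule eval_leastE) (use eval_degree[OF h1] in \<open>auto simp: nv1 simp del: eval.simps(6)\<close>)
  define \<eta>1 where "\<eta>1 = \<eta>(1 := v)"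
  define u1 where "u1 = eval (leastE 2 nv adj) \<eta>1 \<mu>1"
  define \<eta>2 where "\<eta>2 = \<eta>1(11 := u1)"
  define u2 where "u2 = eval (leastE 2 nv (andE adj (notE (eqE (V 2) (V 11))))) \<eta>2 \<mu>1"
  define \<eta>3 where "\<eta>3 = \<eta>2(12 := u2)"
  define u3 where "u3 = eval (leastE 2 nv (andE adj (andE (notE (eqE (V 2) (V 11))) (notE (eqE (V 2) (V 12)))))) \<eta>3 \<mu>1"
  define \<eta>4 where "\<eta>4 = \<eta>3(13 := u3)"
  have us: "\<eta>4 11 = nbr1 NV (G X) \<and> \<eta>4 12 = nbr2 NV (G X) \<and> \<eta>4 13 = nbr3 NV (G X)" if lt: "claw NV (G X) < NV"
  proof -
    have u1: "u1 = nbr1 NV (G X)"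
      unfolding u1_def nbr1_def nv1[of \<eta>1, symmetric]
      by (rule eval_leastE) (use lt in \<open>auto simp: nv1 \<eta>1_def v adj[OF h1]\<close>)
    have u2: "u2 = nbr2 NV (G X)"
      unfolding u2_def nbr2_def nv1[of \<eta>2, symmetric]
      by (rule eval_leastE) (use lt in \<open>auto simp: nv1 \<eta>1_def \<eta>2_def v u1 adj[OF h1]\<close>)
    have u3: "u3 = nbr3 NV (G X)"
      unfolding u3_def nbr3_def nv1[of \<eta>3, symmetric]
      by (rule eval_leastE) (use lt in \<open>auto simp: nv1 \<eta>1_def \<eta>2_def \<eta>3_def v u1 u2 adj[OF h1]\<close>)
    show ?thesis by (simp add: u1 u2 u3 \<eta>1_def \<eta>2_def \<eta>3_def \<eta>4_def)
  qed
  have "eval cand \<eta>4 \<mu>1 = (if linear_forest {..<NV} (G X) then n else pick X (w (\<eta>4 20)))"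
    by (rule cand[OF h1]) (use c1 us t in \<open>auto simp: core_ok_def \<eta>1_def \<eta>2_def \<eta>3_def \<eta>4_def v\<close>)
  then have c: "eval cand \<eta>4 \<mu>1 = (if linear_forest {..<NV} (G X) then n else pick X (w (\<eta> 20)))"
    by (simp add: \<eta>1_def \<eta>2_def \<eta>3_def \<eta>4_def)
  have "exec (step_cmd nv adj cand) \<eta> \<mu> = exec (delete_cmd cand) \<eta>4 \<mu>1"
    unfolding step_cmd_def exec.simps \<mu>1_def[symmetric]
    unfolding v_def[symmetric] \<eta>1_def[symmetric] unfolding u1_def[symmetric] \<eta>2_def[symmetric]
    unfolding u2_def[symmetric] \<eta>3_def[symmetric] unfolding u3_def[symmetric] \<eta>4_def[symmetric] ..
  then show ?thesis
    using delete_cmd_correct[OF h1, of cand \<eta>4] pick[of X "w (\<eta> 20)"] t(2) unfolding c by auto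
qed

lemma copy_cmd_correct:
  assumes "input_ok \<mu>" "digits_ok w \<mu>" "\<mu> (4 * L + 1) = of_bool ans"
  shows "holds {} w ans (exec copy_cmd \<eta> \<mu>)"
proof -
  let ?I = "\<lambda>\<mu>. input_ok \<mu> \<and> digits_ok w \<mu> \<and> \<mu> (4 * L + 1) = of_bool ans"
  let ?P = "\<lambda>k \<mu>. ?I \<mu> \<and> (\<forall>i<k. \<forall>j<m. \<mu> (L + (i * m + j)) = of_bool (inc i j))"
  let ?Q = "\<lambda>k l \<mu>. ?P k \<mu> \<and> (\<forall>j<l. \<mu> (L + (k * m + j)) = of_bool (inc k j))"
  let ?c = "Put 1 (workA (V 1) (V 2)) (Ld (Plus (C 3) (entryE (V 1) (V 2))))"
  have hd: "has_dims \<mu>" using assms by (simp add: input_ok_def)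
  have "?P n (exec copy_cmd \<eta> \<mu>)"
    unfolding copy_cmd_def exec.simps(4)[of 1] eval_dims[OF hd]
  proof (rule fold_upt_induct[where P = ?P])
    fix k \<mu>' assume k: "k < n" and P: "?P k \<mu>'"
    have hd': "has_dims \<mu>'" using P by (simp add: input_ok_def)
    have "?Q k m (exec (For 2 mE ?c) (\<eta>(1 := k)) \<mu>')"
      unfolding exec.simps(4) eval_dims[OF hd']
    proof (rule fold_upt_induct[where P = "?Q k"])
      fix l \<mu>'' assume l: "l < m" and Q: "?Q k l \<mu>''"
      have hd'': "has_dims \<mu>''" using Q by (simp add: input_ok_def)
      have "\<mu>'' (3 + (k * m + l)) = of_bool (inc k l)" using Q k l by (simp add: input_ok_def)
      then have ex: "exec ?c (\<eta>(1 := k, 2 := l)) \<mu>'' = \<mu>''(L + (k * m + l) := of_bool (inc k l))"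
        by (simp add: eval_addresses[OF hd''] eval_entryE[OF hd''])
      have lt: "3 + (k * m + l) < L" by (rule entry_less[OF k l])
      have "?I (\<mu>''(L + (k * m + l) := of_bool (inc k l)))"
        using Q input_ok_upd digits_ok_upd lt by auto
      moreover have "(\<mu>''(L + (k * m + l) := of_bool (inc k l))) (L + (i * m + j)) = of_bool (inc i j)"
        if "i < k \<and> j < m \<or> i = k \<and> j < Suc l" for i j
      proof -
        have "j < m" using that l by auto
        from entry_inj[OF this l, of i k] show ?thesis using Q that by (auto simp: less_Suc_eq)
      qed
      ultimately show "?Q k (Suc l) (exec ?c (\<eta>(1 := k, 2 := l)) \<mu>'')" unfolding ex by blast
    qed (use P in simp)
    then show "?P (Suc k) (exec (For 2 mE ?c) (\<eta>(1 := k)) \<mu>')" by (auto simp: less_Suc_eq)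
  qed (use assms in simp)
  then show ?thesis by (simp add: holds_def work_ok_def)
qed

lemma check_cmd_correct:
  assumes h: "holds X w ans \<mu>"
  shows "holds X w (ans \<or> linear_forest {..<NV} (G X)) (exec (check_cmd nv adj) \<eta> \<mu>)"
proof -
  define \<mu>1 where "\<mu>1 = exec (core_cmd nv adj) \<eta> \<mu>"
  have h1: "holds X w ans \<mu>1" and c1: "core_ok (core NV (G X)) \<mu>1"
    using core_cmd_correct[OF h] unfolding \<mu>1_def by auto
  note hd = holds_dims[OF h1]
  have "eval (SumE 1 nv (leE (C 3) (SumE 2 nv adj))) \<eta> \<mu>1 = (\<Sum>v<NV. of_bool (3 \<le> card {u. u < NV \<and> G X v u}))"
    unfolding eval.simps(6)[of 1] eval_leE nv[OF hd]
    by (intro sum.cong) (use eval_degree[OF h1] in \<open>auto simp del: eval.simps(6)\<close>)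
  then have 1: "eval (SumE 1 nv (leE (C 3) (SumE 2 nv adj))) \<eta> \<mu>1 = 0 \<longleftrightarrow> claw NV (G X) = NV"
    by (simp only: claw_def least_below_eq_iff sum_of_bool_eq_0)
  have "eval (SumE 1 nv (Ld (coreA (V 1)))) \<eta> \<mu>1 = (\<Sum>v<NV. of_bool (v \<in> core NV (G X)))"
    unfolding eval.simps nv[OF hd] eval_addresses[OF hd]
    by (intro sum.cong) (use c1 in \<open>auto simp: core_ok_def\<close>)
  then have 2: "eval (SumE 1 nv (Ld (coreA (V 1)))) \<eta> \<mu>1 = 0 \<longleftrightarrow> core NV (G X) = {}"
    using core_subset[of NV "G X"] by (simp only: sum_of_bool_eq_0) blast
  have ex: "exec (check_cmd nv adj) \<eta> \<mu> = (if linear_forest {..<NV} (G X) then \<mu>1(4 * L + 1 := 1) else \<mu>1)"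
    unfolding check_cmd_def exec.simps \<mu>1_def[symmetric] eval_andE eval_notE 1 2 eval_addresses[OF hd]
      linear_forest_iff_claw_core by simp
  show ?thesis
    using h1 input_ok_upd[of "4 * L + 1" \<mu>1 1] work_ok_upd[of "4 * L + 1" X \<mu>1 1] digits_ok_upd[of "4 * L + 1" w \<mu>1 1]
    unfolding ex holds_def by auto
qed

lemma increment_cmd_correct:
  assumes h: "holds X (digit b i) ans \<mu>"
  shows "holds X (digit b (Suc i)) ans (exec (increment_cmd b) \<eta> \<mu>) \<and>
    exec (increment_cmd b) \<eta> \<mu> (4 * L) = of_bool (b ^ d dvd Suc i)"
proof -
  \<comment> \<open>Halfway state: the digits below \<open>t\<close> already belong to
    \<open>Suc i\<close>, the others still to \<open>i\<close>, and the flag is the carry into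
    position \<open>t\<close>.\<close>
  define w where "w t s = (if s < t then digit b (Suc i) s else digit b i s)" for t s
  let ?P = "\<lambda>t \<mu>. holds X (w t) ans \<mu> \<and> \<mu> (4 * L) = of_bool (b ^ t dvd Suc i)"
  let ?e = "eqE (V 3) (C (b - 1))"
  let ?c = "When (Ld flagA) (Bind 3 (Ld (digitA (V 20)))
    (Seq (Put b (digitA (V 20)) (ifE ?e (C 0) (Plus (V 3) (C 1)))) (When (notE ?e) (Put 1 flagA (C 0)))))"
  note hd = holds_dims[OF h]
  have "exec (Put 1 flagA (C 1)) \<eta> \<mu> = \<mu>(4 * L := 1)" by (simp add: eval_addresses[OF hd])
  moreover have h1: "holds X (digit b i) ans (\<mu>(4 * L := 1))" by (rule holds_upd[OF h]) simp_all
  note hd1 = holds_dims[OF h1]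
  have "?P d (fold (\<lambda>t. exec ?c (\<eta>(20 := t))) [0..<d] (\<mu>(4 * L := 1)))"
  proof (rule fold_upt_induct[where P = ?P])
    have "w 0 = digit b i" by (simp add: w_def fun_eq_iff)
    then show "?P 0 (\<mu>(4 * L := 1))" using h1 by simp
  next
    fix t \<mu>' assume t: "t < d" and P: "?P t \<mu>'"
    note hd' = holds_dims[OF P[THEN conjunct1]]
    let ?x = "digit b i t"
    have x: "\<mu>' (2 * L + t) = ?x" using P t by (simp add: holds_def digits_ok_def w_def)
    show "?P (Suc t) (exec ?c (\<eta>(20 := t)) \<mu>')"
    proof (cases "b ^ t dvd Suc i")
      case False
      then have "exec ?c (\<eta>(20 := t)) \<mu>' = \<mu>'" using P by (simp add: eval_addresses[OF hd'])
      moreover have "w (Suc t) = w t" using False digit_Suc(1)[OF b, of i t] by (auto simp: w_def less_Suc_eq fun_eq_iff)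
      ultimately show ?thesis using P False digit_Suc(2)[OF b, of t i] by simp
    next
      case True
      let ?y = "digit b (Suc i) t"
      let ?\<mu> = "\<mu>'(2 * L + t := ?y)"
      have y: "?y = (if ?x = b - 1 then 0 else Suc ?x)" using digit_Suc(1)[OF b, of i t] True by simp
      have "?y \<le> b" using b by (simp add: digit_def less_imp_le)
      moreover have "2 * L + t < 3 * L" using le_L t by simp
      moreover have "w (Suc t) = (w t)(t := ?y)" by (auto simp: w_def less_Suc_eq fun_eq_iff)
      ultimately have h2: "holds X (w (Suc t)) ans ?\<mu>"
        using P t input_ok_upd[of "2 * L + t" \<mu>' ?y] work_ok_upd[of "2 * L + t" X \<mu>' ?y]
        unfolding holds_def by (auto simp: digits_ok_def)
      have "exec ?c (\<eta>(20 := t)) \<mu>' = (if ?x = b - 1 then ?\<mu> else ?\<mu>(4 * L := 0))"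
      proof -
        have "exec (Put b (digitA (V 20)) (ifE ?e (C 0) (Plus (V 3) (C 1)))) (\<eta>(20 := t, 3 := ?x)) \<mu>' = ?\<mu>"
          using y \<open>?y \<le> b\<close> by (cases "?x = b - 1") (simp_all add: eval_addresses[OF hd'])
        moreover have "\<mu>' (4 * L) \<noteq> 0" using P True by simp
        ultimately show ?thesis
          by (simp add: eval_addresses[OF hd'] eval_addresses[OF holds_dims[OF h2]] x)
      qed
      moreover have "holds X (w (Suc t)) ans (?\<mu>(4 * L := 0))" by (rule holds_upd[OF h2]) simp_all
      moreover have "?\<mu> (4 * L) = 1" using P True \<open>2 * L + t < 3 * L\<close> by simp
      ultimately show ?thesis using h2 True digit_Suc(2)[OF b, of t i] by simp
    qed
  qed
  moreover have "holds X (digit b (Suc i)) ans \<nu>" if "holds X (w d) ans \<nu>" for \<nu>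
    using that by (simp add: holds_def digits_ok_def w_def)
  ultimately show ?thesis
    unfolding increment_cmd_def exec.simps(2,4) using eval_dims[OF hd1] by simp
qed

primrec run :: "(nat \<Rightarrow> nat) \<Rightarrow> nat \<Rightarrow> nat set" where
  "run w 0 = {}"
| "run w (Suc t) = (if linear_forest {..<NV} (G (run w t)) then run w t
     else insert (pick (run w t) (w t)) (run w t))"

lemma body_cmd_correct:
  fixes \<mu> \<eta> :: "nat \<Rightarrow> nat"
  assumes "input_ok \<mu>" "digits_ok (digit b i) \<mu>" "\<mu> (4 * L + 1) = of_bool ans"
  defines "\<mu>' \<equiv> exec (body_cmd nv adj cand b) \<eta> \<mu>"
  shows "input_ok \<mu>'" "digits_ok (digit b (Suc i)) \<mu>'" "\<mu>' (4 * L) = of_bool (b ^ d dvd Suc i)"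
    "\<mu>' (4 * L + 1) = of_bool (ans \<or> linear_forest {..<NV} (G (run (digit b i) d)))"
proof -
  let ?w = "digit b i"
  let ?\<mu>1 = "exec copy_cmd \<eta> \<mu>" and ?X = "run ?w d"
  have h1: "holds {} ?w ans ?\<mu>1" by (rule copy_cmd_correct[OF assms(1-3)])
  have "holds ?X ?w ans (exec (For 20 dE (step_cmd nv adj cand)) \<eta> ?\<mu>1)"
    unfolding exec.simps(4) eval_dims[OF holds_dims[OF h1]]
  proof (rule fold_upt_induct[where P = "\<lambda>t. holds (run ?w t) ?w ans"])
    fix t \<nu> assume t: "t < d" and "holds (run ?w t) ?w ans \<nu>"
    moreover have "?w t < b" using b by (simp add: digit_def)
    ultimately show "holds (run ?w (Suc t)) ?w ans (exec (step_cmd nv adj cand) (\<eta>(20 := t)) \<nu>)"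
      using step_cmd_correct[of "run ?w t" ?w ans \<nu> "\<eta>(20 := t)"] unfolding fun_upd_same run.simps by blast
  qed (use h1 in simp)
  from increment_cmd_correct[OF check_cmd_correct[OF this]]
  show "input_ok \<mu>'" "digits_ok (digit b (Suc i)) \<mu>'" "\<mu>' (4 * L) = of_bool (b ^ d dvd Suc i)"
    "\<mu>' (4 * L + 1) = of_bool (ans \<or> linear_forest {..<NV} (G (run (digit b i) d)))"
    unfolding \<mu>'_def body_cmd_def exec.simps(2) holds_def by blast+
qed

lemma run_cong: "(\<And>s. s < t \<Longrightarrow> w s = w' s) \<Longrightarrow> run w t = run w' t"
  by (induction t) auto

text \<open>A run of \<open>d\<close> steps reads only the first \<open>d\<close> letters of a
  guess, and these are the digits of a number below \<open>b ^ d\<close>.\<close>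

lemma solvable_iff:
  "(\<exists>S\<subseteq>{..<n}. card S \<le> d \<and> linear_forest {..<NV} (G S)) \<longleftrightarrow>
   (\<exists>i<b ^ d. linear_forest {..<NV} (G (run (digit b i) d)))"
proof -
  have "(\<exists>S\<subseteq>{..<n}. card S \<le> d \<and> linear_forest {..<NV} (G S)) \<longleftrightarrow>
      (\<exists>w. (\<forall>t. w t < b) \<and> linear_forest {..<NV} (G (run w d)))"
    by (rule branching_correct[where OK = "\<lambda>X. linear_forest {..<NV} (G X)" and pick = pick])
      (use pick safe b in auto)
  also have "\<dots> \<longleftrightarrow> (\<exists>i<b ^ d. linear_forest {..<NV} (G (run (digit b i) d)))"
  proof
    assume "\<exists>w. (\<forall>t. w t < b) \<and> linear_forest {..<NV} (G (run w d))"
    then obtain w where w: "\<And>t. w t < b" "linear_forest {..<NV} (G (run w d))" by blast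
    obtain i where i: "i < b ^ d" "\<forall>t<d. digit b i t = w t" using digits_surj[of w b d] w(1) by blast
    have "run (digit b i) d = run w d" by (rule run_cong) (use i in auto)
    then show "\<exists>i<b ^ d. linear_forest {..<NV} (G (run (digit b i) d))" using i w by auto
  next
    assume "\<exists>i<b ^ d. linear_forest {..<NV} (G (run (digit b i) d))"
    moreover have "digit b i t < b" for i t using b by (simp add: digit_def)
    ultimately show "\<exists>w. (\<forall>t. w t < b) \<and> linear_forest {..<NV} (G (run w d))" by blast
  qed
  finally show ?thesis .
qed

text \<open>After \<open>i > 0\<close> rounds the flag tells whether \<open>b ^ d\<close> divides
  \<open>i\<close>, so it first goes up after exactly \<open>b ^ d\<close> rounds, when every guess
  has been tried. The exception \<open>i = 0\<close> is there because the flag cell is arbitrary at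
  the start; \<open>ans\<close> is the initial content of the answer cell.\<close>

lemma iterate_body_correct:
  fixes \<mu> \<eta> :: "nat \<Rightarrow> nat"
  assumes "input_ok \<mu>" "digits_ok (\<lambda>_. 0) \<mu>" "\<mu> (4 * L + 1) = of_bool ans"
  defines "f \<equiv> exec (body_cmd nv adj cand b) \<eta>"
  shows "\<And>i. i < b ^ d \<Longrightarrow> (f ^^ i) \<mu> (4 * L) = 0 \<or> i = 0" "(f ^^ (b ^ d)) \<mu> (4 * L) \<noteq> 0"
    "(f ^^ (b ^ d)) \<mu> (4 * L + 1) = of_bool (ans \<or> (\<exists>S\<subseteq>{..<n}. card S \<le> d \<and> linear_forest {..<NV} (G S)))"
    "\<And>i. has_dims ((f ^^ i) \<mu>)"
proof -
  note body = body_cmd_correct[where \<eta> = \<eta>, folded f_def]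
  have I: "input_ok ((f ^^ i) \<mu>) \<and> digits_ok (digit b i) ((f ^^ i) \<mu>) \<and>
      (f ^^ i) \<mu> (4 * L + 1) = of_bool (ans \<or> (\<exists>j<i. linear_forest {..<NV} (G (run (digit b j) d))))" for i
  proof (induction i)
    case 0
    have "digit b 0 = (\<lambda>_. 0)" by (simp add: digit_def fun_eq_iff)
    then show ?case using assms(1-3) by simp
  next
    case (Suc i)
    let ?a = "ans \<or> (\<exists>j<i. linear_forest {..<NV} (G (run (digit b j) d)))"
    have "?a \<or> linear_forest {..<NV} (G (run (digit b i) d)) \<longleftrightarrow>
        ans \<or> (\<exists>j<Suc i. linear_forest {..<NV} (G (run (digit b j) d)))" by (auto simp: less_Suc_eq)
    then show ?case
      using Suc body[of "(f ^^ i) \<mu>" i ?a] by (simp only: funpow.simps comp_apply)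
  qed
  have flag: "(f ^^ Suc i) \<mu> (4 * L) = of_bool (b ^ d dvd Suc i)" for i
    using I[of i] body(3)[of "(f ^^ i) \<mu>" i] unfolding funpow.simps comp_apply by blast
  show "(f ^^ i) \<mu> (4 * L) = 0 \<or> i = 0" if "i < b ^ d" for i
    using flag[of "i - 1"] that by (cases i) (auto dest: dvd_imp_le)
  have "b ^ d \<noteq> 0" using b by simp
  then obtain k where "b ^ d = Suc k" using not0_implies_Suc by blast
  then show "(f ^^ (b ^ d)) \<mu> (4 * L) \<noteq> 0" using flag[of k] by simp
  show "(f ^^ (b ^ d)) \<mu> (4 * L + 1) = of_bool (ans \<or> (\<exists>S\<subseteq>{..<n}. card S \<le> d \<and> linear_forest {..<NV} (G S)))"
    using I[of "b ^ d"] unfolding solvable_iff by blast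
  show "has_dims ((f ^^ i) \<mu>)" for i using I[of i] by (simp add: input_ok_def)
qed

end

section \<open>The decision programs\<close>

abbreviation digitE :: expr where "digitE \<equiv> Ld (digitA (V 20))"

definition row_adj :: expr where
  "row_adj = andE (notE (eqE (V 1) (V 2))) (SumE 4 mE (andE (workE (V 1) (V 4)) (workE (V 2) (V 4))))"

text \<open>Whether the graph is already a linear forest needs no test: then there is no claw, the
  core is empty, and the search ends with its default \<open>n\<close>.\<close>

definition row_cand :: expr where
  "row_cand = ifE (ltE (V 1) nE)
     (ifE (eqE digitE (C 0)) (V 1) (ifE (eqE digitE (C 1)) (V 11) (ifE (eqE digitE (C 2)) (V 12) (V 13))))
     (leastE 2 nE (Ld (coreA (V 2))))"

definition col_adj :: expr where
  "col_adj = andE (notE (eqE (V 1) (V 2))) (SumE 4 nE (andE (workE (V 4) (V 1)) (workE (V 4) (V 2))))"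

definition hitE :: "expr \<Rightarrow> expr" where
  "hitE u = leastE 3 nE (andE (workE (V 3) (V 1)) (workE (V 3) u))"

definition core_edgeE :: "expr \<Rightarrow> expr" where
  "core_edgeE r = leE (C 2) (SumE 5 mE (andE (workE r (V 5)) (Ld (coreA (V 5)))))"

definition copiesE :: "expr \<Rightarrow> expr" where
  "copiesE r = SumE 6 nE (leE (C 2) (SumE 5 mE (andE (workE (V 6) (V 5)) (workE r (V 5)))))"

definition col_cand :: expr where
  "col_cand = ifE (ltE (V 1) mE)
     (ifE (eqE digitE (C 0)) (hitE (V 11)) (ifE (eqE digitE (C 1)) (hitE (V 12)) (hitE (V 13))))
     (leastE 3 nE (andE (core_edgeE (V 3))
       (notE (SumE 4 nE (andE (core_edgeE (V 4)) (ltE (copiesE (V 4)) (copiesE (V 3))))))))"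

section \<open>Correctness of the adjacency and candidate expressions\<close>

context ram_layout
begin

lemma eval_workE:
  assumes "holds X w ans \<mu>" "eval i \<eta> \<mu> < n" "eval j \<eta> \<mu> < m"
  shows "eval (workE i j) \<eta> \<mu> = of_bool (eval i \<eta> \<mu> \<notin> X \<and> inc (eval i \<eta> \<mu>) (eval j \<eta> \<mu>))"
  using assms eval_addresses(1)[OF holds_dims[OF assms(1)], of i j \<eta>] by (simp add: holds_def work_ok_def)

lemma eval_digitE:
  assumes "holds X w ans \<mu>" "\<eta> 20 < d"
  shows "eval digitE \<eta> \<mu> = w (\<eta> 20)"
  using assms eval_addresses(2)[OF holds_dims[OF assms(1)], of "V 20" \<eta>] by (simp add: holds_def digits_ok_def)

lemma row_branching:
  "branching n m d inc nE n row_adj row_cand (row_graph inc n m) (row_pick inc n m) 4"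
proof unfold_locales
  show "eval nE \<eta> \<mu> = n" if "has_dims \<mu>" for \<mu> \<eta> by (rule eval_dims[OF that])
  show "n < L" by (rule le_L)
  show "eval row_adj \<eta> \<mu> = of_bool (row_graph inc n m X (\<eta> 1) (\<eta> 2))"
    if h: "holds X w ans \<mu>" and v: "\<eta> 1 < n" "\<eta> 2 < n" for X w ans \<mu> \<eta>
  proof -
    have "eval (SumE 4 mE (andE (workE (V 1) (V 4)) (workE (V 2) (V 4)))) \<eta> \<mu> =
        (\<Sum>j<m. of_bool ((\<eta> 1 \<notin> X \<and> inc (\<eta> 1) j) \<and> (\<eta> 2 \<notin> X \<and> inc (\<eta> 2) j)))"
      unfolding eval.simps(6) eval_dims[OF holds_dims[OF h]] eval_andE
      by (intro sum.cong) (use v in \<open>auto simp: eval_workE[OF h] simp del: eval.simps(5)\<close>)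
    then have "eval (SumE 4 mE (andE (workE (V 1) (V 4)) (workE (V 2) (V 4)))) \<eta> \<mu> \<noteq> 0 \<longleftrightarrow>
        (\<exists>j<m. (\<eta> 1 \<notin> X \<and> inc (\<eta> 1) j) \<and> (\<eta> 2 \<notin> X \<and> inc (\<eta> 2) j))"
      by (simp only: sum_of_bool_eq_0) blast
    then show ?thesis using v unfolding row_adj_def eval_andE by (simp add: row_graph_def)
  qed
  show "eval row_cand \<eta> \<mu> = (if linear_forest {..<n} (row_graph inc n m X) then n else row_pick inc n m X (w (\<eta> 20)))"
    if h: "holds X w ans \<mu>" and c: "\<And>v. v < n \<Longrightarrow> \<mu> (3 * L + v) = of_bool (v \<in> core n (row_graph inc n m X))"
      and v: "\<eta> 1 = claw n (row_graph inc n m X)"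
      and u: "claw n (row_graph inc n m X) < n \<Longrightarrow> \<eta> 11 = nbr1 n (row_graph inc n m X) \<and>
        \<eta> 12 = nbr2 n (row_graph inc n m X) \<and> \<eta> 13 = nbr3 n (row_graph inc n m X)"
      and t: "\<eta> 20 < d" for X w ans \<mu> \<eta>
  proof -
    let ?E = "row_graph inc n m X"
    note hd = holds_dims[OF h]
    have dig: "eval digitE \<eta>' \<mu> = w (\<eta> 20)" if "\<eta>' 20 = \<eta> 20" for \<eta>'
      using eval_digitE[OF h, of \<eta>'] t that by simp
    have lt: "eval (ltE (V 1) nE) \<eta> \<mu> = of_bool (claw n ?E < n)"
      using v eval_dims[OF hd] by simp
    show ?thesis
    proof (cases "claw n ?E < n")
      case True
      then have "\<not> linear_forest {..<n} ?E" using linear_forest_iff_claw_core[of n ?E] by simp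
      moreover have "eval row_cand \<eta> \<mu> = row_pick inc n m X (w (\<eta> 20))"
        unfolding row_cand_def eval_ifE lt row_pick_def Let_def eval_eqE
        using True u v by (simp add: dig del: eval.simps(5))
      ultimately show ?thesis by simp
    next
      case False
      have "eval (leastE 2 nE (Ld (coreA (V 2)))) (\<eta>(99 := 0)) \<mu> = least_below n (\<lambda>v. v \<in> core n ?E)"
        unfolding eval_dims(1)[OF hd, of "\<eta>(99 := 0)", symmetric]
        by (rule eval_leastE) (use c in \<open>simp add: eval_addresses[OF hd] eval_dims[OF hd, simplified]\<close>)
      then have "eval row_cand \<eta> \<mu> = least_below n (\<lambda>v. v \<in> core n ?E)"
        unfolding row_cand_def eval_ifE lt using False by simp
      moreover have "least_below n (\<lambda>v. v \<in> core n ?E) = n" if "linear_forest {..<n} ?E"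
        using that linear_forest_iff_claw_core[of n ?E] by (intro least_below_eq) simp
      ultimately show ?thesis using False by (simp add: row_pick_def)
    qed
  qed
  show "row_pick inc n m X i \<in> {..<n} - X" if "\<not> linear_forest {..<n} (row_graph inc n m X)" for X i
    using that by (rule row_pick)
qed (use row_pick_safe in auto)

text \<open>The condition \<open>r \<noteq> 5\<close> prevents the summation variable from capturing
  \<open>V r\<close>.\<close>

lemma eval_core_edgeE:
  assumes h: "holds X w ans \<mu>" and c: "\<And>v. v < m \<Longrightarrow> \<mu> (3 * L + v) = of_bool (v \<in> core m (col_graph inc n m X))"
    and r: "\<eta> r < n" "r \<noteq> 5"
  shows "eval (core_edgeE (V r)) \<eta> \<mu> = of_bool (core_edge inc n m X (\<eta> r))"
proof -
  note hd = holds_dims[OF h]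
  have core: "eval (Ld (coreA (V 5))) (\<eta>(5 := j)) \<mu> = of_bool (j \<in> core m (col_graph inc n m X))" if "j < m" for j
    using c[OF that] by (simp add: eval_addresses[OF hd])
  have "eval (SumE 5 mE (andE (workE (V r) (V 5)) (Ld (coreA (V 5))))) \<eta> \<mu> =
      (\<Sum>j<m. of_bool ((\<eta> r \<notin> X \<and> inc (\<eta> r) j) \<and> j \<in> core m (col_graph inc n m X)))"
    unfolding eval.simps(6) eval_dims[OF hd] eval_andE
    by (intro sum.cong) (use r in \<open>auto simp: eval_workE[OF h] core simp del: eval.simps(5)\<close>)
  then show ?thesis unfolding core_edgeE_def eval_leE core_edge_def by (simp only: sum_of_bool_card) simp
qed

lemma eval_copiesE:
  assumes h: "holds X w ans \<mu>" and r: "\<eta> r < n" "r \<noteq> 5" "r \<noteq> 6"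
  shows "eval (copiesE (V r)) \<eta> \<mu> = row_copies inc n m X (\<eta> r)"
proof -
  note hd = holds_dims[OF h]
  have inner: "eval (SumE 5 mE (andE (workE (V 6) (V 5)) (workE (V r) (V 5)))) (\<eta>(6 := i)) \<mu> =
      card {j. j < m \<and> (i \<notin> X \<and> inc i j) \<and> (\<eta> r \<notin> X \<and> inc (\<eta> r) j)}" if "i < n" for i
  proof -
    have "eval (SumE 5 mE (andE (workE (V 6) (V 5)) (workE (V r) (V 5)))) (\<eta>(6 := i)) \<mu> =
        (\<Sum>j<m. of_bool ((i \<notin> X \<and> inc i j) \<and> (\<eta> r \<notin> X \<and> inc (\<eta> r) j)))"
      unfolding eval.simps(6) eval_dims[OF hd] eval_andE
      by (intro sum.cong) (use r that in \<open>auto simp: eval_workE[OF h] simp del: eval.simps(5)\<close>)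
    then show ?thesis by (simp only: sum_of_bool_card)
  qed
  have "eval (copiesE (V r)) \<eta> \<mu> =
      (\<Sum>i<n. of_bool (2 \<le> card {j. j < m \<and> (i \<notin> X \<and> inc i j) \<and> (\<eta> r \<notin> X \<and> inc (\<eta> r) j)}))"
    unfolding copiesE_def eval.simps(6)[of 6] eval_dims[OF hd] eval_leE
    by (intro sum.cong) (use inner in \<open>auto simp del: eval.simps(6)\<close>)
  then show ?thesis unfolding row_copies_def by (simp only: sum_of_bool_card)
qed

lemma col_branching:
  assumes two: "\<forall>i<n. card {j. j < m \<and> inc i j} \<le> 2"
  shows "branching n m d inc mE m col_adj col_cand (col_graph inc n m) (col_pick inc n m) 3"
proof unfold_locales
  show "eval mE \<eta> \<mu> = m" if "has_dims \<mu>" for \<mu> \<eta> by (rule eval_dims[OF that])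
  show "m < L" by (rule le_L)
  show "eval col_adj \<eta> \<mu> = of_bool (col_graph inc n m X (\<eta> 1) (\<eta> 2))"
    if h: "holds X w ans \<mu>" and v: "\<eta> 1 < m" "\<eta> 2 < m" for X w ans \<mu> \<eta>
  proof -
    have "eval (SumE 4 nE (andE (workE (V 4) (V 1)) (workE (V 4) (V 2)))) \<eta> \<mu> =
        (\<Sum>i<n. of_bool ((i \<notin> X \<and> inc i (\<eta> 1)) \<and> (i \<notin> X \<and> inc i (\<eta> 2))))"
      unfolding eval.simps(6) eval_dims[OF holds_dims[OF h]] eval_andE
      by (intro sum.cong) (use v in \<open>auto simp: eval_workE[OF h] simp del: eval.simps(5)\<close>)
    then have "eval (SumE 4 nE (andE (workE (V 4) (V 1)) (workE (V 4) (V 2)))) \<eta> \<mu> \<noteq> 0 \<longleftrightarrow>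
        (\<exists>i<n. (i \<notin> X \<and> inc i (\<eta> 1)) \<and> (i \<notin> X \<and> inc i (\<eta> 2)))"
      by (simp only: sum_of_bool_eq_0) blast
    then show ?thesis using v unfolding col_adj_def eval_andE by (simp add: col_graph_def)
  qed
  show "eval col_cand \<eta> \<mu> = (if linear_forest {..<m} (col_graph inc n m X) then n else col_pick inc n m X (w (\<eta> 20)))"
    if h: "holds X w ans \<mu>" and c: "\<And>v. v < m \<Longrightarrow> \<mu> (3 * L + v) = of_bool (v \<in> core m (col_graph inc n m X))"
      and v: "\<eta> 1 = claw m (col_graph inc n m X)"
      and u: "claw m (col_graph inc n m X) < m \<Longrightarrow> \<eta> 11 = nbr1 m (col_graph inc n m X) \<and>
        \<eta> 12 = nbr2 m (col_graph inc n m X) \<and> \<eta> 13 = nbr3 m (col_graph inc n m X)"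
      and t: "\<eta> 20 < d" for X w ans \<mu> \<eta>
  proof -
    let ?E = "col_graph inc n m X"
    note hd = holds_dims[OF h]
    have dig: "eval digitE \<eta>' \<mu> = w (\<eta> 20)" if "\<eta>' 20 = \<eta> 20" for \<eta>'
      using eval_digitE[OF h, of \<eta>'] t that by simp
    have lt: "eval (ltE (V 1) mE) \<eta> \<mu> = of_bool (claw m ?E < m)"
      using v eval_dims[OF hd] by simp
    have nE: "eval nE \<eta>' \<mu> = n" for \<eta>' by (rule eval_dims[OF hd])
    show ?thesis
    proof (cases "claw m ?E < m")
      case True
      note nb = claw_nbrs[OF True]
      have hit: "eval (hitE (V x)) \<eta>' \<mu> =
          least_below n (\<lambda>r. (r \<notin> X \<and> inc r (claw m ?E)) \<and> (r \<notin> X \<and> inc r (\<eta> x)))"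
        if "\<eta>' 1 = \<eta> 1" "\<eta>' x = \<eta> x" "\<eta> x < m" "x \<noteq> 3" "x \<noteq> 50" for x \<eta>'
        unfolding hitE_def nE[of \<eta>', symmetric]
        by (rule eval_leastE) (use True v that in \<open>auto simp: nE eval_workE[OF h] simp del: eval.simps(5)\<close>)
      have "\<not> linear_forest {..<m} ?E" using True linear_forest_iff_claw_core[of m ?E] by simp
      moreover have "eval col_cand \<eta> \<mu> = col_pick inc n m X (w (\<eta> 20))"
        unfolding col_cand_def eval_ifE lt col_pick_def Let_def eval_eqE
        using True u v nb by (simp add: dig hit del: eval.simps(5))
      ultimately show ?thesis by simp
    next
      case False
      let ?Q = "\<lambda>r. core_edge inc n m X r \<and>
        (\<forall>r'<n. core_edge inc n m X r' \<longrightarrow> row_copies inc n m X r \<le> row_copies inc n m X r')"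
      let ?e = "SumE 4 nE (andE (core_edgeE (V 4)) (ltE (copiesE (V 4)) (copiesE (V 3))))"
      let ?\<eta> = "\<eta>(99 := 0)"
      \<comment> \<open>The sum counts the core edges with strictly fewer copies; it is zero iff row
        \<open>\<eta>' 3\<close> is minimal.\<close>
      have min: "eval ?e \<eta>' \<mu> = 0 \<longleftrightarrow>
          (\<forall>r'<n. core_edge inc n m X r' \<longrightarrow> row_copies inc n m X (\<eta>' 3) \<le> row_copies inc n m X r')"
        if "\<eta>' 3 < n" for \<eta>'
      proof -
        have "eval ?e \<eta>' \<mu> = (\<Sum>r'<n. of_bool (core_edge inc n m X r' \<and>
            row_copies inc n m X r' < row_copies inc n m X (\<eta>' 3)))"
          unfolding eval.simps(6) nE eval_andE eval_ltE
          by (intro sum.cong) (use that in \<open>auto simp: eval_core_edgeE[OF h c] eval_copiesE[OF h]\<close>)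
        then show ?thesis by (simp only: sum_of_bool_eq_0 not_less de_Morgan_conj) blast
      qed
      have "eval (leastE 3 nE (andE (core_edgeE (V 3)) (notE ?e))) ?\<eta> \<mu> = least_below n ?Q"
        unfolding nE[of ?\<eta>, symmetric]
        by (rule eval_leastE) (simp add: nE eval_core_edgeE[OF h c] min del: eval.simps(5,6))
      then have e: "eval col_cand \<eta> \<mu> = least_below n ?Q"
        unfolding col_cand_def eval_ifE lt using False by simp
      have "least_below n ?Q = n" if "linear_forest {..<m} ?E"
        using that linear_forest_iff_claw_core[of m ?E] by (intro least_below_eq) (simp add: core_edge_iff)
      then show ?thesis using e False by (simp add: col_pick_def Let_def)
    qed
  qed
  show "col_pick inc n m X i \<in> {..<n} - X" if "\<not> linear_forest {..<m} (col_graph inc n m X)" for X i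
    using that by (rule col_pick)
qed (use col_pick_safe[OF two] in auto)

end

text \<open>If there are no columns, or if all rows may be deleted, the dimensions are replaced by zero:
  otherwise they need not be polynomial in the input size.\<close>

definition prologue :: "instr list" where
  "prologue = [Const 0 0, Const 1 1, Load 2 1, Load 3 0, Const 4 2, Load 5 4, Sub 6 3 5,
     Jump_Zero 2 10, Jump_Zero 6 10, Jump 13, Store 0 0, Store 1 0, Store 4 0]"

text \<open>Free variables are mapped to register 0, which stays zero during the loop, and scratch
  registers start at 1. Position 13 is the length of the prologue. The backward jump is taken as
  long as the flag is down.\<close>

definition loop_code :: "cmd \<Rightarrow> instr list" where
  "loop_code c = (let cc = ccomp (\<lambda>_. 0) 1 13 c in
     cc @ ecomp (\<lambda>_. 0) 1 (13 + length cc) (Ld flagA) @ [Jump_Zero 1 13])"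

text \<open>Adding register 1 to register 0 moves the answer to where acceptance is read
  off.\<close>

definition program :: "cmd \<Rightarrow> instr list" where
  "program c = prologue @ loop_code c @
     ecomp (\<lambda>_. 0) 1 (13 + length (loop_code c)) (Ld answerA) @ [Add 0 0 1]"

definition normalize_dims :: "(nat \<Rightarrow> nat) \<Rightarrow> (nat \<Rightarrow> nat)" where
  "normalize_dims \<mu> = (if \<mu> 1 = 0 \<or> \<mu> 0 \<le> \<mu> 2 then \<mu>(0 := 0, 1 := 0, 2 := 0) else \<mu>)"

section \<open>Runs of the assembled program\<close>

lemma bit_length_simps [simp]: "bit_length 0 = 1" "bit_length (Suc 0) = 1" "bit_length 2 = 2"
  by (simp_all add: bit_length_def floorlog_def log2_of_power_eq)

lemma bit_length_mono: "a \<le> b \<Longrightarrow> bit_length a \<le> bit_length b"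
  unfolding bit_length_def by (intro max.mono floorlog_mono) auto

lemma bit_length_pos: "1 \<le> bit_length a"
  by (simp add: bit_length_def)

text \<open>The cost is stated in bit lengths: before normalization the values themselves may be
  exponential in the input size. The factor 30 is generous.\<close>

lemma prologue_correct:
  fixes \<mu> :: "nat \<Rightarrow> nat"
  assumes code: "code_at p 0 prologue"
  shows "\<exists>r. runs_le p (Config 0 (\<lambda>_. 0) \<mu>) (30 * (bit_length (\<mu> 0) + bit_length (\<mu> 1) + bit_length (\<mu> 2)))
    (Config 13 r (normalize_dims \<mu>)) \<and> r 0 = 0"
proof -
  let ?K = "bit_length (\<mu> 0) + bit_length (\<mu> 1) + bit_length (\<mu> 2)"
  have K: "1 \<le> bit_length (\<mu> 0)" "1 \<le> bit_length (\<mu> 1)" "1 \<le> bit_length (\<mu> 2)"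
    by (rule bit_length_pos)+
  have at: "q < length p \<and> p ! q = prologue ! q" if "q < 13" for q
    using code that unfolding code_at_def prologue_def by (auto dest!: spec[of _ q])
  define r where "r = (\<lambda>_::nat. 0 :: nat)(0 := 0, 1 := 1, 2 := \<mu> 1, 3 := \<mu> 0, 4 := 2, 5 := \<mu> 2, 6 := \<mu> 0 - \<mu> 2)"
  have st: "runs_le p (Config q r' \<nu>) t s"
    if "q < 13" "prologue ! q = i" "step i (Config q r' \<nu>) = s" "cost i (Config q r' \<nu>) \<le> t" for q i r' \<nu> t s
    using runs_le_step[of q p i r' \<nu> s t] at[OF that(1)] that by simp
  let ?r1 = "(\<lambda>_. 0 :: nat)(0 := 0)"
  let ?r2 = "?r1(1 := 1)" let ?r3 = "?r2(2 := \<mu> 1)" let ?r4 = "?r3(3 := \<mu> 0)"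
  let ?r5 = "?r4(4 := 2)" let ?r6 = "?r5(5 := \<mu> 2)"
  have 1: "runs_le p (Config 0 (\<lambda>_. 0) \<mu>) ?K (Config 1 ?r1 \<mu>)"
    by (rule st[where i = "Const 0 0"]) (use K in \<open>auto simp: prologue_def\<close>)
  have 2: "runs_le p (Config 1 ?r1 \<mu>) ?K (Config 2 ?r2 \<mu>)"
    by (rule st[where i = "Const 1 1"]) (use K in \<open>auto simp: prologue_def\<close>)
  have 3: "runs_le p (Config 2 ?r2 \<mu>) ?K (Config 3 ?r3 \<mu>)"
    by (rule st[where i = "Load 2 1"]) (use K in \<open>auto simp: prologue_def\<close>)
  have 4: "runs_le p (Config 3 ?r3 \<mu>) ?K (Config 4 ?r4 \<mu>)"
    by (rule st[where i = "Load 3 0"]) (use K in \<open>auto simp: prologue_def\<close>)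
  have 5: "runs_le p (Config 4 ?r4 \<mu>) ?K (Config 5 ?r5 \<mu>)"
    by (rule st[where i = "Const 4 2"]) (use K in \<open>auto simp: prologue_def\<close>)
  have 6: "runs_le p (Config 5 ?r5 \<mu>) (2 * ?K) (Config 6 ?r6 \<mu>)"
    by (rule st[where i = "Load 5 4"]) (use K in \<open>auto simp: prologue_def\<close>)
  have 7: "runs_le p (Config 6 ?r6 \<mu>) ?K (Config 7 r \<mu>)"
    by (rule st[where i = "Sub 6 3 5"]) (use K in \<open>auto simp: prologue_def r_def\<close>)
  note run7 = runs_le_trans[OF runs_le_trans[OF runs_le_trans[OF runs_le_trans[OF runs_le_trans[OF runs_le_trans[OF 1 2] 3] 4] 5] 6] 7]
  have 8: "runs_le p (Config 7 r \<mu>) ?K (Config (if \<mu> 1 = 0 then 10 else 8) r \<mu>)"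
    by (rule st[where i = "Jump_Zero 2 10"]) (use K in \<open>auto simp: prologue_def r_def\<close>)
  have 9: "runs_le p (Config 8 r \<mu>) ?K (Config (if \<mu> 0 \<le> \<mu> 2 then 10 else 9) r \<mu>)"
    by (rule st[where i = "Jump_Zero 6 10"])
      (use K bit_length_mono[of "\<mu> 0 - \<mu> 2" "\<mu> 0"] in \<open>auto simp: prologue_def r_def\<close>)
  have 10: "runs_le p (Config 9 r \<mu>) ?K (Config 13 r \<mu>)"
    by (rule st[where i = "Jump 13"]) (use K in \<open>auto simp: prologue_def\<close>)
  have 11: "runs_le p (Config 10 r \<mu>) (9 * ?K) (Config 13 r (\<mu>(0 := 0, 1 := 0, 2 := 0)))"
  proof -
    have a: "runs_le p (Config 10 r \<mu>) (3 * ?K) (Config 11 r (\<mu>(0 := 0)))"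
      by (rule st[where i = "Store 0 0"]) (use K in \<open>auto simp: prologue_def r_def\<close>)
    have b: "runs_le p (Config 11 r (\<mu>(0 := 0))) (3 * ?K) (Config 12 r (\<mu>(0 := 0, 1 := 0)))"
      by (rule st[where i = "Store 1 0"]) (use K in \<open>auto simp: prologue_def r_def\<close>)
    have c: "runs_le p (Config 12 r (\<mu>(0 := 0, 1 := 0))) (3 * ?K) (Config 13 r (\<mu>(0 := 0, 1 := 0, 2 := 0)))"
      by (rule st[where i = "Store 4 0"]) (use K in \<open>auto simp: prologue_def r_def\<close>)
    show ?thesis by (rule runs_le_mono[OF runs_le_trans[OF runs_le_trans[OF a b] c]]) simp
  qed
  have "runs_le p (Config 7 r \<mu>) (12 * ?K) (Config 13 r (normalize_dims \<mu>))"
  proof -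
    consider "\<mu> 1 = 0" | "\<mu> 1 \<noteq> 0" "\<mu> 0 \<le> \<mu> 2" | "\<mu> 1 \<noteq> 0" "\<not> \<mu> 0 \<le> \<mu> 2" by blast
    then show ?thesis
    proof cases
      case 1
      show ?thesis using 1 runs_le_mono[OF runs_le_trans[OF 8[unfolded 1 simp_thms if_True] 11], of "12 * ?K"]
        by (simp add: normalize_dims_def)
    next
      case 2
      then have "runs_le p (Config 7 r \<mu>) ?K (Config 8 r \<mu>)" "runs_le p (Config 8 r \<mu>) ?K (Config 10 r \<mu>)"
        using 8 9 by simp_all
      from runs_le_mono[OF runs_le_trans[OF runs_le_trans[OF this] 11], of "12 * ?K"]
      show ?thesis using 2 by (simp add: normalize_dims_def)
    next
      case 3
      then have "runs_le p (Config 7 r \<mu>) ?K (Config 8 r \<mu>)" "runs_le p (Config 8 r \<mu>) ?K (Config 9 r \<mu>)"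
        using 8 9 by simp_all
      from runs_le_mono[OF runs_le_trans[OF runs_le_trans[OF this] 10], of "12 * ?K"]
      show ?thesis using 3 by (simp add: normalize_dims_def)
    qed
  qed
  from runs_le_mono[OF runs_le_trans[OF run7 this], of "30 * ?K"]
  have *: "runs_le p (Config 0 (\<lambda>_. 0) \<mu>) (30 * ?K) (Config 13 r (normalize_dims \<mu>))" by simp
  show ?thesis by (intro exI conjI, rule *) (simp add: r_def)
qed

text \<open>The flag is tested after the body, so there is at least one round and \<open>T\<close>
  tests fail. All rounds have the same cost bound, because the caps keep the memory below
  \<open>B\<close>.\<close>

lemma loop_correct:
  assumes code: "code_at p 13 (loop_code c)" and B: "kmax c \<le> B"
  defines "f \<equiv> exec c (\<lambda>_. 0)" and "it \<equiv> \<lambda>B. cbound c B + ebound (Ld flagA) B + B + 1"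
  assumes "\<forall>a. \<mu> a \<le> B" "r 0 = 0"
    "\<forall>i. i < T \<longrightarrow> eval (Ld flagA) (\<lambda>_. 0) ((f ^^ Suc i) \<mu>) = 0"
    "eval (Ld flagA) (\<lambda>_. 0) ((f ^^ Suc T) \<mu>) \<noteq> 0"
  shows "\<exists>r'. runs_le p (Config 13 r \<mu>) (Suc T * it B)
    (Config (13 + length (loop_code c)) r' ((f ^^ Suc T) \<mu>)) \<and> r' 0 = 0"
proof -
  have once: "\<exists>r'. runs_le p (Config 13 r \<mu>) (it B)
     (Config (if eval (Ld flagA) (\<lambda>_. 0) (f \<mu>) = 0 then 13 else 13 + length (loop_code c)) r' (f \<mu>)) \<and> r' 0 = 0"
    if \<mu>: "\<forall>a. \<mu> a \<le> B" "r 0 = 0" for \<mu> r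
  proof -
    let ?cc = "ccomp (\<lambda>_. 0) 1 13 c"
    let ?q = "13 + length ?cc"
    let ?cf = "ecomp (\<lambda>_. 0) 1 ?q (Ld flagA)"
    have lc: "loop_code c = ?cc @ ?cf @ [Jump_Zero 1 13]" by (simp add: loop_code_def Let_def)
    have code': "code_at p 13 ?cc" "code_at p ?q ?cf" "code_at p (?q + length ?cf) [Jump_Zero 1 13]"
      using code unfolding lc code_at_append by blast+
    obtain r1 where r1: "runs_le p (Config 13 r \<mu>) (cbound c B) (Config ?q r1 (f \<mu>))" "r1 0 = 0"
      using ccomp_correct[OF code'(1), of r B \<mu>] B \<mu> unfolding f_def by auto
    have fB: "\<forall>a. f \<mu> a \<le> B" unfolding f_def using exec_bounded[of \<mu> B c] \<mu> B by blast
    obtain r2 where r2: "runs_le p (Config ?q r1 (f \<mu>)) (ebound (Ld flagA) B) (Config (?q + length ?cf) r2 (f \<mu>))"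
      "r2 1 = eval (Ld flagA) (\<lambda>_. 0) (f \<mu>)" "r2 0 = 0"
      using ecomp_correct[OF code'(2), of r1 B "f \<mu>"] r1(2) fB by (auto simp del: ecomp.simps ebound.simps eval.simps)
    have "r2 1 \<le> B" using r2(2) fB by simp
    then have 3: "runs_le p (Config (?q + length ?cf) r2 (f \<mu>)) (B + 1)
        (Config (if r2 1 = 0 then 13 else Suc (?q + length ?cf)) r2 (f \<mu>))"
      by (intro runs_le_stepI[OF code'(3)]) (auto dest: bit_length_bound)
    have "Suc (?q + length ?cf) = 13 + length (loop_code c)" unfolding lc by simp
    with runs_le_trans[OF runs_le_trans[OF r1(1) r2(1)] 3] r2(2)
    have "runs_le p (Config 13 r \<mu>) (it B)
     (Config (if eval (Ld flagA) (\<lambda>_. 0) (f \<mu>) = 0 then 13 else 13 + length (loop_code c)) r2 (f \<mu>))"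
      by (simp only: it_def add.assoc)
    then show ?thesis using r2(3) by blast
  qed
  show ?thesis
    using assms(5-)
  proof (induction T arbitrary: \<mu> r)
  case 0
  then show ?case using once[of \<mu> r] by simp
next
  case (Suc T)
  have "eval (Ld flagA) (\<lambda>_. 0) (f \<mu>) = 0" using Suc.prems(3)[rule_format, of 0] by simp
  then obtain r1 where r1: "runs_le p (Config 13 r \<mu>) (it B) (Config 13 r1 (f \<mu>))" "r1 0 = 0"
    using once[of \<mu> r] Suc.prems(1,2) by auto
  have fB: "\<forall>a. f \<mu> a \<le> B" unfolding f_def using exec_bounded[of \<mu> B c] Suc.prems(1) B by blast
  have sh: "(f ^^ Suc i) (f \<mu>) = (f ^^ Suc (Suc i)) \<mu>" for i by (simp add: funpow_swap1)
  have "\<exists>r'. runs_le p (Config 13 r1 (f \<mu>)) (Suc T * it B)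
      (Config (13 + length (loop_code c)) r' ((f ^^ Suc T) (f \<mu>))) \<and> r' 0 = 0"
    using Suc.prems(3,4) by (intro Suc.IH[of "f \<mu>" r1] fB r1(2)) (auto simp only: sh)
  then obtain r2 where r2: "runs_le p (Config 13 r1 (f \<mu>)) (Suc T * it B)
      (Config (13 + length (loop_code c)) r2 ((f ^^ Suc (Suc T)) \<mu>))" "r2 0 = 0" unfolding sh by blast
  have "runs_le p (Config 13 r \<mu>) (Suc (Suc T) * it B)
      (Config (13 + length (loop_code c)) r2 ((f ^^ Suc (Suc T)) \<mu>))"
    using runs_le_trans[OF r1(1) r2(1)] by (rule runs_le_mono) simp
  then show ?case using r2(2) by blast
qed
qed

lemma program_correct:
  fixes \<mu> :: "nat \<Rightarrow> nat"
  assumes B: "kmax c \<le> B" "\<forall>a. normalize_dims \<mu> a \<le> B"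
  defines "f \<equiv> exec c (\<lambda>_. 0)"
  assumes flag: "\<forall>i. i < T \<longrightarrow> eval (Ld flagA) (\<lambda>_. 0) ((f ^^ Suc i) (normalize_dims \<mu>)) = 0"
    "eval (Ld flagA) (\<lambda>_. 0) ((f ^^ Suc T) (normalize_dims \<mu>)) \<noteq> 0"
  shows "\<exists>t s. halts_in (program c) (Config 0 (\<lambda>_. 0) \<mu>) t s \<and>
    regs s 0 = eval (Ld answerA) (\<lambda>_. 0) ((f ^^ Suc T) (normalize_dims \<mu>)) \<and>
    t \<le> 30 * (bit_length (\<mu> 0) + bit_length (\<mu> 1) + bit_length (\<mu> 2)) +
      Suc T * (cbound c B + ebound (Ld flagA) B + B + 1) + (ebound (Ld answerA) B + B + 2)"
proof -
  let ?p = "program c" and ?q = "13 + length (loop_code c)" and ?\<mu> = "(f ^^ Suc T) (normalize_dims \<mu>)"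
  let ?ca = "ecomp (\<lambda>_. 0) 1 ?q (Ld answerA)"
  have len: "length prologue = 13" by (simp add: prologue_def)
  have code: "code_at ?p 0 prologue" "code_at ?p 13 (loop_code c)" "code_at ?p ?q ?ca"
    "code_at ?p (?q + length ?ca) [Add 0 0 1]"
    using code_at_self[of "[]" ?p "[]"] unfolding program_def
    by (simp_all only: append_Nil append_Nil2 list.size code_at_append len add_0)
  obtain r1 where r1: "runs_le ?p (Config 0 (\<lambda>_. 0) \<mu>)
      (30 * (bit_length (\<mu> 0) + bit_length (\<mu> 1) + bit_length (\<mu> 2))) (Config 13 r1 (normalize_dims \<mu>))" "r1 0 = 0"
    using prologue_correct[OF code(1), of \<mu>] by blast
  obtain r2 where r2: "runs_le ?p (Config 13 r1 (normalize_dims \<mu>))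
      (Suc T * (cbound c B + ebound (Ld flagA) B + B + 1)) (Config ?q r2 ?\<mu>)" "r2 0 = 0"
    using loop_correct[OF code(2) B(1), of "normalize_dims \<mu>" r1 T] B(2) r1(2) flag unfolding f_def by blast
  have bd: "\<forall>a. (f ^^ i) (normalize_dims \<mu>) a \<le> B" for i
    by (induction i) (use B exec_bounded[of _ B c] in \<open>auto simp: f_def\<close>)
  obtain r3 where r3: "runs_le ?p (Config ?q r2 ?\<mu>) (ebound (Ld answerA) B) (Config (?q + length ?ca) r3 ?\<mu>)"
      "r3 1 = eval (Ld answerA) (\<lambda>_. 0) ?\<mu>" "r3 0 = 0"
    using ecomp_correct[OF code(3), of r2 B ?\<mu>] r2(2) bd[of "Suc T"]
    by (auto simp del: ecomp.simps ebound.simps eval.simps funpow.simps)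
  have "r3 1 \<le> B" using r3(2) bd[of "Suc T"] by (simp del: funpow.simps)
  then have "runs_le ?p (Config (?q + length ?ca) r3 ?\<mu>) (B + 2) (Config (Suc (?q + length ?ca)) (r3(0 := r3 1)) ?\<mu>)"
    by (intro runs_le_stepI[OF code(4)]) (use r3(3) bit_length_bound[of "r3 1" B] in auto)
  from runs_le_trans[OF runs_le_trans[OF runs_le_trans[OF r1(1) r2(1)] r3(1)] this]
  obtain t where t: "runs ?p (Config 0 (\<lambda>_. 0) \<mu>) t (Config (Suc (?q + length ?ca)) (r3(0 := r3 1)) ?\<mu>)"
    "t \<le> 30 * (bit_length (\<mu> 0) + bit_length (\<mu> 1) + bit_length (\<mu> 2)) +
      Suc T * (cbound c B + ebound (Ld flagA) B + B + 1) + ebound (Ld answerA) B + (B + 2)"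
    unfolding runs_le_def by blast
  have "length ?p \<le> Suc (?q + length ?ca)" by (simp add: program_def len)
  then have "halts_in ?p (Config (Suc (?q + length ?ca)) (r3(0 := r3 1)) ?\<mu>) 0
      (Config (Suc (?q + length ?ca)) (r3(0 := r3 1)) ?\<mu>)" by (intro halts_in.halt) simp
  from runs_halts[OF t(1) this] show ?thesis
    using t(2) r3(2) by (intro exI[of _ t] exI[of _ "Config (Suc (?q + length ?ca)) (r3(0 := r3 1)) ?\<mu>"])
      (simp del: funpow.simps eval.simps ebound.simps)
qed

section \<open>Encoded instances and the total running time\<close>

lemma nth_entries:
  assumes "i < n" "j < m"
  shows "[g i j. i \<leftarrow> [0..<n], j \<leftarrow> [0..<m]] ! (i * m + j) = (g i j :: nat)"
  using assms(1)
proof (induction n)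
  case (Suc n)
  have len: "length [g i j. i \<leftarrow> [0..<n], j \<leftarrow> [0..<m]] = n * m"
    by (simp add: length_concat comp_def sum_list_triv)
  show ?case
  proof (cases "i < n")
    case True
    then show ?thesis using Suc.IH entry_less_mult[OF True assms(2)] len by (simp add: nth_append)
  next
    case False
    then have "i = n" using Suc.prems by simp
    then show ?thesis using len assms(2) by (simp add: nth_append)
  qed
qed simp

lemma length_encode: "length (encode_instance (M, d)) = 3 + dim_row M * dim_col M"
  by (simp add: encode_instance_def length_concat comp_def sum_list_triv)

lemma nth_encode:
  "encode_instance (M, d) ! 0 = dim_row M" "encode_instance (M, d) ! 1 = dim_col M"
  "encode_instance (M, d) ! 2 = d"
  "i < dim_row M \<Longrightarrow> j < dim_col M \<Longrightarrow> encode_instance (M, d) ! (3 + (i * dim_col M + j)) = M $$ (i, j)"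
  using nth_entries[of i "dim_row M" j "dim_col M" "\<lambda>i j. M $$ (i, j)"]
  by (simp_all add: encode_instance_def numeral_3_eq_3 numeral_2_eq_2)

lemma encode_entry:
  assumes "binary_mat M" "3 \<le> a" "a < length (encode_instance (M, d))"
  shows "encode_instance (M, d) ! a \<le> 1"
proof -
  let ?m = "dim_col M" and ?a = "a - 3"
  have a: "?a < dim_row M * ?m" using assms(2,3) length_encode[of M d] by simp
  then have m: "0 < ?m" by (cases ?m) auto
  have ij: "?a div ?m < dim_row M" "?a mod ?m < ?m" using a m by (simp_all add: less_mult_imp_div_less)
  have "a = 3 + (?a div ?m * ?m + ?a mod ?m)" using assms(2) by simp
  then have "encode_instance (M, d) ! a = M $$ (?a div ?m, ?a mod ?m)" using nth_encode(4)[OF ij] by metis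
  moreover have "M $$ (?a div ?m, ?a mod ?m) \<in> elements_mat M" using ij by (intro elements_matI) auto
  ultimately show ?thesis using assms(1) by (auto simp: binary_mat_def)
qed

lemma input_size_encode:
  "bit_length (dim_row M) + bit_length (dim_col M) + bit_length d \<le> input_size (encode_instance (M, d))"
  "length (encode_instance (M, d)) \<le> input_size (encode_instance (M, d))"
proof -
  show "bit_length (dim_row M) + bit_length (dim_col M) + bit_length d \<le> input_size (encode_instance (M, d))"
    by (simp add: input_size_def encode_instance_def)
  have "length xs \<le> input_size xs" for xs
  proof (induction xs)
    case (Cons x xs)
    then show ?case using bit_length_pos[of x] by (simp add: input_size_def)
  qed simp
  then show "length (encode_instance (M, d)) \<le> input_size (encode_instance (M, d))" .
qed

text \<open>Delete nothing or all rows; in both cases one dimension of the resulting matrix is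
  empty.\<close>

lemma trivial_instance:
  assumes "dim_col M = 0 \<or> dim_row M \<le> d"
  shows "(M, d) \<in> d_SC1S_R"
proof (cases "dim_col M = 0")
  case True
  have "SC1P (delete_rows {} M)"
    unfolding SC1P_delete_rows_iff[of "{}" M, OF empty_subsetI] using True
    by (auto simp: consec_by_def intro!: exI[of _ id])
  then show ?thesis unfolding d_SC1S_R_def by (auto intro!: exI[of _ "{}"])
next
  case False
  then have "card {..<dim_row M} \<le> d" using assms by simp
  moreover have "SC1P (delete_rows {..<dim_row M} M)"
    unfolding SC1P_delete_rows_iff[of "{..<dim_row M}" M, OF subset_refl]
    by (auto simp: consec_by_def intro!: exI[of _ id])
  ultimately show ?thesis unfolding d_SC1S_R_def by blast
qed

text \<open>The single bound \<open>B = N + b\<close>, where \<open>N\<close> is the input size,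
  covers the normalized memory and all caps. One round then costs a polynomial in \<open>N\<close>,
  and there are at most \<open>b ^ d\<close> rounds.\<close>

lemma fpt_branching:
  assumes b: "2 \<le> b" and bin: "\<And>M d. (M, d) \<in> I \<Longrightarrow> binary_mat M"
    and yes: "\<And>M d. (M, d) \<in> I \<Longrightarrow> dim_col M = 0 \<or> dim_row M \<le> d \<Longrightarrow> (M, d) \<in> Y"
    and br: "\<And>M d n m e. (M, d) \<in> I \<Longrightarrow> (if dim_col M = 0 \<or> dim_row M \<le> d then n = 0 \<and> m = 0 \<and> e = 0
        else n = dim_row M \<and> m = dim_col M \<and> e = d) \<Longrightarrow>
      \<exists>NV G pick. branching n m e (\<lambda>i j. M $$ (i, j) = 1) nv NV adj cand G pick b \<and>
        ((M, d) \<in> Y \<longleftrightarrow> (\<exists>S\<subseteq>{..<n}. card S \<le> e \<and> linear_forest {..<NV} (G S)))"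
  shows "fpt_in_time encode_instance snd I Y (\<lambda>d. b ^ d)"
proof -
  let ?c = "body_cmd nv adj cand b"
  define F where "F B = cbound ?c B + ebound (Ld flagA) B + B + 1 + (ebound (Ld answerA) B + B + 2)" for B
  have "poly_bounded F"
    unfolding F_def by (intro poly_bounded_intros poly_bounded_cbound poly_bounded_ebound)
  then obtain c k where F: "\<And>B. F B \<le> c * (B + 1) ^ k" unfolding poly_bounded_def by blast
  have kmax: "kmax ?c \<le> b"
    using b by (simp add: body_cmd_def copy_cmd_def step_cmd_def core_cmd_def peel_cmd_def delete_cmd_def
        check_cmd_def increment_cmd_def)
  have "\<exists>t s. halts_in (program ?c) (initial_config (encode_instance (M, d))) t s \<and>
      (accepting s \<longleftrightarrow> (M, d) \<in> Y) \<and>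
      t \<le> (30 + c * (b + 2) ^ k) * b ^ d * input_size (encode_instance (M, d)) ^ Suc k"
    if I: "(M, d) \<in> I" for M d
  proof -
    define xs where "xs = encode_instance (M, d)"
    define N where "N = input_size xs"
    define triv where "triv \<longleftrightarrow> dim_col M = 0 \<or> dim_row M \<le> d"
    define n where "n = (if triv then 0 else dim_row M)"
    define m where "m = (if triv then 0 else dim_col M)"
    define e where "e = (if triv then 0 else d)"
    let ?inc = "\<lambda>i j. M $$ (i, j) = 1"
    have "if dim_col M = 0 \<or> dim_row M \<le> d then n = 0 \<and> m = 0 \<and> e = 0
        else n = dim_row M \<and> m = dim_col M \<and> e = d"
      by (simp add: n_def m_def e_def triv_def)
    from br[OF I this] obtain NV G pick where G: "branching n m e ?inc nv NV adj cand G pick b"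
      "(M, d) \<in> Y \<longleftrightarrow> (\<exists>S\<subseteq>{..<n}. card S \<le> e \<and> linear_forest {..<NV} (G S))"
      by (elim exE conjE)
    interpret branching n m e ?inc nv NV adj cand G pick b by (rule G(1))
    define \<mu> where "\<mu> a = (if a < length xs then xs ! a else 0)" for a
    define \<nu> where "\<nu> = normalize_dims \<mu>"
    have len: "length xs = 3 + dim_row M * dim_col M" unfolding xs_def by (rule length_encode)
    have \<mu>: "\<mu> 0 = dim_row M" "\<mu> 1 = dim_col M" "\<mu> 2 = d"
      using nth_encode(1-3)[of M d] len by (simp_all add: \<mu>_def xs_def)
    have \<nu>: "\<nu> = (if triv then \<mu>(0 := 0, 1 := 0, 2 := 0) else \<mu>)"
      unfolding \<nu>_def normalize_dims_def \<mu> triv_def ..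
    have bit: "\<mu> a \<le> 1" if "3 \<le> a" for a
      using encode_entry[OF bin[OF I] that, of d] by (simp add: \<mu>_def xs_def)
    have in_ok: "input_ok \<nu>"
    proof (cases triv)
      case False
      have "M $$ (i, j) = of_bool (?inc i j)" if "i < dim_row M" "j < dim_col M" for i j

      proof -
        have "M $$ (i, j) \<in> elements_mat M" using that by (intro elements_matI) auto
        then show ?thesis using bin[OF I] by (auto simp: binary_mat_def)
      qed
      moreover have "\<mu> (3 + (i * m + j)) = M $$ (i, j)" if "i < n" "j < m" for i j
        using nth_encode(4)[of i M j d] that entry_less_mult[of i "dim_row M" j "dim_col M"] len False
        by (simp add: \<mu>_def xs_def n_def m_def)
      ultimately show ?thesis
        using False \<mu> unfolding input_ok_def has_dims_def by (simp add: \<nu> n_def m_def e_def)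
    next
      case True
      then show ?thesis unfolding input_ok_def has_dims_def by (simp add: \<nu> n_def m_def e_def)
    qed
    \<comment> \<open>A nontrivial input ends exactly where the first block ends, so the other
      blocks start out as zero; in particular the first guess is the word of zeros.\<close>
    have out: "\<nu> a = 0" if "L \<le> a" "\<not> triv" for a
      using that len unfolding L_def by (simp add: \<nu> \<mu>_def n_def m_def)
    have dig: "digits_ok (\<lambda>_. 0) \<nu>"
      unfolding digits_ok_def using out by (cases triv) (simp_all add: e_def)
    \<comment> \<open>If the dimensions were replaced by zero, then \<open>L = 3\<close>, and the
      answer cell at address 13 may hold a matrix entry. A one there makes the program accept, which
      is right since such an instance is a yes-instance.\<close>
    define ans where "ans \<longleftrightarrow> \<nu> (4 * L + 1) \<noteq> 0"
    have "\<nu> (4 * L + 1) \<le> 1" using bit[of "4 * L + 1"] by (auto simp: \<nu> L_def)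
    then have ans: "\<nu> (4 * L + 1) = of_bool ans" by (auto simp: ans_def)
    have noans: "ans \<Longrightarrow> (M, d) \<in> Y"

    proof -
      assume "ans"
      then have triv using out[of "4 * L + 1"] by (auto simp: ans_def)
      then show ?thesis using yes[OF I] by (simp add: triv_def)
    qed
    define f where "f = exec ?c (\<lambda>_. 0)"
    note it = iterate_body_correct[OF in_ok dig ans, where \<eta> = "\<lambda>_. 0", folded f_def]
    have "b ^ e \<noteq> 0" using b by simp
    then obtain T where T: "b ^ e = Suc T" using not0_implies_Suc by blast
    have ev: "eval (Ld flagA) (\<lambda>_. 0) ((f ^^ i) \<nu>) = (f ^^ i) \<nu> (4 * L)"
      "eval (Ld answerA) (\<lambda>_. 0) ((f ^^ i) \<nu>) = (f ^^ i) \<nu> (4 * L + 1)" for i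
      using eval_addresses(4,5)[OF it(4)[of i]] by simp_all
    have Nlen: "length xs \<le> N" unfolding N_def xs_def by (rule input_size_encode)
    \<comment> \<open>Once trivial instances are set aside, the dimensions and \<open>d\<close> are
      at most the number of entries. The summand \<open>b\<close> covers the caps.\<close>
    have \<nu>B: "\<nu> a \<le> N + b" for a
    proof (cases "3 \<le> a")
      case True
      then show ?thesis using bit[OF True] b by (simp add: \<nu>)
    next
      case False
      have "dim_row M \<le> N \<and> dim_col M \<le> N \<and> d \<le> N" if "\<not> triv"
      proof -
        have "0 < dim_col M" "0 < dim_row M" "d < dim_row M" using that by (auto simp: triv_def)
        then have "dim_row M \<le> dim_row M * dim_col M" "dim_col M \<le> dim_row M * dim_col M" by simp_all
        then show ?thesis using Nlen len \<open>d < dim_row M\<close> by linarith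
      qed
      moreover have "a = 0 \<or> a = 1 \<or> a = 2" using False by linarith
      ultimately show ?thesis using \<mu> by (auto simp: \<nu>)
    qed
    have "\<exists>t s. halts_in (program ?c) (Config 0 (\<lambda>_. 0) \<mu>) t s \<and>
      regs s 0 = eval (Ld answerA) (\<lambda>_. 0) ((f ^^ Suc T) \<nu>) \<and>
      t \<le> 30 * (bit_length (\<mu> 0) + bit_length (\<mu> 1) + bit_length (\<mu> 2)) +
        Suc T * (cbound ?c (N + b) + ebound (Ld flagA) (N + b) + (N + b) + 1) + (ebound (Ld answerA) (N + b) + (N + b) + 2)"
      unfolding \<nu>_def f_def
    proof (rule program_correct, unfold \<nu>_def[symmetric] f_def[symmetric])
      show "kmax ?c \<le> N + b" using kmax by simp
      show "\<forall>a. \<nu> a \<le> N + b" using \<nu>B by blast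
      show "\<forall>i. i < T \<longrightarrow> eval (Ld flagA) (\<lambda>_. 0) ((f ^^ Suc i) \<nu>) = 0"
        unfolding ev using it(1)[unfolded T] by (metis Suc_less_eq nat.distinct(1))
      show "eval (Ld flagA) (\<lambda>_. 0) ((f ^^ Suc T) \<nu>) \<noteq> 0"
        unfolding ev using it(2)[unfolded T] .
    qed
    then obtain t s where ts: "halts_in (program ?c) (Config 0 (\<lambda>_. 0) \<mu>) t s"
      "regs s 0 = (f ^^ Suc T) \<nu> (4 * L + 1)"
      "t \<le> 30 * (bit_length (\<mu> 0) + bit_length (\<mu> 1) + bit_length (\<mu> 2)) +
        Suc T * (cbound ?c (N + b) + ebound (Ld flagA) (N + b) + (N + b) + 1) + (ebound (Ld answerA) (N + b) + (N + b) + 2)"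
      unfolding ev by blast
    have init: "initial_config xs = Config 0 (\<lambda>_. 0) \<mu>"
      unfolding initial_config_def \<mu>_def[abs_def] ..
    have "accepting s \<longleftrightarrow> (M, d) \<in> Y"
      unfolding accepting_def ts(2) it(3)[unfolded T] G(2)[symmetric] using noans by auto
    moreover have "t \<le> (30 + c * (b + 2) ^ k) * b ^ d * N ^ Suc k"
    proof -
      define A where "A = ebound (Ld answerA) (N + b) + (N + b) + 2"
      define I where "I = cbound ?c (N + b) + ebound (Ld flagA) (N + b) + (N + b) + 1"
      have N: "1 \<le> N" using Nlen len by simp
      have b1: "1 \<le> b ^ d" using b by simp
      have e: "Suc T \<le> b ^ d" using b unfolding T[symmetric] by (intro power_increasing) (auto simp: e_def)
      have "Suc T * I + 1 * A \<le> b ^ d * I + b ^ d * A" by (intro add_mono mult_le_mono e b1 le_refl)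
      also have "\<dots> = b ^ d * F (N + b)" by (simp only: F_def A_def I_def add_mult_distrib2)
      also have "\<dots> \<le> b ^ d * (c * (N + b + 1) ^ k)" using F[of "N + b"] by (intro mult_le_mono2) simp
      also have "\<dots> \<le> b ^ d * (c * ((b + 2) * N) ^ k)"
      proof -
        \<comment> \<open>Since \<open>N \<ge> 1\<close>, the offset \<open>b + 1\<close> can be
          absorbed into the constant factor, which gives \<open>(b + 2) ^ k\<close>.\<close>
        have "b \<le> b * N" using N by simp
        then have "N + b + 1 \<le> (b + 2) * N" using N unfolding add_mult_distrib by linarith
        then show ?thesis by (intro mult_le_mono2 power_mono) auto
      qed
      also have "\<dots> = c * (b + 2) ^ k * b ^ d * N ^ k" by (simp only: power_mult_distrib mult_ac)
      also have "\<dots> \<le> c * (b + 2) ^ k * b ^ d * N ^ Suc k"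
        using N by (intro mult_le_mono2 power_increasing) auto
      finally have 1: "Suc T * I + A \<le> c * (b + 2) ^ k * b ^ d * N ^ Suc k" by (simp only: mult_1)
      have "30 * (bit_length (\<mu> 0) + bit_length (\<mu> 1) + bit_length (\<mu> 2)) \<le> 30 * N"
        unfolding \<mu> N_def xs_def by (intro mult_le_mono2 input_size_encode)
      also have "\<dots> \<le> 30 * b ^ d * N ^ Suc k"
      proof -
        \<comment> \<open>The prologue is linear in \<open>N\<close>; the exponent
          \<open>Suc k\<close> leaves room for it even if \<open>k = 0\<close>.\<close>
        have "N * 1 \<le> N ^ Suc k" using N by (simp only: power_Suc) (intro mult_le_mono2 one_le_power)
        then have "1 * N \<le> b ^ d * N ^ Suc k" using b1 by (intro mult_le_mono) auto
        then show ?thesis by simp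
      qed
      finally have "t \<le> 30 * b ^ d * N ^ Suc k + c * (b + 2) ^ k * b ^ d * N ^ Suc k"
        using 1 ts(3) unfolding A_def I_def by linarith
      then show ?thesis by (simp only: add_mult_distrib)
    qed
    ultimately show ?thesis using ts(1) init unfolding N_def xs_def by auto
  qed
  then show ?thesis
    unfolding fpt_in_time_def
    by (intro exI[of _ "program ?c"] exI[of _ "30 + c * (b + 2) ^ k"] exI[of _ "Suc k"]) auto
qed

lemma ram_layout_dims:
  assumes "if dim_col M = 0 \<or> dim_row M \<le> d then n = 0 \<and> m = 0 \<and> e = 0
      else n = dim_row M \<and> m = dim_col M \<and> e = d"
  shows "ram_layout n m e"
  using assms by unfold_locales (auto split: if_splits)

theorem theorem10:
  shows "fpt_in_time encode_instance snd {(M, d). binary_mat M \<and> two_star_mat M} d_SC1S_R (\<lambda>d. 4 ^ d)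
       \<and> fpt_in_time encode_instance snd {(M, d). binary_mat M \<and> star_two_mat M} d_SC1S_R (\<lambda>d. 3 ^ d)"
proof
  show "fpt_in_time encode_instance snd {(M, d). binary_mat M \<and> two_star_mat M} d_SC1S_R (\<lambda>d. 4 ^ d)"
  proof (rule fpt_branching[where nv = nE and adj = row_adj and cand = row_cand])
    fix M d n m e
    assume I: "(M, d) \<in> {(M, d). binary_mat M \<and> two_star_mat M}"
      and dims: "if dim_col M = 0 \<or> dim_row M \<le> d then n = 0 \<and> m = 0 \<and> e = 0
        else n = dim_row M \<and> m = dim_col M \<and> e = d"
    let ?inc = "\<lambda>i j. M $$ (i, j) = 1"
    have "(M, d) \<in> d_SC1S_R \<longleftrightarrow> (\<exists>S\<subseteq>{..<n}. card S \<le> e \<and> linear_forest {..<n} (row_graph ?inc n m S))"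
    proof (cases "dim_col M = 0 \<or> dim_row M \<le> d")
      case True
      \<comment> \<open>Both sides hold: the graph without vertices is a linear forest, with nothing
        deleted.\<close>
      then show ?thesis using dims trivial_instance[OF True] by (simp add: linear_forest_def)
    next
      case False
      then have nme: "n = dim_row M" "m = dim_col M" "e = d" using dims by auto
      have "SC1P (delete_rows S M) \<longleftrightarrow> linear_forest {..<n} (row_graph ?inc n m S)" if "S \<subseteq> {..<n}" for S
        using SC1P_two_star_iff[of M S] I that unfolding nme by simp
      then show ?thesis unfolding d_SC1S_R_def nme by auto
    qed
    then show "\<exists>NV G pick. branching n m e ?inc nE NV row_adj row_cand G pick 4 \<and>
        ((M, d) \<in> d_SC1S_R \<longleftrightarrow> (\<exists>S\<subseteq>{..<n}. card S \<le> e \<and> linear_forest {..<NV} (G S)))"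
      using ram_layout.row_branching[OF ram_layout_dims[OF dims], of ?inc] by blast
  qed (auto simp: trivial_instance)
  show "fpt_in_time encode_instance snd {(M, d). binary_mat M \<and> star_two_mat M} d_SC1S_R (\<lambda>d. 3 ^ d)"
  proof (rule fpt_branching[where nv = mE and adj = col_adj and cand = col_cand])
    fix M d n m e
    assume I: "(M, d) \<in> {(M, d). binary_mat M \<and> star_two_mat M}"
      and dims: "if dim_col M = 0 \<or> dim_row M \<le> d then n = 0 \<and> m = 0 \<and> e = 0
        else n = dim_row M \<and> m = dim_col M \<and> e = d"
    let ?inc = "\<lambda>i j. M $$ (i, j) = 1"
    have two: "\<forall>i<n. card {j. j < m \<and> ?inc i j} \<le> 2"
      using I dims by (auto simp: star_two_mat_def split: if_splits)
    have "(M, d) \<in> d_SC1S_R \<longleftrightarrow> (\<exists>S\<subseteq>{..<n}. card S \<le> e \<and> linear_forest {..<m} (col_graph ?inc n m S))"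
    proof (cases "dim_col M = 0 \<or> dim_row M \<le> d")
      case True
      then show ?thesis using dims trivial_instance[OF True] by (simp add: linear_forest_def)
    next
      case False
      then have nme: "n = dim_row M" "m = dim_col M" "e = d" using dims by auto
      have "SC1P (delete_rows S M) \<longleftrightarrow> linear_forest {..<m} (col_graph ?inc n m S)" if "S \<subseteq> {..<n}" for S
        using SC1P_star_two_iff[of M S] I that unfolding nme by simp
      then show ?thesis unfolding d_SC1S_R_def nme by auto
    qed
    then show "\<exists>NV G pick. branching n m e ?inc mE NV col_adj col_cand G pick 3 \<and>
        ((M, d) \<in> d_SC1S_R \<longleftrightarrow> (\<exists>S\<subseteq>{..<n}. card S \<le> e \<and> linear_forest {..<NV} (G S)))"
      using ram_layout.col_branching[OF ram_layout_dims[OF dims] two] by blast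
  qed (auto simp: trivial_instance)
qed

end
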